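(* Let $\gamma>0$, $a>3$, $\tau>4$, and let $b\in\ell^\infty(\mathbb{Z}^+,\mathbb{R})$ be such that $|b(n)|\le\gamma a^{-\tau n}$ for all $n\ge1$. Then there exists $\epsilon>0$, depending only on $b$, such that for each $\kappa\in\mathbb{R}$ with $|\kappa|<\epsilon$ the following hold. 1. The half-line Schrödinger operator $H_{\pi/4}^\kappa=\triangle+\kappa b$ on $\ell^2(\mathbb{Z}^+)$ with boundary condition $u(0)\cos(\pi/4)+u(1)\sin(\pi/4)=0$ satisfies: (i) its spectrum is purely absolutely continuous on $[-2,2]$; (ii) for each $\psi=f(H_{\pi/4}^\kappa)\delta_1$ with $f\in C([-2,2])$, the associated spectral measure $\mu_\psi^{\pi/4}$ is $\frac12$-Hölder continuous; (iii) for each $\psi=f(H_{\pi/4}^\kappa)\delta_1$ with $f\in C([-2,2])$, there exists $\gamma'>0$ such that for each $t>2$, $$\frac1t\int_0^t|\langle\psi,e^{-isH_{\pi/4}^\kappa}\psi\rangle|^2\,ds\le\gamma'\,\frac{\log(t)}{t}.$$ 2. The half-line Schrödinger operator $H_+^\kappa=\triangle+\kappa b$ on $\ell^2(\mathbb{Z}^+)$ with Dirichlet boundary condition $u(0)=0$ satisfies: (i) its spectrum is purely absolutely continuous on $[-2,2]$; (ii) for each $\psi=f(H_+^\kappa)\delta_1$ with $f\in C([-2,2])$, its spectral measure $\mu_\psi^+$ is Lipschitz continuous; (iii) for each $\psi=f(H_+^\kappa)\delta_1$ with $f\in C([-2,2])$, there exists $\eta>0$ such that for each $t>0$, $$\f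rac1t\int_0^t|\langle\psi,e^{-isH_+^\kappa}\psi\rangle|^2\,ds\le\eta\,\frac1t.$$
   Context: $\mathbb{Z}^+=\{1,2,3,\dots\}$ and $\{\delta_n\}$ is the canonical basis of $\ell^2(\mathbb{Z}^+)$. For a bounded real potential $V$ and $\beta\in(-\pi/2,\pi/2)$, the half-line operator $\triangle+V$ with boundary condition $u(0)\cos\beta+u(1)\sin\beta=0$ acts on $\ell^2(\mathbb{Z}^+)$ by $u\mapsto u(n+1)+u(n-1)+V(n)u(n)$, $n\ge1$, where $u(0)$ is determined from $u(1)$ by the boundary condition. $C([-2,2])$ is the space of complex-valued continuous functions on $[-2,2]$. The operators may have eigenvalues outside $[-2,2]$; only the part of the spectrum in $[-2,2]$ is considered, so for $f\in C([-2,2])$, $f(H)\delta_1$ is defined by the functional calculus with $f$ extended by $0$ outside $[-2,2]$. The spectrum of $H$ being purely absolutely continuous on $[-2,2]$ means that the restrictions to $[-2,2]$ of the spectral measures of $H$ are absolutely continuous with respect to Lebesgue measure. For a vector $\psi$, its spectral measure $\mu_\psi$ is the measure with $\langle\psi,g(H)\psi\rangle=\int g\,d\mu_\psi$ for bounded Borel $g$. A positive Borel measure $\mu$ on $\mathbb{R}$ is $\alpha$-Hölder continuous ($\alpha\in[0,1]$) if there is a constant $C>0$ with $\mu(I)<C|I|^\alpha$ for every interval $I$ with $|I|<1$ ($|\cdot|$ is Lebesgue measure); for $\alpha=1$ it is called Lipschitz continuous. *)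

theory Defs
  imports "HOL-Analysis.Analysis"
begin

section \<open>The Hilbert space of square-summable sequences on the positive integers\<close>

text \<open>
  The positive integers are the indices \<open>n \<ge> 1\<close> of type \<^typ>\<open>nat\<close>. So that each vector has
  exactly one representative, its value at the unused index \<open>0\<close> is required to be \<open>0\<close>; this is
  unrelated to the boundary value \<open>u(0)\<close> below.
\<close>

definition ell2 :: "(nat \<Rightarrow> complex) set" where
  "ell2 = {u. u 0 = 0 \<and> summable (\<lambda>n. (cmod (u n))\<^sup>2)}"

text \<open>Conjugate-linear in the first argument.\<close>

definition ell2_inner :: "(nat \<Rightarrow> complex) \<Rightarrow> (nat \<Rightarrow> complex) \<Rightarrow> complex" where
  "ell2_inner u v = (\<Sum>n. cnj (u n) * v n)"

definition ell2_norm :: "(nat \<Rightarrow> complex) \<Rightarrow> real" where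
  "ell2_norm u = sqrt (\<Sum>n. (cmod (u n))\<^sup>2)"

definition delta :: "nat \<Rightarrow> nat \<Rightarrow> complex" where
  "delta k = (\<lambda>n. if n = k then 1 else 0)"

type_synonym ell2_op = "(nat \<Rightarrow> complex) \<Rightarrow> (nat \<Rightarrow> complex)"

definition bounded_op :: "ell2_op \<Rightarrow> bool" where
  "bounded_op T \<longleftrightarrow>
     (\<forall>u\<in>ell2. T u \<in> ell2) \<and>
     (\<forall>u\<in>ell2. \<forall>v\<in>ell2. T (\<lambda>n. u n + v n) = (\<lambda>n. T u n + T v n)) \<and>
     (\<forall>c. \<forall>u\<in>ell2. T (\<lambda>n. c * u n) = (\<lambda>n. c * T u n)) \<and>
     (\<exists>K. \<forall>u\<in>ell2. ell2_norm (T u) \<le> K * ell2_norm u)"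


section \<open>Half-line Schroedinger operators\<close>

text \<open>
  For \<open>\<beta>\<close> in \<open>(-pi/2, pi/2)\<close> the boundary condition \<open>u(0) cos \<beta> + u(1) sin \<beta> = 0\<close> determines
  \<open>u(0)\<close> from \<open>u(1)\<close>; \<open>\<beta> = 0\<close> is the Dirichlet condition \<open>u(0) = 0\<close>.
\<close>

definition extend_bc :: "real \<Rightarrow> (nat \<Rightarrow> complex) \<Rightarrow> nat \<Rightarrow> complex" where
  "extend_bc \<beta> u = u(0 := - of_real (tan \<beta>) * u 1)"

lemma extend_bc_iff:
  assumes "- pi / 2 < \<beta>" "\<beta> < pi / 2" "\<And>n. n \<ge> 1 \<Longrightarrow> w n = u n"
  shows "w = extend_bc \<beta> u \<longleftrightarrow> w 0 * of_real (cos \<beta>) + w 1 * of_real (sin \<beta>) = 0"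
proof -
  have c: "cos \<beta> \<noteq> 0"
    using assms(1,2) cos_gt_zero_pi[of \<beta>] by simp
  have "w = extend_bc \<beta> u \<longleftrightarrow> w 0 = - of_real (tan \<beta>) * u 1"
    using assms(3) by (auto simp: extend_bc_def fun_eq_iff)
  also have "\<dots> \<longleftrightarrow> w 0 * of_real (cos \<beta>) + w 1 * of_real (sin \<beta>) = 0"
    using c assms(3)[of 1] by (simp add: tan_def field_simps eq_neg_iff_add_eq_0)
  finally show ?thesis .
qed

definition schroedinger :: "real \<Rightarrow> (nat \<Rightarrow> real) \<Rightarrow> ell2_op" where
  "schroedinger \<beta> V u = (\<lambda>n. if n = 0 then 0
     else extend_bc \<beta> u (n + 1) + extend_bc \<beta> u (n - 1) + of_real (V n) * u n)"

abbreviation schroedinger_dirichlet :: "(nat \<Rightarrow> real) \<Rightarrow> ell2_op" where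
  "schroedinger_dirichlet V \<equiv> schroedinger 0 V"


section \<open>Borel functional calculus and spectral measures\<close>

definition bounded_borel :: "(real \<Rightarrow> complex) set" where
  "bounded_borel = {g \<in> borel_measurable borel. bounded (range g)}"

text \<open>
  The defining properties of the Borel functional calculus \<open>g \<mapsto> g(H)\<close> of a bounded self-adjoint
  operator \<open>H\<close>: a unital *-homomorphism, sequentially continuous from bounded pointwise convergence
  to strong convergence, which sends the coordinate function to \<open>H\<close>. The coordinate function is
  not bounded on the whole line, so the last clause refers to bounded functions that agree with it
  on \<open>[-R, R]\<close> where \<open>R\<close> bounds the norm of \<open>H\<close>. By the spectral theorem such a map exists, and
  these properties determine \<open>g(H) u\<close> for bounded Borel \<open>g\<close> and \<open>u\<close> in \<open>ell2\<close>.
\<close>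

definition is_borel_calculus :: "ell2_op \<Rightarrow> ((real \<Rightarrow> complex) \<Rightarrow> ell2_op) \<Rightarrow> bool" where
  "is_borel_calculus H \<Phi> \<longleftrightarrow>
     (\<forall>g\<in>bounded_borel. bounded_op (\<Phi> g)) \<and>
     (\<forall>u\<in>ell2. \<Phi> (\<lambda>x. 1) u = u) \<and>
     (\<forall>g\<in>bounded_borel. \<forall>h\<in>bounded_borel. \<forall>u\<in>ell2.
        \<Phi> (\<lambda>x. g x + h x) u = (\<lambda>n. \<Phi> g u n + \<Phi> h u n)) \<and>
     (\<forall>c. \<forall>g\<in>bounded_borel. \<forall>u\<in>ell2. \<Phi> (\<lambda>x. c * g x) u = (\<lambda>n. c * \<Phi> g u n)) \<and>
     (\<forall>g\<in>bounded_borel. \<forall>h\<in>bounded_borel. \<forall>u\<in>ell2. \<Phi> (\<lambda>x. g x * h x) u = \<Phi> g (\<Phi> h u)) \<and>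
     (\<forall>g\<in>bounded_borel. \<forall>u\<in>ell2. \<forall>v\<in>ell2.
        ell2_inner (\<Phi> g u) v = ell2_inner u (\<Phi> (\<lambda>x. cnj (g x)) v)) \<and>
     (\<forall>gs g M. (\<forall>k. gs k \<in> bounded_borel) \<and> (\<forall>k x. cmod (gs k x) \<le> M) \<and>
        (\<forall>x. (\<lambda>k. gs k x) \<longlonglongrightarrow> g x) \<longrightarrow>
        (\<forall>u\<in>ell2. (\<lambda>k. ell2_norm (\<lambda>n. \<Phi> (gs k) u n - \<Phi> g u n)) \<longlonglongrightarrow> 0)) \<and>
     (\<forall>R. \<forall>g\<in>bounded_borel.
        (\<forall>u\<in>ell2. ell2_norm (H u) \<le> R * ell2_norm u) \<and>
        (\<forall>x\<in>{-R..R}. g x = of_real x) \<longrightarrow>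
        (\<forall>u\<in>ell2. \<Phi> g u = H u))"

definition borel_calculus :: "ell2_op \<Rightarrow> (real \<Rightarrow> complex) \<Rightarrow> ell2_op" where
  "borel_calculus H = (SOME \<Phi>. is_borel_calculus H \<Phi>)"

definition spectral_measure :: "ell2_op \<Rightarrow> (nat \<Rightarrow> complex) \<Rightarrow> real measure" where
  "spectral_measure H \<psi> = (THE \<mu>. sets \<mu> = sets borel \<and> finite_measure \<mu> \<and>
     (\<forall>g\<in>bounded_borel. ell2_inner \<psi> (borel_calculus H g \<psi>) = (LINT x|\<mu>. g x)))"

definition purely_ac_on :: "ell2_op \<Rightarrow> real set \<Rightarrow> bool" where
  "purely_ac_on H S \<longleftrightarrow>
     (\<forall>\<psi>\<in>ell2. absolutely_continuous lborel (density (spectral_measure H \<psi>) (indicator S)))"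

text \<open>\<open>f(H) \<delta>\<^sub>1\<close> for \<open>f\<close> in \<open>C([-2,2])\<close>, with \<open>f\<close> extended by \<open>0\<close> outside \<open>[-2,2]\<close>.\<close>

definition calc_delta1 :: "ell2_op \<Rightarrow> (real \<Rightarrow> complex) \<Rightarrow> nat \<Rightarrow> complex" where
  "calc_delta1 H f = borel_calculus H (\<lambda>x. if x \<in> {-2..2} then f x else 0) (delta 1)"

definition evolution :: "ell2_op \<Rightarrow> real \<Rightarrow> ell2_op" where
  "evolution H s = borel_calculus H (\<lambda>x. exp (- \<i> * of_real s * of_real x))"

definition avg_return_prob :: "ell2_op \<Rightarrow> (nat \<Rightarrow> complex) \<Rightarrow> real \<Rightarrow> real" where
  "avg_return_prob H \<psi> t =
     1 / t * integral {0..t} (\<lambda>s. (cmod (ell2_inner \<psi> (evolution H s \<psi>)))\<^sup>2)"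


section \<open>Hoelder continuity of measures\<close>

text \<open>
  Intervals of length \<open>0\<close> are excluded: for \<open>\<alpha> > 0\<close> the strict inequality would be unsatisfiable
  on them. Nothing is lost, since a point or the empty set is contained in arbitrarily short
  intervals of positive length.
\<close>

definition holder_continuous_measure :: "real \<Rightarrow> real measure \<Rightarrow> bool" where
  "holder_continuous_measure \<alpha> \<mu> \<longleftrightarrow>
     (\<exists>C>0. \<forall>I. is_interval I \<and> 0 < emeasure lborel I \<and> emeasure lborel I < 1 \<longrightarrow>
        emeasure \<mu> I < ennreal (C * measure lborel I powr \<alpha>))"

abbreviation lipschitz_continuous_measure :: "real measure \<Rightarrow> bool" where
  "lipschitz_continuous_measure \<mu> \<equiv> holder_continuous_measure 1 \<mu>"

end

theory Submission
  imports Defs "HOL-Probability.Probability"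
begin

text \<open>
  The operator is a bounded Jacobi matrix, and \<open>\<delta>\<^sub>1\<close> is cyclic. Its spectral measure is the solution of a
  Hausdorff moment problem (the moments of the rescaled operator \<open>T = (H + R)/(2R)\<close> are completely monotone because
  \<open>0 \<le> T \<le> 1\<close>), and the Borel functional calculus is given by the matrices
  \<open>\<integral> g p\<^sub>n p\<^sub>k d\<mu>\<close>, where \<open>p\<^sub>n\<close> are the orthonormal polynomials.

  For \<open>E = z + 1/z\<close> with \<open>|z| < 1\<close>, the Jost solution \<open>f\<close> satisfies \<open>(H - E) f = - F \<delta>\<^sub>1\<close> with the Jost function
  \<open>F = f\<^sub>0 + f\<^sub>1 tan \<beta>\<close>, so the Borel transform of \<open>\<mu>\<close> is \<open>- f\<^sub>1 / F\<close>. For a small perturbation \<open>F\<close> is close to \<open>1\<close> in the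
  Dirichlet case, and bounded below by a multiple of \<open>|1 + z|\<close> near the unit circle if \<open>\<beta> = \<pi>/4\<close>.
  Hence on \<open>[-2, 2]\<close> the measure is dominated by a constant, respectively by a multiple of
  \<open>(2 + x)\<^sup>-\<^sup>1\<^sup>/\<^sup>2\<close>, which gives the regularity of the spectral measures. The return probabilities follow by a
  Schur test with the Fejer kernel, after removing the mass of \<open>x + 2 < 1/t\<close> in the second case.
\<close>

section \<open>Square-summable sequences\<close>

text \<open>The calculus is selected by \<open>SOME\<close> and the spectral measure by
  \<open>THE\<close>, so neither carries information until existence is proved (for the measure also
  uniqueness); this is why the spectral theorem for these matrices is built up first. Afterwards
  only the defining properties of the calculus are used.

  The difficulty is one resonance. For the free operator with \<beta> = \<pi>/4 the Jost function is
  1 + z, which vanishes at z = -1, the band edge E = -2. A perturbation may push this zero off the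
  unit circle to either side, and on one side it stands for an eigenvalue below -2. The lower bound
  must therefore hold near the circle whatever the sign of the shift. Under the Dirichlet condition
  the free Jost function is the constant 1, and smallness of the perturbation is enough.

  The logarithm has its origin in the density (2 + x)^(-1/2): it is integrable, but its square
  misses integrability at -2 by exactly a logarithm, so cutting at distance 1/t costs log t.\<close>

lemma ell2_zero: "u \<in> ell2 \<Longrightarrow> u 0 = 0"
  by (simp add: ell2_def)

lemma ell2_summable: "u \<in> ell2 \<Longrightarrow> summable (\<lambda>n. (cmod (u n))\<^sup>2)"
  by (simp add: ell2_def)

lemma ell2_norm_nonneg: "u \<in> ell2 \<Longrightarrow> 0 \<le> ell2_norm u"
  by (simp add: ell2_norm_def ell2_summable suminf_nonneg)

lemma ell2_norm_sq: "u \<in> ell2 \<Longrightarrow> (ell2_norm u)\<^sup>2 = (\<Sum>n. (cmod (u n))\<^sup>2)"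
  by (simp add: ell2_norm_def ell2_summable suminf_nonneg)

lemma L2_set_le_ell2_norm:
  assumes "u \<in> ell2" "finite A"
  shows "L2_set (\<lambda>n. cmod (u n)) A \<le> ell2_norm u"
  unfolding L2_set_def ell2_norm_def
  by (intro real_sqrt_le_mono sum_le_suminf ell2_summable assms) auto

lemma cmod_le_ell2_norm: "u \<in> ell2 \<Longrightarrow> cmod (u k) \<le> ell2_norm u"
  using L2_set_le_ell2_norm[of u "{k}"] by simp

text \<open>Membership and norm bound come together from initial segments, so that operator
  estimates reduce to inequalities for \<open>L2_set\<close> on finite sets.\<close>

lemma ell2_bounded_partial:
  assumes "u 0 = 0" "\<And>N. L2_set (\<lambda>n. cmod (u n)) {..<N} \<le> C"
  shows "u \<in> ell2" "ell2_norm u \<le> C"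
proof -
  have C: "0 \<le> C" using assms(2)[of 0] by simp
  have b: "(\<Sum>n<N. (cmod (u n))\<^sup>2) \<le> C\<^sup>2" for N
    using assms(2)[of N] unfolding L2_set_def by (rule sqrt_le_D)
  have s: "summable (\<lambda>n. (cmod (u n))\<^sup>2)"
    using b by (intro summableI_nonneg_bounded[where x="C\<^sup>2"]) auto
  show "u \<in> ell2" using s assms(1) by (simp add: ell2_def)
  have "(\<Sum>n. (cmod (u n))\<^sup>2) \<le> C\<^sup>2"
    by (rule suminf_le_const[OF s b])
  then show "ell2_norm u \<le> C"
    using C unfolding ell2_norm_def by (intro real_le_lsqrt)
qed

lemma L2_set_add_le:
  assumes "u \<in> ell2" "v \<in> ell2" "finite A"
  shows "L2_set (\<lambda>n. cmod (u n + v n)) A \<le> ell2_norm u + ell2_norm v"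
proof -
  have "L2_set (\<lambda>n. cmod (u n + v n)) A \<le> L2_set (\<lambda>n. cmod (u n) + cmod (v n)) A"
    by (intro L2_set_mono) (auto intro: norm_triangle_ineq)
  also have "\<dots> \<le> L2_set (\<lambda>n. cmod (u n)) A + L2_set (\<lambda>n. cmod (v n)) A"
    by (rule L2_set_triangle_ineq)
  finally show ?thesis
    using L2_set_le_ell2_norm[OF assms(1,3)] L2_set_le_ell2_norm[OF assms(2,3)] by linarith
qed

lemma ell2_add: 
  assumes "u \<in> ell2" "v \<in> ell2" shows "(\<lambda>n. u n + v n) \<in> ell2"
  using L2_set_add_le[OF assms] assms
  by (intro ell2_bounded_partial(1)[where C="ell2_norm u + ell2_norm v"]) (auto simp: ell2_zero)

lemma ell2_norm_triangle:
  assumes "u \<in> ell2" "v \<in> ell2"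
  shows "ell2_norm (\<lambda>n. u n + v n) \<le> ell2_norm u + ell2_norm v"
  using L2_set_add_le[OF assms] assms
  by (intro ell2_bounded_partial(2)) (auto simp: ell2_zero)

lemma ell2_scale: "u \<in> ell2 \<Longrightarrow> (\<lambda>n. c * u n) \<in> ell2"
  by (auto simp: ell2_def norm_mult power_mult_distrib intro!: summable_mult)

lemma ell2_norm_scale: "u \<in> ell2 \<Longrightarrow> ell2_norm (\<lambda>n. c * u n) = cmod c * ell2_norm u"
  by (simp add: ell2_norm_def norm_mult power_mult_distrib suminf_mult ell2_summable real_sqrt_mult)

lemma ell2_diff: 
  assumes "u \<in> ell2" "v \<in> ell2" shows "(\<lambda>n. u n - v n) \<in> ell2"
  using ell2_add[OF assms(1) ell2_scale[OF assms(2), of "-1"]] by simp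

lemma ell2_zero_seq: "(\<lambda>n. 0) \<in> ell2" and ell2_norm_zero_seq: "ell2_norm (\<lambda>n. 0) = 0"
  by (simp_all add: ell2_def ell2_norm_def)

lemma delta_apply: "delta k n = (if n = k then 1 else 0)"
  by (simp add: delta_def)

lemma delta_ell2: "k \<ge> 1 \<Longrightarrow> delta k \<in> ell2"
  by (auto simp: ell2_def delta_def split: if_splits intro!: summable_finite[of "{k}"])

lemma summable_ell2_mult:
  assumes "u \<in> ell2" "v \<in> ell2"
  shows "summable (\<lambda>n. cmod (u n) * cmod (v n))"
proof (rule summable_comparison_test')
  show "summable (\<lambda>n. (cmod (u n))\<^sup>2 + (cmod (v n))\<^sup>2)"
    using assms by (intro summable_add ell2_summable)
  show "norm (cmod (u n) * cmod (v n)) \<le> (cmod (u n))\<^sup>2 + (cmod (v n))\<^sup>2" if "n \<ge> 0" for n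
  proof -
    have "0 \<le> cmod (u n) * cmod (v n)" by simp
    then show ?thesis
      using sum_squares_bound[of "cmod (u n)" "cmod (v n)"] unfolding real_norm_def by linarith
  qed
qed

lemma summable_ell2_inner:
  assumes "u \<in> ell2" "v \<in> ell2"
  shows "summable (\<lambda>n. cnj (u n) * v n)"
  by (rule summable_norm_cancel) (use summable_ell2_mult[OF assms] in \<open>simp add: norm_mult\<close>)

lemma ell2_Cauchy_Schwarz:
  assumes "u \<in> ell2" "v \<in> ell2"
  shows "cmod (ell2_inner u v) \<le> ell2_norm u * ell2_norm v"
proof -
  have "cmod (ell2_inner u v) \<le> (\<Sum>n. cmod (cnj (u n) * v n))"
    unfolding ell2_inner_def
    by (rule summable_norm) (use summable_ell2_mult[OF assms] in \<open>simp add: norm_mult\<close>)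
  also have "\<dots> \<le> ell2_norm u * ell2_norm v"
  proof (rule suminf_le_const)
    show "summable (\<lambda>n. cmod (cnj (u n) * v n))"
      using summable_ell2_mult[OF assms] by (simp add: norm_mult)
    fix N
    have "(\<Sum>n<N. cmod (cnj (u n) * v n)) \<le> L2_set (\<lambda>n. cmod (u n)) {..<N} * L2_set (\<lambda>n. cmod (v n)) {..<N}"
      using L2_set_mult_ineq[of "\<lambda>n. cmod (u n)" "\<lambda>n. cmod (v n)" "{..<N}"] by (simp add: norm_mult)
    also have "\<dots> \<le> ell2_norm u * ell2_norm v"
      by (intro mult_mono L2_set_le_ell2_norm assms ell2_norm_nonneg) auto
    finally show "(\<Sum>n<N. cmod (cnj (u n) * v n)) \<le> ell2_norm u * ell2_norm v" .
  qed
  finally show ?thesis .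
qed

lemma ell2_inner_self: 
  assumes "u \<in> ell2" shows "ell2_inner u u = complex_of_real ((ell2_norm u)\<^sup>2)"
proof -
  have "(\<lambda>n. complex_of_real ((cmod (u n))\<^sup>2)) sums complex_of_real (\<Sum>n. (cmod (u n))\<^sup>2)"
    by (intro sums_of_real summable_sums ell2_summable assms)
  moreover have "complex_of_real ((cmod z)\<^sup>2) = cnj z * z" for z
    using complex_norm_square[of z] by (simp add: mult.commute)
  ultimately show ?thesis
    unfolding ell2_inner_def ell2_norm_sq[OF assms] by (simp only: sums_iff)
qed

lemma ell2_norm_eq_0: "u \<in> ell2 \<Longrightarrow> ell2_norm u = 0 \<Longrightarrow> u = (\<lambda>n. 0)"
  using cmod_le_ell2_norm[of u] by fastforce

lemma ell2_inner_add_right: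
  "u \<in> ell2 \<Longrightarrow> v \<in> ell2 \<Longrightarrow> w \<in> ell2 \<Longrightarrow>
    ell2_inner u (\<lambda>n. v n + w n) = ell2_inner u v + ell2_inner u w"
  by (simp add: ell2_inner_def distrib_left suminf_add summable_ell2_inner)

lemma ell2_inner_scale_right:
  "u \<in> ell2 \<Longrightarrow> v \<in> ell2 \<Longrightarrow> ell2_inner u (\<lambda>n. c * v n) = c * ell2_inner u v"
  by (simp add: ell2_inner_def suminf_mult[symmetric] summable_ell2_inner mult.left_commute)

lemma ell2_inner_commute: 
  "u \<in> ell2 \<Longrightarrow> v \<in> ell2 \<Longrightarrow> ell2_inner v u = cnj (ell2_inner u v)"
proof -
  assume a: "u \<in> ell2" "v \<in> ell2"
  have "(\<lambda>n. cnj (cnj (u n) * v n)) sums cnj (ell2_inner u v)"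
    unfolding ell2_inner_def by (subst sums_cnj) (intro summable_sums summable_ell2_inner a)
  then show ?thesis by (simp add: ell2_inner_def sums_iff mult.commute)
qed

lemma ell2_inner_add_left:
  "u \<in> ell2 \<Longrightarrow> v \<in> ell2 \<Longrightarrow> w \<in> ell2 \<Longrightarrow>
    ell2_inner (\<lambda>n. v n + w n) u = ell2_inner v u + ell2_inner w u"
  by (simp add: ell2_inner_commute[of u] ell2_add ell2_inner_add_right)

lemma ell2_inner_scale_left:
  "u \<in> ell2 \<Longrightarrow> v \<in> ell2 \<Longrightarrow> ell2_inner (\<lambda>n. c * v n) u = cnj c * ell2_inner v u"
  by (simp add: ell2_inner_commute[of u] ell2_scale ell2_inner_scale_right)

lemma ell2_inner_delta_left: "ell2_inner (delta k) u = u k"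
proof -
  have "(\<lambda>n. cnj (delta k n) * u n) = (\<lambda>n. if n = k then u n else 0)"
    by (auto simp: delta_def)
  then show ?thesis unfolding ell2_inner_def using sums_single[of k u] by (simp add: sums_iff)
qed

lemma ell2_inner_delta_right: "ell2_inner u (delta k) = cnj (u k)"
proof -
  have "(\<lambda>n. cnj (u n) * delta k n) = (\<lambda>n. if n = k then cnj (u n) else 0)"
    by (auto simp: delta_def)
  then show ?thesis unfolding ell2_inner_def using sums_single[of k "\<lambda>n. cnj (u n)"] by (simp add: sums_iff)
qed

lemma ell2_norm_delta:
  assumes "k \<ge> 1" shows "ell2_norm (delta k) = 1"
proof -
  have "complex_of_real ((ell2_norm (delta k))\<^sup>2) = complex_of_real 1"
    using ell2_inner_self[OF delta_ell2[OF assms]] by (simp add: ell2_inner_delta_left delta_apply)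
  then have "(ell2_norm (delta k))\<^sup>2 = 1" using of_real_eq_iff by blast
  then show ?thesis using ell2_norm_nonneg[OF delta_ell2[OF assms]] by (simp add: power2_eq_1_iff)
qed

section \<open>Truncations and density of finitely supported sequences\<close>

definition ell2_trunc :: "nat \<Rightarrow> (nat \<Rightarrow> complex) \<Rightarrow> nat \<Rightarrow> complex" where
  "ell2_trunc N u = (\<lambda>n. if n < N then u n else 0)"

lemma ell2_trunc_ell2: "u \<in> ell2 \<Longrightarrow> ell2_trunc N u \<in> ell2"
  by (auto simp: ell2_def ell2_trunc_def split: if_splits intro!: summable_finite[of "{..<N}"])

lemma ell2_trunc_0: "ell2_trunc 0 u = (\<lambda>n. 0)"
  by (simp add: ell2_trunc_def)

lemma ell2_trunc_Suc: "ell2_trunc (Suc N) u = (\<lambda>n. ell2_trunc N u n + u N * delta N n)"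
  by (auto simp: ell2_trunc_def delta_def fun_eq_iff less_Suc_eq)

lemma ell2_norm_trunc_diff:
  assumes "u \<in> ell2"
  shows "(\<lambda>N. ell2_norm (\<lambda>n. u n - ell2_trunc N u n)) \<longlonglongrightarrow> 0"
proof -
  have "(\<lambda>N. sqrt (\<Sum>i. (cmod (u (i + N)))\<^sup>2)) \<longlonglongrightarrow> sqrt 0"
    by (intro tendsto_real_sqrt suminf_exist_split2 ell2_summable assms)
  moreover have "ell2_norm (\<lambda>n. u n - ell2_trunc N u n) = sqrt (\<Sum>i. (cmod (u (i + N)))\<^sup>2)" for N
  proof -
    have *: "(\<lambda>n. (cmod (u n - ell2_trunc N u n))\<^sup>2) = (\<lambda>n. if n < N then 0 else (cmod (u n))\<^sup>2)"
      by (auto simp: ell2_trunc_def)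
    have s: "summable (\<lambda>n. (cmod (u n - ell2_trunc N u n))\<^sup>2)"
      using ell2_diff[OF assms ell2_trunc_ell2[OF assms]] by (rule ell2_summable)
    show ?thesis unfolding ell2_norm_def
      using suminf_split_initial_segment[OF s, of N] by (simp add: ell2_trunc_def)
  qed
  ultimately show ?thesis by simp
qed

text \<open>The density half of the Banach-Steinhaus theorem: linearity carries convergence from
  basis vectors to truncations, and the uniform bound C controls the contribution of the tail of
  \<open>u\<close>.\<close>

lemma ell2_strong_convergence:
  fixes T :: "nat \<Rightarrow> ell2_op"
  assumes cl: "\<And>i u. u \<in> ell2 \<Longrightarrow> T i u \<in> ell2"
    and add: "\<And>i u v. u \<in> ell2 \<Longrightarrow> v \<in> ell2 \<Longrightarrow> T i (\<lambda>n. u n + v n) = (\<lambda>n. T i u n + T i v n)"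
    and scale: "\<And>i c u. u \<in> ell2 \<Longrightarrow> T i (\<lambda>n. c * u n) = (\<lambda>n. c * T i u n)"
    and bound: "\<And>i u. u \<in> ell2 \<Longrightarrow> ell2_norm (T i u) \<le> C * ell2_norm u"
    and delta: "\<And>l. l \<ge> 1 \<Longrightarrow> (\<lambda>i. ell2_norm (T i (delta l))) \<longlonglongrightarrow> 0"
    and u: "u \<in> ell2"
  shows "(\<lambda>i. ell2_norm (T i u)) \<longlonglongrightarrow> 0"
proof -
  have T0: "T i (\<lambda>n. 0) = (\<lambda>n. 0)" for i
    using scale[OF ell2_zero_seq, of i 0] by simp
  have tr: "(\<lambda>i. ell2_norm (T i (ell2_trunc N u))) \<longlonglongrightarrow> 0" for N
  proof (induction N)
    case 0
    show ?case by (simp add: ell2_trunc_0 T0 ell2_norm_zero_seq)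
  next
    case (Suc N)
    show ?case
    \<comment> \<open>\<open>delta 0\<close> lies outside \<open>ell2\<close>, but the entry of
      \<open>u\<close> at index 0 vanishes as well.\<close>
    proof (cases "N = 0")
      case True
      then have "ell2_trunc (Suc N) u = (\<lambda>n. 0)"
        using ell2_zero[OF u] by (auto simp: ell2_trunc_def)
      then show ?thesis by (simp add: T0 ell2_norm_zero_seq)
    next
      case False
      then have d: "delta N \<in> ell2" by (simp add: delta_ell2)
      have le: "ell2_norm (T i (ell2_trunc (Suc N) u)) \<le>
          ell2_norm (T i (ell2_trunc N u)) + cmod (u N) * ell2_norm (T i (delta N))" for i
        using ell2_norm_triangle[OF cl[OF ell2_trunc_ell2[OF u]] ell2_scale[OF cl[OF d]], of i N "u N" i]
        by (simp add: ell2_trunc_Suc add ell2_scale d ell2_trunc_ell2 u scale ell2_norm_scale cl)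
      have "(\<lambda>i. ell2_norm (T i (ell2_trunc N u)) + cmod (u N) * ell2_norm (T i (delta N))) \<longlonglongrightarrow> 0 + cmod (u N) * 0"
        using False by (intro tendsto_intros Suc delta) auto
      then have lim: "(\<lambda>i. ell2_norm (T i (ell2_trunc N u)) + cmod (u N) * ell2_norm (T i (delta N))) \<longlonglongrightarrow> 0"
        by simp
      show ?thesis
        by (rule tendsto_sandwich[OF always_eventually always_eventually tendsto_const lim])
          (use le in \<open>auto intro!: ell2_norm_nonneg cl ell2_trunc_ell2 u\<close>)
    qed
  qed
  show ?thesis
  proof (rule LIMSEQ_I)
    fix r :: real assume r: "r > 0"
    have "(\<lambda>N. C * ell2_norm (\<lambda>n. u n - ell2_trunc N u n)) \<longlonglongrightarrow> C * 0"
      by (intro tendsto_intros ell2_norm_trunc_diff u)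
    then have "eventually (\<lambda>N. C * ell2_norm (\<lambda>n. u n - ell2_trunc N u n) < r / 2) sequentially"
      using r by (intro order_tendstoD(2)) auto
    then obtain N where N: "C * ell2_norm (\<lambda>n. u n - ell2_trunc N u n) < r / 2"
      by (auto simp: eventually_sequentially)
    obtain i0 where i0: "\<And>i. i \<ge> i0 \<Longrightarrow> ell2_norm (T i (ell2_trunc N u)) < r / 2"
      using order_tendstoD(2)[OF tr[of N], of "r/2"] r unfolding eventually_sequentially by auto
    have "norm (ell2_norm (T i u) - 0) < r" if "i \<ge> i0" for i
    proof -
      have d: "(\<lambda>n. u n - ell2_trunc N u n) \<in> ell2" by (intro ell2_diff u ell2_trunc_ell2)
      have "T i u = T i (\<lambda>n. ell2_trunc N u n + (u n - ell2_trunc N u n))" by simp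
      also have "\<dots> = (\<lambda>n. T i (ell2_trunc N u) n + T i (\<lambda>n. u n - ell2_trunc N u n) n)"
        by (rule add[OF ell2_trunc_ell2[OF u] d])
      finally have "ell2_norm (T i u) \<le> ell2_norm (T i (ell2_trunc N u)) + ell2_norm (T i (\<lambda>n. u n - ell2_trunc N u n))"
        using ell2_norm_triangle[OF cl[OF ell2_trunc_ell2[OF u]] cl[OF d], of i N i] by simp
      then show ?thesis using i0[OF that] bound[OF d, of i] N ell2_norm_nonneg[OF cl[OF u], of i] by simp
    qed
    then show "\<exists>n0. \<forall>i\<ge>n0. norm (ell2_norm (T i u) - 0) < r" by blast
  qed
qed

lemma ell2_functional_eq_0:
  fixes L :: "(nat \<Rightarrow> complex) \<Rightarrow> complex"
  assumes add: "\<And>u v. u \<in> ell2 \<Longrightarrow> v \<in> ell2 \<Longrightarrow> L (\<lambda>n. u n + v n) = L u + L v"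
    and scale: "\<And>c u. u \<in> ell2 \<Longrightarrow> L (\<lambda>n. c * u n) = c * L u"
    and bound: "\<And>u. u \<in> ell2 \<Longrightarrow> cmod (L u) \<le> C * ell2_norm u"
    and delta: "\<And>l. l \<ge> 1 \<Longrightarrow> L (delta l) = 0"
    and u: "u \<in> ell2"
  shows "L u = 0"
proof -
  \<comment> \<open>A constant sequence of rank-one operators with norms |L u|: if these converge to
    0, they are 0.\<close>
  define T where "T = (\<lambda>(i::nat) u n. L u * delta 1 n)"
  have d: "ell2_norm (delta 1) = 1" by (simp add: ell2_norm_delta)
  have n: "ell2_norm (T i u) = cmod (L u)" for i u
    using ell2_norm_scale[OF delta_ell2, of 1 "L u"] d by (simp add: T_def)
  have "(\<lambda>i. ell2_norm (T i u)) \<longlonglongrightarrow> 0"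
  proof (rule ell2_strong_convergence[OF _ _ _ _ _ u])
    show "T i u \<in> ell2" for i u unfolding T_def by (intro ell2_scale delta_ell2) simp
    show "ell2_norm (T i u) \<le> C * ell2_norm u" if "u \<in> ell2" for i u using n bound[OF that] by simp
    show "(\<lambda>i. ell2_norm (T i (delta l))) \<longlonglongrightarrow> 0" if "l \<ge> 1" for l
      using delta[OF that] by (simp add: n)
  qed (auto simp: T_def add scale distrib_right)
  then show ?thesis by (simp add: n LIMSEQ_const_iff)
qed

section \<open>The Hausdorff moment problem\<close>

text \<open>If m k l is the integral of x^k (1 - x)^l, the recursion says x + (1 - x) = 1, and the
  claim is the binomial expansion of (x + (1 - x))^n under the integral.\<close>

lemma hausdorff_weights_sum:
  fixes m :: "nat \<Rightarrow> nat \<Rightarrow> real"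
  assumes rec: "\<And>k l. m k l = m (Suc k) l + m k (Suc l)"
  shows "(\<Sum>i\<le>n. real (n choose i) * m (j + i) (l + (n - i))) = m j l"
proof (induction n)
  case (Suc n)
  have "(\<Sum>i\<le>Suc n. real (Suc n choose i) * m (j + i) (l + (Suc n - i)))
      = m j (l + Suc n) + (\<Sum>i\<le>n. real (Suc n choose Suc i) * m (j + Suc i) (l + (n - i)))"
    by (subst sum.atMost_Suc_shift) simp
  also have "(\<Sum>i\<le>n. real (Suc n choose Suc i) * m (j + Suc i) (l + (n - i)))
      = (\<Sum>i\<le>n. real (n choose i) * m (j + Suc i) (l + (n - i)))
      + (\<Sum>i\<le>n. real (n choose Suc i) * m (j + Suc i) (l + (n - i)))"
    by (simp add: distrib_right sum.distrib del: add_Suc_right)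
  also have "(\<Sum>i\<le>n. real (n choose Suc i) * m (j + Suc i) (l + (n - i)))
      = (\<Sum>i<n. real (n choose Suc i) * m (j + Suc i) (l + (n - i)))"
    by (intro sum.mono_neutral_right) (auto simp: not_less)
  also have "m j (l + Suc n) + ((\<Sum>i\<le>n. real (n choose i) * m (j + Suc i) (l + (n - i))) + \<dots>)
      = (\<Sum>i\<le>n. real (n choose i) * m (j + Suc i) (l + (n - i)))
      + (m j (l + Suc n) + (\<Sum>i<n. real (n choose Suc i) * m (j + Suc i) (l + (n - i))))"
    by simp
  also have "m j (l + Suc n) + (\<Sum>i<n. real (n choose Suc i) * m (j + Suc i) (l + (n - i)))
      = (\<Sum>i\<le>n. real (n choose i) * m (j + i) (l + (Suc n - i)))"
  proof -
    have "(\<Sum>i<n. real (n choose Suc i) * m (j + Suc i) (l + (n - i)))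
        = (\<Sum>i<n. real (n choose Suc i) * m (j + Suc i) (l + (Suc n - Suc i)))" by simp
    moreover have "(\<Sum>i\<le>n. real (n choose i) * m (j + i) (l + (Suc n - i))) =
        m j (l + Suc n) + (\<Sum>i<n. real (n choose Suc i) * m (j + Suc i) (l + (Suc n - Suc i)))"
      by (subst sum.atMost_shift) simp
    ultimately show ?thesis by simp
  qed
  also have "(\<Sum>i\<le>n. real (n choose i) * m (j + Suc i) (l + (n - i))) + \<dots>
      = (\<Sum>i\<le>n. real (n choose i) * (m (Suc (j + i)) (l + (n - i)) + m (j + i) (Suc (l + (n - i)))))"
    by (simp add: sum.distrib[symmetric] distrib_left Suc_diff_le)
  also have "\<dots> = m j l"
    unfolding rec[symmetric] by (rule Suc.IH)
  finally show ?case .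
qed simp

text \<open>Falling factorials, unlike powers, are absorbed exactly by binomial coefficients: (N
  choose k) (k choose j) = (N choose j) (N - j choose k - j). The remaining sum is that of
  \<open>hausdorff_weights_sum\<close>.\<close>

lemma hausdorff_factorial_moment:
  fixes m :: "nat \<Rightarrow> nat \<Rightarrow> real"
  assumes rec: "\<And>k l. m k l = m (Suc k) l + m k (Suc l)"
    and "j \<le> N"
  shows "(\<Sum>k\<le>N. real (N choose k) * m k (N - k) * (\<Prod>i<j. real k - real i)) = (\<Prod>i<j. real N - real i) * m j 0"
proof -
  have pr: "(\<Prod>i<j. real k - real i) = fact j * real (k choose j)" for k
    using gbinomial_mult_fact[of j "real k"] by (simp add: binomial_gbinomial lessThan_atLeast0)
  have "(\<Sum>k\<le>N. real (N choose k) * m k (N - k) * (\<Prod>i<j. real k - real i))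
      = (\<Sum>k\<in>{j..N}. real (N choose k) * m k (N - k) * (fact j * real (k choose j)))"
    unfolding pr by (intro sum.mono_neutral_right) auto
  also have "\<dots> = (\<Sum>k\<in>{j..N}. fact j * real (N choose j) * (real ((N - j) choose (k - j)) * m k (N - k)))"
  proof (intro sum.cong refl)
    fix k assume "k \<in> {j..N}"
    then have "real (N choose k) * real (k choose j) = real (N choose j) * real ((N - j) choose (k - j))"
      using choose_mult[of j k N] by (simp flip: of_nat_mult)
    then show "real (N choose k) * m k (N - k) * (fact j * real (k choose j)) =
         fact j * real (N choose j) * (real ((N - j) choose (k - j)) * m k (N - k))"
      by (simp add: ac_simps)
  qed
  also have "\<dots> = fact j * real (N choose j) * (\<Sum>k\<in>{j..N}. real ((N - j) choose (k - j)) * m k (N - k))"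
    by (simp add: sum_distrib_left)
  also have "(\<Sum>k\<in>{j..N}. real ((N - j) choose (k - j)) * m k (N - k))
     = (\<Sum>i\<le>N - j. real ((N - j) choose i) * m (j + i) (0 + (N - j - i)))"
    by (rule sum.reindex_bij_witness[of _ "\<lambda>i. j + i" "\<lambda>k. k - j"]) (use assms(2) in auto)
  also have "\<dots> = m j 0" by (rule hausdorff_weights_sum[where m=m, OF rec])
  finally show ?thesis using pr[of N] by simp
qed

text \<open>Place mass \<open>w N k\<close> at the point k/N. The factorial moments of these
  discrete measures are known exactly and differ from the power moments by O(1/N), and all mass
  stays in [0,1]; so a weak limit exists and has the prescribed moments.\<close>

theorem hausdorff_moment:
  fixes m :: "nat \<Rightarrow> nat \<Rightarrow> real"
  assumes rec: "\<And>k l. m k l = m (Suc k) l + m k (Suc l)"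
    and nonneg: "\<And>k l. 0 \<le> m k l"
    and m00: "m 0 0 = 1"
  shows "\<exists>M. real_distribution M \<and> (AE x in M. x \<in> {0..1}) \<and> (\<forall>j. (\<integral>x. x ^ j \<partial>M) = m j 0)"
proof -
  \<comment> \<open>What the integral of the Bernstein polynomial (N choose k) x^k (1 - x)^(N - k)
    would have to be.\<close>
  define w where "w = (\<lambda>N k. if k \<le> N then real (N choose k) * m k (N - k) else 0)"
  have w0: "0 \<le> w N k" for N k by (simp add: w_def nonneg)
  have w1: "(\<Sum>k\<le>N. w N k) = 1" for N
    using hausdorff_weights_sum[where m=m, OF rec, of N 0 0] by (simp add: w_def m00)
  define p where "p = (\<lambda>N. embed_pmf (w N))"
  have pw: "pmf (p N) k = w N k" for N k
    unfolding p_def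
  proof (rule pmf_embed_pmf)
    have "(\<integral>\<^sup>+x. ennreal (w N x) \<partial>count_space UNIV) = (\<Sum>k\<le>N. ennreal (w N k))"
      by (rule nn_integral_count_space'[where A="{..N}"]) (auto simp: w_def)
    also have "\<dots> = 1" using w1[of N] by (simp add: sum_ennreal w0)
    finally show "(\<integral>\<^sup>+x. ennreal (w N x) \<partial>count_space UNIV) = 1" .
  qed (rule w0)
  \<comment> \<open>The shift to \<open>Suc n\<close> keeps the denominator positive.\<close>
  define \<mu> where "\<mu> = (\<lambda>n. distr (measure_pmf (p (Suc n))) borel (\<lambda>k. real k / real (Suc n)))"
  have rd: "real_distribution (\<mu> n)" for n
    unfolding \<mu>_def by (rule prob_space.real_distribution_distr) (auto intro: measure_pmf.prob_space_axioms)
  have setp: "set_pmf (p N) \<subseteq> {..N}" for N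
    using pw by (auto simp: set_pmf_eq w_def split: if_splits)
  have int: "(\<integral>x. f x \<partial>\<mu> n) = (\<Sum>k\<le>Suc n. f (real k / real (Suc n)) * w (Suc n) k)"
    if [measurable]: "f \<in> borel_measurable borel" for f :: "real \<Rightarrow> real" and n
  proof -
    have "(\<integral>x. f x \<partial>\<mu> n) = (\<integral>k. f (real k / real (Suc n)) \<partial>measure_pmf (p (Suc n)))"
      unfolding \<mu>_def by (rule integral_distr) auto
    also have "\<dots> = (\<Sum>k\<le>Suc n. f (real k / real (Suc n)) * pmf (p (Suc n)) k)"
      using setp[of "Suc n"] by (intro integral_measure_pmf_real) auto
    finally show ?thesis by (simp add: pw)
  qed
  have tight: "tight \<mu>"
    unfolding tight_def
  proof (intro conjI allI impI rd)
    fix \<epsilon> :: real assume \<epsilon>: "\<epsilon> > 0"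
    \<comment> \<open>Tightness is phrased with intervals open on the left, so the left end lies
      below 0 to keep the atom there.\<close>
    have "measure (\<mu> n) {-1<..1} = 1" for n
    proof -
      interpret real_distribution "\<mu> n" by (rule rd)
      have "(\<integral>x. indicator {-1<..1} x \<partial>\<mu> n) = (\<Sum>k\<le>Suc n. indicator {-1<..1} (real k / real (Suc n)) * w (Suc n) k)"
        by (rule int) auto
      also have "\<dots> = (\<Sum>k\<le>Suc n. w (Suc n) k)"
      proof (intro sum.cong refl)
        fix k assume "k \<in> {..Suc n}"
        then have "real k / real (Suc n) \<in> {-1<..1}"
          by (auto simp: divide_le_eq intro: less_le_trans[of "-1" 0])
        then show "indicator {-1<..1} (real k / real (Suc n)) * w (Suc n) k = w (Suc n) k" by simp
      qed
      finally show ?thesis using w1[of "Suc n"] by simp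
    qed
    then show "\<exists>a b. a < b \<and> (\<forall>n. 1 - \<epsilon> < measure (\<mu> n) {a<..b})"
      using \<epsilon> by (intro exI[of _ "-1"] exI[of _ 1]) simp
  qed
  obtain r M where r: "strict_mono (r :: nat \<Rightarrow> nat)" and M: "real_distribution M" and wc: "weak_conv_m (\<mu> \<circ> id \<circ> r) M"
    using tight_imp_convergent_subsubsequence[OF tight strict_mono_id] by blast
  interpret M: real_distribution M by (rule M)
  \<comment> \<open>Clamping to [0,1] makes x^j a bounded continuous test function without changing
    it at the atoms k/N.\<close>
  define c where "c = (\<lambda>x::real. max 0 (min 1 x))"
  have c01: "0 \<le> c x" "c x \<le> 1" for x by (auto simp: c_def)
  have cid: "x \<in> {0..1} \<Longrightarrow> c x = x" for x by (auto simp: c_def)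
  have cc: "continuous_on UNIV c" unfolding c_def by (intro continuous_intros)
  have pt: "real k / real (Suc n) \<in> {0..1}" if "k \<le> Suc n" for k n using that by auto
  have conv: "(\<lambda>n. \<integral>x. f x \<partial>\<mu> (r n)) \<longlonglongrightarrow> (\<integral>x. f x \<partial>M)"
    if "continuous_on UNIV f" "\<And>x. \<bar>f x\<bar> \<le> B" for f :: "real \<Rightarrow> real" and B
  proof -
    have "(\<lambda>n. \<integral>x. f x \<partial>((\<mu> \<circ> id \<circ> r) n)) \<longlonglongrightarrow> (\<integral>x. f x \<partial>M)"
      by (rule weak_conv_imp_integral_bdd_continuous_conv[OF _ M wc, of f B])
        (use that rd in \<open>auto simp: continuous_on_eq_continuous_at\<close>)
    then show ?thesis by simp
  qed
  have supp: "AE x in M. x \<in> {0..1}"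
  proof -
    \<comment> \<open>A bounded continuous function whose zero set is [0,1]; its integrals against
      the discrete measures vanish, hence also the one against the limit.\<close>
    define d where "d = (\<lambda>x::real. min 1 \<bar>x - c x\<bar>)"
    have dc: "continuous_on UNIV d" unfolding d_def by (intro continuous_intros cc)
    have d01: "0 \<le> d x" "d x \<le> 1" for x by (auto simp: d_def)
    have "(\<integral>x. d x \<partial>\<mu> n) = 0" for n
    proof -
      have "(\<integral>x. d x \<partial>\<mu> n) = (\<Sum>k\<le>Suc n. d (real k / real (Suc n)) * w (Suc n) k)"
        by (rule int) (rule borel_measurable_continuous_onI[OF dc])
      also have "\<dots> = 0"
        using cid[OF pt] by (intro sum.neutral ballI) (simp add: d_def)
      finally show ?thesis .
    qed
    then have "(\<integral>x. d x \<partial>M) = 0"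
      using conv[OF dc, of 1] d01 by (simp add: LIMSEQ_const_iff)
    moreover have "integrable M d"
      by (rule M.integrable_const_bound[of _ 1])
        (use d01 borel_measurable_continuous_onI[OF dc] in auto)
    ultimately have "AE x in M. d x = 0"
      using integral_nonneg_eq_0_iff_AE[of M d] d01 by simp
    then show ?thesis
      by eventually_elim (auto simp: d_def c_def max_def min_def split: if_splits)
  qed
  have mom: "(\<integral>x. x ^ j \<partial>M) = m j 0" for j
  proof -
    have e1: "(\<integral>x. x ^ j \<partial>M) = (\<integral>x. c x ^ j \<partial>M)"
      by (rule integral_cong_AE)
        (use supp borel_measurable_continuous_onI[OF cc] in \<open>auto simp: cid\<close>)
    have lim1: "(\<lambda>n. \<integral>x. c x ^ j \<partial>\<mu> (r n)) \<longlonglongrightarrow> (\<integral>x. x ^ j \<partial>M)"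
      unfolding e1 by (rule conv[of _ 1])
        (use c01 in \<open>auto intro!: continuous_intros cc power_le_one\<close>)
    \<comment> \<open>The j-th factorial moment divided by N^j, with N = Suc n.\<close>
    define q where "q = (\<lambda>n. (\<Prod>i<j. 1 - real i / real (Suc n)) * m j 0)"
    have lim2: "q \<longlonglongrightarrow> m j 0"
    proof -
      have "(\<lambda>n. (\<Prod>i<j. 1 - real i / real (Suc n)) * m j 0) \<longlonglongrightarrow> (\<Prod>i<j. 1 - 0) * m j 0"
        by (intro tendsto_intros LIMSEQ_Suc[OF lim_const_over_n])
      then show ?thesis by (simp add: q_def)
    qed
    have est: "\<bar>(\<integral>x. c x ^ j \<partial>\<mu> n) - q n\<bar> \<le> real (j * j) / real (Suc n)" if "n \<ge> j" for n
    proof -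
      let ?N = "Suc n"
      have i: "(\<integral>x. c x ^ j \<partial>\<mu> n) = (\<Sum>k\<le>?N. (real k / real ?N) ^ j * w ?N k)"
        using int[of "\<lambda>x. c x ^ j" n] borel_measurable_continuous_onI[OF cc] cid[OF pt]
        by (simp del: sum.atMost_Suc of_nat_Suc)
      have qn: "q n = (\<Sum>k\<le>?N. (\<Prod>i<j. real k / real ?N - real i / real ?N) * w ?N k)"
      proof -
        have "(\<Sum>k\<le>?N. (\<Prod>i<j. real k / real ?N - real i / real ?N) * w ?N k)
          = (\<Sum>k\<le>?N. real (?N choose k) * m k (?N - k) * (\<Prod>i<j. real k - real i)) / real ?N ^ j"
          by (simp add: diff_divide_distrib[symmetric] prod_dividef w_def sum_divide_distrib mult.commute del: of_nat_Suc sum.atMost_Suc)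
        also have "\<dots> = (\<Prod>i<j. real ?N - real i) * m j 0 / real ?N ^ j"
          using hausdorff_factorial_moment[where m=m, OF rec, of j ?N] that by simp
        also have "\<dots> = (\<Prod>i<j. (real ?N - real i) / real ?N) * m j 0"
          by (simp add: prod_dividef del: of_nat_Suc)
        also have "\<dots> = q n" unfolding q_def by (simp add: diff_divide_distrib del: of_nat_Suc)
        finally show ?thesis by simp
      qed
      \<comment> \<open>Two products of j numbers in [-1,1] whose i-th factors differ by i/N <= j/N;
        replacing the factors one at a time costs at most j * j / N.\<close>
      have bnd: "\<bar>(real k / real ?N) ^ j - (\<Prod>i<j. real k / real ?N - real i / real ?N)\<bar> \<le> real (j * j) / real ?N"
        if k: "k \<le> ?N" for k
      proof -
        have "norm ((\<Prod>i<j. real k / real ?N) - (\<Prod>i<j. real k / real ?N - real i / real ?N))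
          \<le> (\<Sum>i<j. norm (real k / real ?N - (real k / real ?N - real i / real ?N)))"
        proof (rule norm_prod_diff)
          show "norm (real k / real ?N) \<le> 1" for i using k by simp
          fix i assume "i \<in> {..<j}"
          then have "i \<le> ?N" using \<open>n \<ge> j\<close> by simp
          then show "norm (real k / real ?N - real i / real ?N) \<le> 1"
            using pt[OF k] pt[OF \<open>i \<le> ?N\<close>] unfolding atLeastAtMost_iff real_norm_def by linarith
        qed
        also have "\<dots> = (\<Sum>i<j. real i / real ?N)" by simp
        also have "\<dots> \<le> (\<Sum>i<j. real j / real ?N)"
          by (intro sum_mono divide_right_mono) auto
        finally show ?thesis by simp
      qed
      have "\<bar>(\<integral>x. c x ^ j \<partial>\<mu> n) - q n\<bar> =
        \<bar>\<Sum>k\<le>?N. ((real k / real ?N) ^ j - (\<Prod>i<j. real k / real ?N - real i / real ?N)) * w ?N k\<bar>"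
        unfolding i qn by (simp only: sum_subtractf[symmetric] left_diff_distrib)
      also have "\<dots> \<le> (\<Sum>k\<le>?N. real (j * j) / real ?N * w ?N k)"
        by (rule order_trans[OF sum_abs], intro sum_mono)
          (simp only: abs_mult abs_of_nonneg[OF w0], intro mult_right_mono bnd w0, simp)
      also have "\<dots> = real (j * j) / real ?N"
        using w1[of ?N] by (simp only: sum_distrib_left[symmetric] mult_1_right)
      finally show ?thesis .
    qed
    have "(\<lambda>n. (\<integral>x. c x ^ j \<partial>\<mu> n) - q n) \<longlonglongrightarrow> 0"
    proof (rule tendsto_rabs_zero_cancel, rule tendsto_sandwich[OF _ _ tendsto_const])
      show "(\<lambda>n. real (j * j) / real (Suc n)) \<longlonglongrightarrow> 0"
        by (intro LIMSEQ_Suc[OF lim_const_over_n])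
      show "\<forall>\<^sub>F n in sequentially. \<bar>(\<integral>x. c x ^ j \<partial>\<mu> n) - q n\<bar> \<le> real (j * j) / real (Suc n)"
        using eventually_ge_at_top[of j] by eventually_elim (rule est)
    qed simp
    from tendsto_add[OF this lim2] have "(\<lambda>n. \<integral>x. c x ^ j \<partial>\<mu> n) \<longlonglongrightarrow> m j 0" by simp
    then have "(\<lambda>n. \<integral>x. c x ^ j \<partial>\<mu> (r n)) \<longlonglongrightarrow> m j 0"
      using r by (rule LIMSEQ_subseq_LIMSEQ[unfolded comp_def])
    with lim1 show ?thesis by (rule LIMSEQ_unique)
  qed
  show ?thesis using M supp mom by blast
qed

section \<open>Bounded Jacobi operators\<close>

lemma bounded_opD:
  assumes "bounded_op T"
  shows "u \<in> ell2 \<Longrightarrow> T u \<in> ell2"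
    and "u \<in> ell2 \<Longrightarrow> w \<in> ell2 \<Longrightarrow> T (\<lambda>n. u n + w n) = (\<lambda>n. T u n + T w n)"
    and "u \<in> ell2 \<Longrightarrow> T (\<lambda>n. c * u n) = (\<lambda>n. c * T u n)"
  using assms by (auto simp: bounded_op_def)

lemma bounded_op_boundE:
  assumes "bounded_op T"
  obtains K where "K \<ge> 0" "\<And>u. u \<in> ell2 \<Longrightarrow> ell2_norm (T u) \<le> K * ell2_norm u"
proof -
  obtain K where K: "\<And>u. u \<in> ell2 \<Longrightarrow> ell2_norm (T u) \<le> K * ell2_norm u"
    using assms unfolding bounded_op_def by blast
  have "ell2_norm (T u) \<le> max 0 K * ell2_norm u" if "u \<in> ell2" for u
    using K[OF that] mult_right_mono[OF max.cobounded2[of K 0] ell2_norm_nonneg[OF that]] by linarith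
  then show ?thesis using that[of "max 0 K"] by simp
qed

lemma bounded_op_eqI:
  assumes T: "bounded_op T" and S: "bounded_op S"
    and eq: "\<And>l. l \<ge> 1 \<Longrightarrow> T (delta l) = S (delta l)" and u: "u \<in> ell2"
  shows "T u = S u"
proof
  fix n
  obtain K where K: "K \<ge> 0" "\<And>u. u \<in> ell2 \<Longrightarrow> ell2_norm (T u) \<le> K * ell2_norm u"
    using bounded_op_boundE[OF T] by blast
  obtain K' where K': "K' \<ge> 0" "\<And>u. u \<in> ell2 \<Longrightarrow> ell2_norm (S u) \<le> K' * ell2_norm u"
    using bounded_op_boundE[OF S] by blast
  have "T u n - S u n = 0"
  proof (rule ell2_functional_eq_0[where L="\<lambda>u. T u n - S u n" and C="K + K'", OF _ _ _ _ u])
    fix w assume w: "w \<in> ell2"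
    have "cmod (T w n - S w n) \<le> cmod (T w n) + cmod (S w n)" by (rule norm_triangle_ineq4)
    also have "\<dots> \<le> K * ell2_norm w + K' * ell2_norm w"
      by (intro add_mono order_trans[OF cmod_le_ell2_norm K(2)] order_trans[OF cmod_le_ell2_norm K'(2)]
          bounded_opD(1)[OF T] bounded_opD(1)[OF S] w)
    finally show "cmod (T w n - S w n) \<le> (K + K') * ell2_norm w" by (simp add: distrib_right)
  qed (simp_all add: bounded_opD[OF T] bounded_opD[OF S] eq algebra_simps)
  then show "T u n = S u n" by simp
qed

lemma bounded_op_compose:
  assumes T: "bounded_op T" and S: "bounded_op S"
  shows "bounded_op (\<lambda>u. T (S u))"
proof -
  obtain K where K: "K \<ge> 0" "\<And>u. u \<in> ell2 \<Longrightarrow> ell2_norm (T u) \<le> K * ell2_norm u"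
    using bounded_op_boundE[OF T] by blast
  obtain K' where K': "K' \<ge> 0" "\<And>u. u \<in> ell2 \<Longrightarrow> ell2_norm (S u) \<le> K' * ell2_norm u"
    using bounded_op_boundE[OF S] by blast
  have "ell2_norm (T (S u)) \<le> (K * K') * ell2_norm u" if "u \<in> ell2" for u
    using K(2)[OF bounded_opD(1)[OF S that]] mult_left_mono[OF K'(2)[OF that] K(1)] by simp
  then show ?thesis
    by (auto simp: bounded_op_def bounded_opD[OF T] bounded_opD[OF S])
qed

lemma bounded_op_funpow: "bounded_op T \<Longrightarrow> bounded_op (T ^^ k)"
proof (induction k)
  case 0
  show ?case by (auto simp: bounded_op_def intro!: exI[of _ 1])
next
  case (Suc k)
  show ?case using bounded_op_compose[OF Suc.prems Suc.IH[OF Suc.prems]] by (simp add: comp_def)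
qed

lemma bounded_op_affine:
  assumes T: "bounded_op T"
  shows "bounded_op (\<lambda>u n. c * u n + d * T u n)"
proof -
  obtain K where K: "K \<ge> 0" "\<And>u. u \<in> ell2 \<Longrightarrow> ell2_norm (T u) \<le> K * ell2_norm u"
    using bounded_op_boundE[OF T] by blast
  have "ell2_norm (\<lambda>n. c * u n + d * T u n) \<le> (cmod c + cmod d * K) * ell2_norm u" if u: "u \<in> ell2" for u
  proof -
    have "ell2_norm (\<lambda>n. c * u n + d * T u n) \<le> ell2_norm (\<lambda>n. c * u n) + ell2_norm (\<lambda>n. d * T u n)"
      by (intro ell2_norm_triangle ell2_scale bounded_opD(1)[OF T] u)
    also have "\<dots> \<le> cmod c * ell2_norm u + cmod d * (K * ell2_norm u)"
      using mult_left_mono[OF K(2)[OF u], of "cmod d"] by (simp add: ell2_norm_scale u bounded_opD(1)[OF T])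
    finally show ?thesis by (simp add: algebra_simps)
  qed
  then have "\<exists>K. \<forall>u\<in>ell2. ell2_norm (\<lambda>n. c * u n + d * T u n) \<le> K * ell2_norm u" by blast
  then show ?thesis
    unfolding bounded_op_def
    by (intro conjI ballI allI) (simp_all add: bounded_opD[OF T] ell2_add ell2_scale algebra_simps)
qed

section \<open>Symmetric operators\<close>

definition symmetric_op :: "ell2_op \<Rightarrow> bool" where
  "symmetric_op T \<longleftrightarrow> (\<forall>u\<in>ell2. \<forall>w\<in>ell2. ell2_inner (T u) w = ell2_inner u (T w))"

lemma symmetric_opD: "symmetric_op T \<Longrightarrow> u \<in> ell2 \<Longrightarrow> w \<in> ell2 \<Longrightarrow> ell2_inner (T u) w = ell2_inner u (T w)"
  by (simp add: symmetric_op_def)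

lemma symmetric_op_funpow: 
  assumes "bounded_op T" "symmetric_op T" shows "symmetric_op (T ^^ k)"
proof (induction k)
  case (Suc k)
  show ?case
    unfolding symmetric_op_def
  proof (intro ballI)
    fix u w assume uw: "u \<in> ell2" "w \<in> ell2"
    have "ell2_inner ((T ^^ Suc k) u) w = ell2_inner ((T ^^ k) u) (T w)"
      using symmetric_opD[OF assms(2) bounded_opD(1)[OF bounded_op_funpow[OF assms(1)] uw(1)] uw(2)] by simp
    also have "\<dots> = ell2_inner u ((T ^^ k) (T w))"
      by (rule symmetric_opD[OF Suc uw(1) bounded_opD(1)[OF assms(1) uw(2)]])
    finally show "ell2_inner ((T ^^ Suc k) u) w = ell2_inner u ((T ^^ Suc k) w)"
      by (simp add: funpow_swap1)
  qed
qed (simp add: symmetric_op_def)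

lemma symmetric_op_affine:
  assumes "bounded_op T" "symmetric_op T" 
  shows "symmetric_op (\<lambda>u n. complex_of_real c * u n + complex_of_real d * T u n)"
  unfolding symmetric_op_def
  by (auto simp: ell2_inner_add_left ell2_inner_add_right ell2_inner_scale_left ell2_inner_scale_right
      ell2_scale bounded_opD(1)[OF assms(1)] symmetric_opD[OF assms(2)])

lemma funpow_commute_on_ell2:
  assumes T: "bounded_op T" and S: "bounded_op S" 
    and comm: "\<And>u. u \<in> ell2 \<Longrightarrow> T (S u) = S (T u)" and u: "u \<in> ell2"
  shows "(T ^^ k) (S u) = S ((T ^^ k) u)"
proof (induction k)
  case (Suc k)
  then show ?case
    using comm[OF bounded_opD(1)[OF bounded_op_funpow[OF T] u], of k] by simp
qed simp

text \<open>No boundary condition appears: since u(0) = - tan \<beta> u(1), it amounts to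
  subtracting tan \<beta> from the first diagonal entry, so that one kind of matrix serves every
  \<beta>.\<close>

definition jacobi :: "(nat \<Rightarrow> real) \<Rightarrow> ell2_op" where
  "jacobi v u = (\<lambda>n. if n = 0 then 0 else u (n + 1) + u (n - 1) + of_real (v n) * u n)"

lemma ell2_shift_left:
  assumes "u \<in> ell2"
  shows "(\<lambda>n. if n = 0 then 0 else u (n + 1)) \<in> ell2 \<and> ell2_norm (\<lambda>n. if n = 0 then 0 else u (n + 1)) \<le> ell2_norm u"
proof -
  have "L2_set (\<lambda>n. cmod (if n = 0 then 0 else u (n + 1))) {..<N} \<le> ell2_norm u" for N
  proof -
    have "L2_set (\<lambda>n. cmod (if n = 0 then 0 else u (n + 1))) {..<N} \<le> L2_set (\<lambda>n. cmod (u (n + 1))) {..<N}"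
      by (intro L2_set_mono) auto
    also have "\<dots> = L2_set (\<lambda>n. cmod (u n)) (Suc ` {..<N})"
      unfolding L2_set_def by (subst sum.reindex) auto
    also have "\<dots> \<le> ell2_norm u" by (intro L2_set_le_ell2_norm assms) auto
    finally show ?thesis .
  qed
  then show ?thesis using ell2_bounded_partial[of "\<lambda>n. if n = 0 then 0 else u (n + 1)" "ell2_norm u"] by simp
qed

lemma ell2_shift_right:
  assumes "u \<in> ell2"
  shows "(\<lambda>n. if n = 0 then 0 else u (n - 1)) \<in> ell2 \<and> ell2_norm (\<lambda>n. if n = 0 then 0 else u (n - 1)) \<le> ell2_norm u"
proof -
  have "L2_set (\<lambda>n. cmod (if n = 0 then 0 else u (n - 1))) {..<N} \<le> ell2_norm u" for N
  proof -
    have "(\<Sum>n<N. (cmod (if n = 0 then 0 else u (n - 1)))\<^sup>2) \<le> (\<Sum>n<Suc N. (cmod (if n = 0 then 0 else u (n - 1)))\<^sup>2)"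
      by simp
    also have "\<dots> = (\<Sum>n<N. (cmod (u n))\<^sup>2)"
      by (subst sum.lessThan_Suc_shift) simp
    finally have "L2_set (\<lambda>n. cmod (if n = 0 then 0 else u (n - 1))) {..<N} \<le> L2_set (\<lambda>n. cmod (u n)) {..<N}"
      unfolding L2_set_def by (rule real_sqrt_le_mono)
    also have "\<dots> \<le> ell2_norm u" by (intro L2_set_le_ell2_norm assms) auto
    finally show ?thesis .
  qed
  then show ?thesis using ell2_bounded_partial[of "\<lambda>n. if n = 0 then 0 else u (n - 1)" "ell2_norm u"] by simp
qed

lemma ell2_multiplier:
  assumes "u \<in> ell2" "\<And>n. n \<ge> 1 \<Longrightarrow> \<bar>v n\<bar> \<le> B" "0 \<le> B"
  shows "(\<lambda>n. complex_of_real (v n) * u n) \<in> ell2 \<and> ell2_norm (\<lambda>n. complex_of_real (v n) * u n) \<le> B * ell2_norm u"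
proof -
  have "L2_set (\<lambda>n. cmod (complex_of_real (v n) * u n)) {..<N} \<le> B * ell2_norm u" for N
  proof -
    have "L2_set (\<lambda>n. cmod (complex_of_real (v n) * u n)) {..<N} \<le> L2_set (\<lambda>n. B * cmod (u n)) {..<N}"
    proof (intro L2_set_mono)
      fix n show "cmod (complex_of_real (v n) * u n) \<le> B * cmod (u n)"
        using assms(2)[of n] ell2_zero[OF assms(1)] by (cases "n = 0") (auto simp: norm_mult intro!: mult_right_mono)
    qed auto
    also have "\<dots> = B * L2_set (\<lambda>n. cmod (u n)) {..<N}"
      using assms(3) by (simp add: L2_set_right_distrib)
    also have "\<dots> \<le> B * ell2_norm u" by (intro mult_left_mono L2_set_le_ell2_norm assms) auto
    finally show ?thesis .
  qed
  then show ?thesis using ell2_bounded_partial[of "\<lambda>n. complex_of_real (v n) * u n" "B * ell2_norm u"] 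
    ell2_zero[OF assms(1)] by simp
qed

lemma jacobi_delta:
  assumes "l \<ge> 1"
  shows "jacobi v (delta l) = (\<lambda>n. delta (l + 1) n + (if l = 1 then 0 else delta (l - 1) n) + of_real (v l) * delta l n)"
proof
  fix n
  obtain k where k: "l = Suc k" using assms by (cases l) auto
  consider "n = 0" | "n = k" "n > 0" | "n = l" | "n = l + 1" | "n > l + 1 \<or> n < k" "n > 0"
    unfolding k by linarith
  then show "jacobi v (delta l) n =
      delta (l + 1) n + (if l = 1 then 0 else delta (l - 1) n) + of_real (v l) * delta l n"
    unfolding k by cases (simp_all add: jacobi_def delta_def, arith)
qed

lemma jacobi_linear:
  "jacobi v (\<lambda>n. c * u n + d * w n) = (\<lambda>n. c * jacobi v u n + d * jacobi v w n)"
  by (auto simp: jacobi_def algebra_simps)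

locale bounded_jacobi =
  fixes v :: "nat \<Rightarrow> real" and B :: real
  assumes v_bound: "\<And>n. n \<ge> 1 \<Longrightarrow> \<bar>v n\<bar> \<le> B"
begin

abbreviation "H \<equiv> jacobi v"

lemma H_split: "u \<in> ell2 \<Longrightarrow> H u = (\<lambda>n. ((if n = 0 then 0 else u (n + 1)) + (if n = 0 then 0 else u (n - 1))) + of_real (v n) * u n)"
  using ell2_zero[of u] by (auto simp: jacobi_def)

lemma bounded_op_H: "bounded_op H"
proof -
  have B: "0 \<le> B" using v_bound[of 1] by linarith
  have 1: "H u \<in> ell2 \<and> ell2_norm (H u) \<le> (2 + B) * ell2_norm u" if u: "u \<in> ell2" for u
  proof -
    note l = ell2_shift_left[OF u] and r = ell2_shift_right[OF u]
    have m: "(\<lambda>n. complex_of_real (v n) * u n) \<in> ell2 \<and> ell2_norm (\<lambda>n. complex_of_real (v n) * u n) \<le> B * ell2_norm u"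
      by (rule ell2_multiplier[OF u v_bound B])
    have lr: "(\<lambda>n. (if n = 0 then 0 else u (n + 1)) + (if n = 0 then 0 else u (n - 1))) \<in> ell2"
      by (rule ell2_add) (use l r in auto)
    have "ell2_norm (\<lambda>n. (if n = 0 then 0 else u (n + 1)) + (if n = 0 then 0 else u (n - 1))) \<le> ell2_norm u + ell2_norm u"
      using ell2_norm_triangle[OF conjunct1[OF l] conjunct1[OF r]] l r by linarith
    moreover have "ell2_norm (H u) \<le> ell2_norm (\<lambda>n. (if n = 0 then 0 else u (n + 1)) + (if n = 0 then 0 else u (n - 1)))
        + ell2_norm (\<lambda>n. complex_of_real (v n) * u n)"
      unfolding H_split[OF u] by (rule ell2_norm_triangle[OF lr conjunct1[OF m]])
    ultimately have "ell2_norm (H u) \<le> ell2_norm u + ell2_norm u + B * ell2_norm u"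
      using m by linarith
    moreover have "H u \<in> ell2" unfolding H_split[OF u] by (rule ell2_add[OF lr conjunct1[OF m]])
    ultimately show ?thesis by (simp add: algebra_simps)
  qed
  have "H (\<lambda>n. u n + w n) = (\<lambda>n. H u n + H w n)" for u w
    using jacobi_linear[of v 1 u 1 w] by simp
  moreover have "H (\<lambda>n. c * u n) = (\<lambda>n. c * H u n)" for c u
    using jacobi_linear[of v c u 0 u] by simp
  moreover have "\<exists>K. \<forall>u\<in>ell2. ell2_norm (H u) \<le> K * ell2_norm u" using 1 by blast
  ultimately show ?thesis using 1 unfolding bounded_op_def by blast
qed

lemmas H_ell2 = bounded_opD(1)[OF bounded_op_H]

lemma symmetric_H: "symmetric_op H"
  unfolding symmetric_op_def
proof (intro ballI)
  fix u w assume u: "u \<in> ell2" and w: "w \<in> ell2"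
  obtain K where K: "K \<ge> 0" "\<And>u. u \<in> ell2 \<Longrightarrow> ell2_norm (H u) \<le> K * ell2_norm u"
    using bounded_op_boundE[OF bounded_op_H] by blast
  have "ell2_inner (H u) w - ell2_inner u (H w) = 0"
  proof (rule ell2_functional_eq_0[where C="2 * (K * ell2_norm u)", OF _ _ _ _ w])
    fix x assume x: "x \<in> ell2"
    have "cmod (ell2_inner (H u) x - ell2_inner u (H x)) \<le> cmod (ell2_inner (H u) x) + cmod (ell2_inner u (H x))"
      by (rule norm_triangle_ineq4)
    also have "\<dots> \<le> ell2_norm (H u) * ell2_norm x + ell2_norm u * ell2_norm (H x)"
      by (intro add_mono ell2_Cauchy_Schwarz H_ell2 u x)
    also have "\<dots> \<le> (K * ell2_norm u) * ell2_norm x + ell2_norm u * (K * ell2_norm x)"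
      by (intro add_mono mult_right_mono mult_left_mono K u x ell2_norm_nonneg)
    finally show "cmod (ell2_inner (H u) x - ell2_inner u (H x)) \<le> 2 * (K * ell2_norm u) * ell2_norm x"
      by (simp add: algebra_simps)
  next
    fix l :: nat assume l: "l \<ge> 1"
    have d: "delta (l + 1) \<in> ell2" "(\<lambda>n. if l = 1 then 0 else delta (l - 1) n) \<in> ell2" "delta l \<in> ell2"
      using l by (auto intro!: delta_ell2) (cases "l = 1"; simp add: ell2_zero_seq delta_ell2)
    have "ell2_inner u (H (delta l)) = cnj (u (l + 1)) + ell2_inner u (\<lambda>n. if l = 1 then 0 else delta (l - 1) n)
        + of_real (v l) * cnj (u l)"
      unfolding jacobi_delta[OF l]
      by (simp only: ell2_inner_add_right ell2_inner_scale_right u d ell2_add ell2_scale ell2_inner_delta_right)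
    moreover have "ell2_inner u (\<lambda>n. if l = 1 then 0 else delta (l - 1) n) = cnj (u (l - 1))"
      using ell2_zero[OF u] l by (cases "l = 1") (auto simp: ell2_inner_delta_right, simp add: ell2_inner_def)
    ultimately show "ell2_inner (H u) (delta l) - ell2_inner u (H (delta l)) = 0"
      using l by (simp add: ell2_inner_delta_right jacobi_def)
  qed (simp_all add: bounded_opD[OF bounded_op_H] ell2_inner_add_right ell2_inner_scale_right u H_ell2 algebra_simps)
  then show "ell2_inner (H u) w = ell2_inner u (H w)" by simp
qed

text \<open>The operator norm itself and not just some bound: the last clause of
  \<open>is_borel_calculus\<close> ranges over all norm bounds, so the calculus has to live on the
  smallest interval \<open>{-R..R}\<close>.\<close>

definition R :: real where
  "R = Inf {r. \<forall>u\<in>ell2. ell2_norm (H u) \<le> r * ell2_norm u}"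

lemma bound_ge_1:
  assumes "\<forall>u\<in>ell2. ell2_norm (H u) \<le> r * ell2_norm u"
  shows "1 \<le> r"
proof -
  have d: "delta 1 \<in> ell2" by (simp add: delta_ell2)
  have n: "ell2_norm (delta 1) = 1" by (simp add: ell2_norm_delta)
  have "1 \<le> cmod (H (delta 1) 2)" by (simp add: jacobi_def delta_def)
  also have "\<dots> \<le> ell2_norm (H (delta 1))" by (rule cmod_le_ell2_norm[OF H_ell2[OF d]])
  also have "\<dots> \<le> r * ell2_norm (delta 1)" using assms d by blast
  finally show ?thesis using n by simp
qed

lemma R_le: "\<forall>u\<in>ell2. ell2_norm (H u) \<le> r * ell2_norm u \<Longrightarrow> R \<le> r"
  unfolding R_def by (rule cInf_lower) (auto intro!: bdd_belowI[of _ 1] bound_ge_1)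

lemma R_bound: "u \<in> ell2 \<Longrightarrow> ell2_norm (H u) \<le> R * ell2_norm u"
proof -
  assume u: "u \<in> ell2"
  obtain K where K: "\<And>u. u \<in> ell2 \<Longrightarrow> ell2_norm (H u) \<le> K * ell2_norm u"
    using bounded_op_boundE[OF bounded_op_H] by blast
  show ?thesis
  proof (cases "ell2_norm u = 0")
    case True
    then show ?thesis using K[OF u] by simp
  next
    case False
    then have pos: "ell2_norm u > 0" using ell2_norm_nonneg[OF u] by simp
    have "ell2_norm (H u) / ell2_norm u \<le> R"
      unfolding R_def using K u pos by (intro cInf_greatest) (auto simp: divide_le_eq)
    then show ?thesis using pos by (simp add: divide_le_eq)
  qed
qed

lemma R_ge_1: "1 \<le> R"
  using R_bound by (intro bound_ge_1) auto

definition T :: ell2_op where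
  "T = (\<lambda>u n. complex_of_real (1/2) * u n + complex_of_real (1 / (2 * R)) * H u n)"

text \<open>Equal to I - \<open>T\<close>, so that products of powers of \<open>T\<close> and
  \<open>S\<close> play the part of x^k (1 - x)^l.\<close>

definition S :: ell2_op where
  "S = (\<lambda>u n. complex_of_real (1/2) * u n + complex_of_real (- 1 / (2 * R)) * H u n)"

lemma bounded_op_T: "bounded_op T" and bounded_op_S: "bounded_op S"
  unfolding T_def S_def by (rule bounded_op_affine[OF bounded_op_H])+

lemma symmetric_T: "symmetric_op T" and symmetric_S: "symmetric_op S"
  unfolding T_def S_def by (rule symmetric_op_affine[OF bounded_op_H symmetric_H])+

lemma affine_H_commute:
  "(\<lambda>n. a * (c * u n + d * H u n) + b * H (\<lambda>n. c * u n + d * H u n) n) =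
   (\<lambda>n. c * (a * u n + b * H u n) + d * H (\<lambda>n. a * u n + b * H u n) n)"
  unfolding jacobi_linear by (simp add: algebra_simps)

lemma T_S_commute: "T (S u) = S (T u)"
  unfolding T_def S_def by (rule affine_H_commute)

lemma T_plus_S: "(\<lambda>n. T u n + S u n) = u"
proof
  fix n
  have "(h * x + c * y) + (h' * x + d * y) = (h + h') * x + (c + d) * y" for h h' c d x y :: complex
    by (simp add: algebra_simps)
  then have "T u n + S u n = (complex_of_real (1/2) + complex_of_real (1/2)) * u n +
      (complex_of_real (1 / (2 * R)) + complex_of_real (- 1 / (2 * R))) * H u n"
    unfolding T_def S_def by blast
  also have "\<dots> = u n" by (simp flip: of_real_add)
  finally show "T u n + S u n = u n" .
qed

text \<open>Cauchy-Schwarz and the norm bound R give the first two. The third holds since <w, T S w>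
  = |w|^2/4 - |H w|^2/(4 R^2). Together with <w, w> >= 0 these are the cases to which
  \<open>mom_nonneg\<close> reduces.\<close>

lemma Re_inner_T_S:
  assumes w: "w \<in> ell2"
  shows "0 \<le> Re (ell2_inner w (T w))" "0 \<le> Re (ell2_inner w (S w))" "0 \<le> Re (ell2_inner w (T (S w)))"
proof -
  have R: "R > 0" using R_ge_1 by simp
  have Hw: "H w \<in> ell2" by (rule H_ell2[OF w])
  have a: "\<bar>Re (ell2_inner w (H w))\<bar> \<le> R * (ell2_norm w)\<^sup>2"
  proof -
    have "\<bar>Re (ell2_inner w (H w))\<bar> \<le> ell2_norm w * ell2_norm (H w)"
      using abs_Re_le_cmod ell2_Cauchy_Schwarz[OF w Hw] by (rule order_trans)
    also have "\<dots> \<le> ell2_norm w * (R * ell2_norm w)"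
      by (intro mult_left_mono R_bound w ell2_norm_nonneg)
    finally show ?thesis by (simp add: power2_eq_square mult.left_commute)
  qed
  define c where "c = 1 / (2 * R)"
  have c: "c > 0" "c * R = 1 / 2" using R by (auto simp: c_def)
  have "ell2_inner w (T w) = complex_of_real (1 / 2 * (ell2_norm w)\<^sup>2) + complex_of_real c * ell2_inner w (H w)"
    unfolding T_def c_def
    by (simp only: ell2_inner_add_right ell2_inner_scale_right ell2_scale w Hw ell2_inner_self of_real_mult)
  then have eqT: "Re (ell2_inner w (T w)) = 1 / 2 * (ell2_norm w)\<^sup>2 + c * Re (ell2_inner w (H w))"
    by simp
  have S_c: "S = (\<lambda>u n. complex_of_real (1/2) * u n + complex_of_real (- c) * H u n)"
    by (simp add: S_def c_def)
  then have "ell2_inner w (S w) = complex_of_real (1 / 2 * (ell2_norm w)\<^sup>2) + complex_of_real (- c) * ell2_inner w (H w)"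
    by (simp only: ell2_inner_add_right ell2_inner_scale_right ell2_scale w Hw ell2_inner_self of_real_mult)
  then have eqS: "Re (ell2_inner w (S w)) = 1 / 2 * (ell2_norm w)\<^sup>2 - c * Re (ell2_inner w (H w))"
    by simp
  have "\<bar>c * Re (ell2_inner w (H w))\<bar> \<le> c * (R * (ell2_norm w)\<^sup>2)"
    using mult_left_mono[OF a, of c] c by (simp add: abs_mult)
  then have ca: "\<bar>c * Re (ell2_inner w (H w))\<bar> \<le> 1 / 2 * (ell2_norm w)\<^sup>2"
    using c by (simp only: mult.assoc[symmetric])
  show "0 \<le> Re (ell2_inner w (T w))" "0 \<le> Re (ell2_inner w (S w))"
    unfolding eqT eqS using ca by linarith+
  have "ell2_inner w (T (S w)) = ell2_inner (T w) (S w)"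
    by (rule symmetric_opD[OF symmetric_T w bounded_opD(1)[OF bounded_op_S w], symmetric])
  also have "\<dots> = complex_of_real (1/2) * (complex_of_real (1/2) * ell2_inner w w + complex_of_real (- c) * ell2_inner w (H w))
      + complex_of_real c * (complex_of_real (1/2) * ell2_inner w (H w) + complex_of_real (- c) * ell2_inner (H w) (H w))"
    unfolding S_c T_def c_def[symmetric]
    by (simp only: ell2_inner_add_right ell2_inner_scale_right ell2_inner_add_left ell2_inner_scale_left 
        ell2_add ell2_scale w Hw symmetric_opD[OF symmetric_H w w] complex_cnj_complex_of_real) (simp add: algebra_simps)
  also have "\<dots> = complex_of_real (1/4 * (ell2_norm w)\<^sup>2 - c * c * (ell2_norm (H w))\<^sup>2)"
    by (simp add: ell2_inner_self w Hw algebra_simps)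
  finally have "Re (ell2_inner w (T (S w))) = 1/4 * (ell2_norm w)\<^sup>2 - c * c * (ell2_norm (H w))\<^sup>2"
    by (simp only: Re_complex_of_real)
  moreover have "(c * ell2_norm (H w))\<^sup>2 \<le> (c * (R * ell2_norm w))\<^sup>2"
    using c by (intro power_mono mult_left_mono mult_nonneg_nonneg R_bound w ell2_norm_nonneg Hw) auto
  moreover have "(c * (R * ell2_norm w))\<^sup>2 = 1/4 * (ell2_norm w)\<^sup>2"
    by (simp only: mult.assoc[symmetric] c(2)) (simp add: power2_eq_square)
  moreover have "(c * ell2_norm (H w))\<^sup>2 = c * c * (ell2_norm (H w))\<^sup>2"
    by (simp add: power2_eq_square)
  ultimately show "0 \<le> Re (ell2_inner w (T (S w)))" by linarith
qed

section \<open>Complete monotonicity of the moments\<close>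

definition mom :: "nat \<Rightarrow> nat \<Rightarrow> real" where
  "mom k l = Re (ell2_inner (delta 1) ((T ^^ k) ((S ^^ l) (delta 1))))"

lemma d1: "delta 1 \<in> ell2" by (simp add: delta_ell2)

lemma mom_rec: "mom k l = mom (Suc k) l + mom k (Suc l)"
proof -
  let ?w = "(S ^^ l) (delta 1)"
  have w: "?w \<in> ell2" by (intro bounded_opD(1)[OF bounded_op_funpow[OF bounded_op_S]] d1)
  have TS: "T ?w \<in> ell2" "S ?w \<in> ell2" by (rule bounded_opD(1)[OF bounded_op_T w], rule bounded_opD(1)[OF bounded_op_S w])
  have "(T ^^ k) ?w = (T ^^ k) (\<lambda>n. T ?w n + S ?w n)" by (simp only: T_plus_S)
  also have "\<dots> = (\<lambda>n. (T ^^ k) (T ?w) n + (T ^^ k) (S ?w) n)"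
    by (rule bounded_opD(2)[OF bounded_op_funpow[OF bounded_op_T] TS])
  also have "(T ^^ k) (T ?w) = (T ^^ Suc k) ?w" by (simp add: funpow_swap1)
  also have "S ?w = (S ^^ Suc l) (delta 1)" by simp
  finally have "(T ^^ k) ?w 1 = (T ^^ Suc k) ?w 1 + (T ^^ k) ((S ^^ Suc l) (delta 1)) 1" by (rule fun_cong)
  then show ?thesis unfolding mom_def ell2_inner_delta_left by (simp only: plus_complex.sel)
qed

text \<open>Half of each exponent is moved to the left slot of the inner product by symmetry and
  commutation. What remains is <w, T^i S^j w> with i and j in {0, 1}, the parities of k and
  l.\<close>

lemma mom_nonneg: "0 \<le> mom k l"
proof -
  have half: "\<exists>a i. n = a + (i + a) \<and> (i = 0 \<or> i = 1)" for n :: nat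
  proof (intro exI conjI)
    show "n = n div 2 + (n mod 2 + n div 2)" using div_mult_mod_eq[of n 2] by linarith
    show "n mod 2 = 0 \<or> n mod 2 = 1" by (simp add: mod2_eq_if)
  qed
  obtain a i where k: "k = a + (i + a)" and i: "i = 0 \<or> i = 1" using half by blast
  obtain b j where l: "l = b + (j + b)" and j: "j = 0 \<or> j = 1" using half by blast
  note Tb = bounded_op_funpow[OF bounded_op_T] and Sb = bounded_op_funpow[OF bounded_op_S]
  define w where "w = (T ^^ a) ((S ^^ b) (delta 1))"
  have w: "w \<in> ell2" unfolding w_def by (intro bounded_opD(1)[OF Tb] bounded_opD(1)[OF Sb] d1)
  have comm: "(T ^^ p) ((S ^^ q) u) = (S ^^ q) ((T ^^ p) u)" if "u \<in> ell2" for p q u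
    by (rule funpow_commute_on_ell2[OF bounded_op_T Sb _ that])
      (rule funpow_commute_on_ell2[OF bounded_op_S bounded_op_T T_S_commute[symmetric], symmetric])
  have "(T ^^ k) ((S ^^ l) (delta 1)) = (T ^^ a) ((T ^^ i) ((T ^^ a) ((S ^^ b) ((S ^^ j) ((S ^^ b) (delta 1))))))"
    unfolding k l by (simp only: funpow_add o_apply)
  also have "(T ^^ a) ((S ^^ b) ((S ^^ j) ((S ^^ b) (delta 1)))) = (S ^^ b) ((S ^^ j) w)"
    unfolding w_def by (simp only: comm bounded_opD(1)[OF Sb] d1)
  also have "(T ^^ i) ((S ^^ b) ((S ^^ j) w)) = (S ^^ b) ((T ^^ i) ((S ^^ j) w))"
    by (simp only: comm bounded_opD(1)[OF Sb] w)
  finally have "ell2_inner (delta 1) ((T ^^ k) ((S ^^ l) (delta 1)))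
      = ell2_inner (delta 1) ((T ^^ a) ((S ^^ b) ((T ^^ i) ((S ^^ j) w))))" by simp
  also have "\<dots> = ell2_inner ((T ^^ a) (delta 1)) ((S ^^ b) ((T ^^ i) ((S ^^ j) w)))"
    by (intro symmetric_opD[OF symmetric_op_funpow[OF bounded_op_T symmetric_T], symmetric] d1
        bounded_opD(1)[OF Tb] bounded_opD(1)[OF Sb] w)
  also have "\<dots> = ell2_inner ((S ^^ b) ((T ^^ a) (delta 1))) ((T ^^ i) ((S ^^ j) w))"
    by (intro symmetric_opD[OF symmetric_op_funpow[OF bounded_op_S symmetric_S], symmetric] d1
        bounded_opD(1)[OF Tb] bounded_opD(1)[OF Sb] w)
  also have "(S ^^ b) ((T ^^ a) (delta 1)) = w" unfolding w_def by (simp only: comm d1)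
  finally have "mom k l = Re (ell2_inner w ((T ^^ i) ((S ^^ j) w)))" by (simp add: mom_def)
  moreover have "0 \<le> Re (ell2_inner w w)" by (simp add: ell2_inner_self w)
  ultimately show ?thesis using i j Re_inner_T_S[OF w] by auto
qed

end

section \<open>Orthonormal polynomials and the spectral measure of a Jacobi operator\<close>

text \<open>The solution of the eigenvalue recurrence with values 0 and 1 at n = 0 and n = 1, hence
  a polynomial of degree n - 1 for n >= 1. As the off-diagonal entries are 1, these polynomials come
  out orthonormal without rescaling.\<close>

fun jpoly :: "(nat \<Rightarrow> real) \<Rightarrow> nat \<Rightarrow> real \<Rightarrow> real" where
  "jpoly v 0 x = 0"
| "jpoly v (Suc 0) x = 1"
| "jpoly v (Suc (Suc n)) x = (x - v (Suc n)) * jpoly v (Suc n) x - jpoly v n x"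

lemma continuous_on_jpoly [continuous_intros]:
  "continuous_on A f \<Longrightarrow> continuous_on A (\<lambda>x. jpoly v n (f x))"
proof (induction v n "x::real" arbitrary: f rule: jpoly.induct)
  case (3 v n x)
  show ?case by (simp, intro continuous_intros 3)
qed (simp_all)

lemma borel_measurable_jpoly [measurable]: "jpoly v n \<in> borel_measurable borel"
  using continuous_on_jpoly[OF continuous_on_id, of UNIV v n] by (intro borel_measurable_continuous_onI) simp

lemma integrable_supported_Icc:
  fixes f :: "real \<Rightarrow> 'a::{banach, second_countable_topology}"
  assumes "finite_measure M" "sets M = sets borel" "AE x in M. x \<in> {a..b}"
    and "f \<in> borel_measurable borel" "\<And>x. x \<in> {a..b} \<Longrightarrow> norm (f x) \<le> K"
  shows "integrable M f"
proof (rule finite_measure.integrable_const_bound[OF assms(1)])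
  show "AE x in M. norm (f x) \<le> K" using assms(3) by eventually_elim (rule assms(5))
  show "f \<in> borel_measurable M" using assms(2,4) by (simp cong: measurable_cong_sets)
qed

lemma integrable_continuous_supported_Icc:
  fixes f :: "real \<Rightarrow> real"
  assumes M: "finite_measure M" "sets M = sets borel" "AE x in M. x \<in> {a..b}"
    and f: "continuous_on UNIV f"
  shows "integrable M f"
proof -
  have "bounded (f ` {a..b})"
    by (intro compact_imp_bounded compact_continuous_image continuous_on_subset[OF f]) auto
  then obtain K where K: "\<forall>y\<in>f ` {a..b}. norm y \<le> K" unfolding bounded_iff by blast
  show ?thesis
    by (rule integrable_supported_Icc[OF M borel_measurable_continuous_onI[OF f], of K]) (use K in blast)
qed

context bounded_jacobi
begin

text \<open>The Hausdorff measure on [0,1] belongs to \<open>T\<close>; its image under the inverse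
  rescaling t -> 2 R t - R belongs to \<open>H\<close>. Orthonormality is the case k = 0 of the
  identity that the integral of p_n p_m t^k is the (n, m) entry of \<open>T ^^ k\<close>.\<close>

lemma spectral_measure_exists:
  "\<exists>M. real_distribution M \<and> (AE x in M. x \<in> {-R..R}) \<and>
    (\<forall>n m. n \<ge> 1 \<longrightarrow> m \<ge> 1 \<longrightarrow> (\<integral>x. jpoly v n x * jpoly v m x \<partial>M) = (if n = m then 1 else 0))"
proof -
  have R: "R > 0" using R_ge_1 by simp
  obtain N where N: "real_distribution N" and supp: "AE x in N. x \<in> {0..1}"
    and momN: "\<And>j. (\<integral>x. x ^ j \<partial>N) = mom j 0"
    using hausdorff_moment[of mom, OF mom_rec mom_nonneg] by (auto simp: mom_def ell2_inner_delta_left delta_apply)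
  interpret N: real_distribution N by (rule N)
  define y where "y = (\<lambda>t. 2 * R * t - R)"
  define q where "q = (\<lambda>n t. jpoly v n (y t))"
  have qc: "continuous_on UNIV (q n)" for n
    unfolding q_def y_def by (intro continuous_intros)
  have int: "integrable N f" if "continuous_on UNIV f" for f :: "real \<Rightarrow> real"
    using integrable_continuous_supported_Icc[OF N.finite_measure_axioms N.events_eq_borel supp that] .
  define D where "D = (\<lambda>n m k. \<integral>t. q n t * q m t * t ^ k \<partial>N)"
  \<comment> \<open>Both sides obey the same three-term recurrence in n: a further factor t in the
    integral is a further application of \<open>T\<close>, and 2 R T - R is \<open>H\<close>.
    Equality at n = 1 for all k therefore propagates to all n.\<close>
  have step: "D n m k = Re ((T ^^ k) (delta m) n)"
    if m: "m \<ge> 1" and base: "\<And>k. D 1 m k = Re ((T ^^ k) (delta m) 1)" for n m k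
  proof -
    have "\<forall>k. D n m k = Re ((T ^^ k) (delta m) n)"
    proof (induction n rule: induct_nat_012)
      case 0
      have "(T ^^ k) (delta m) 0 = 0" for k
        by (rule ell2_zero) (intro bounded_opD(1)[OF bounded_op_funpow[OF bounded_op_T]] delta_ell2 m)
      then show ?case by (simp add: D_def q_def)
    next
      case 1
      then show ?case using base by simp
    next
      case (ge2 n)
      show ?case
      proof
        fix k
        define u where "u = (T ^^ k) (delta m)"
        have i: "integrable N (\<lambda>t. q a t * q m t * t ^ j)" for a j
          by (intro int continuous_intros qc)
        have "D (Suc (Suc n)) m k = (\<integral>t. 2 * R * (q (Suc n) t * q m t * t ^ Suc k)
            - (R + v (Suc n)) * (q (Suc n) t * q m t * t ^ k) - q n t * q m t * t ^ k \<partial>N)"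
          unfolding D_def by (intro Bochner_Integration.integral_cong refl) (simp add: q_def y_def algebra_simps)
        also have "\<dots> = 2 * R * D (Suc n) m (Suc k) - (R + v (Suc n)) * D (Suc n) m k - D n m k"
          using i[of "Suc n" "Suc k"] i[of "Suc n" k] i[of n k] unfolding D_def by simp
        also have "\<dots> = 2 * R * Re (T u (Suc n)) - (R + v (Suc n)) * Re (u (Suc n)) - Re (u n)"
          using ge2 by (simp add: u_def)
        also have "\<dots> = Re (u (Suc (Suc n)))"
        proof -
          have "T u (Suc n) = complex_of_real (1 / 2) * u (Suc n) + complex_of_real (1 / (2 * R)) * H u (Suc n)"
            by (simp add: T_def)
          then have "Re (T u (Suc n)) = 1 / 2 * Re (u (Suc n)) + 1 / (2 * R) * Re (H u (Suc n))"
            by (simp del: of_real_divide)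
          moreover have "Re (H u (Suc n)) = Re (u (Suc (Suc n))) + Re (u n) + v (Suc n) * Re (u (Suc n))"
            by (simp add: jacobi_def)
          ultimately show ?thesis using R by (simp add: field_simps)
        qed
        finally show "D (Suc (Suc n)) m k = Re ((T ^^ k) (delta m) (Suc (Suc n)))" by (simp add: u_def)
      qed
    qed
    then show ?thesis by blast
  qed
  have D1: "D n 1 k = Re ((T ^^ k) (delta 1) n)" for n k
    by (rule step) (use momN in \<open>simp_all add: D_def q_def mom_def ell2_inner_delta_left\<close>)
  \<comment> \<open>The base case for general m comes from the case m = 1: D is symmetric in n and
    m, and \<open>T ^^ k\<close> is symmetric.\<close>
  have D: "D n m k = Re ((T ^^ k) (delta m) n)" if m: "m \<ge> 1" for n m k
  proof (rule step[OF m])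
    fix k
    have "D 1 m k = D m 1 k" by (simp add: D_def mult.commute)
    also have "\<dots> = Re (ell2_inner (delta m) ((T ^^ k) (delta 1)))"
      by (simp add: D1 ell2_inner_delta_left del: One_nat_def)
    also have "ell2_inner (delta m) ((T ^^ k) (delta 1)) = ell2_inner ((T ^^ k) (delta m)) (delta 1)"
      by (intro symmetric_opD[OF symmetric_op_funpow[OF bounded_op_T symmetric_T], symmetric] delta_ell2 m) simp
    finally show "D 1 m k = Re ((T ^^ k) (delta m) 1)" by (simp add: ell2_inner_delta_right)
  qed
  define M where "M = distr N borel y"
  have [measurable]: "y \<in> borel_measurable borel" unfolding y_def by measurable
  have "real_distribution M" unfolding M_def by (rule N.real_distribution_distr) simp
  moreover have "AE x in M. x \<in> {-R..R}"
    unfolding M_def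
  proof (subst AE_distr_iff)
    show "AE t in N. y t \<in> {-R..R}"
      using supp by eventually_elim (use R in \<open>auto simp: y_def\<close>)
  qed auto
  moreover have "(\<integral>x. jpoly v n x * jpoly v m x \<partial>M) = (if n = m then 1 else 0)" if "n \<ge> 1" "m \<ge> 1" for n m
  proof -
    have "(\<integral>x. jpoly v n x * jpoly v m x \<partial>M) = D n m 0"
      unfolding M_def D_def q_def by (subst integral_distr) auto
    then show ?thesis using D[of m n 0] that by (auto simp: delta_apply)
  qed
  ultimately show ?thesis by blast
qed

end

section \<open>The matrix functional calculus\<close>

lemma bounded_borelD:
  assumes "g \<in> bounded_borel"
  shows "g \<in> borel_measurable borel" "\<exists>K. \<forall>x. cmod (g x) \<le> K"
  using assms by (auto simp: bounded_borel_def bounded_iff)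

lemma bounded_borelI: "g \<in> borel_measurable borel \<Longrightarrow> (\<And>x. cmod (g x) \<le> K) \<Longrightarrow> g \<in> bounded_borel"
  by (auto simp: bounded_borel_def bounded_iff)

lemma bounded_borel_const: "(\<lambda>x. c) \<in> bounded_borel"
  by (rule bounded_borelI[where K="cmod c"]) auto

lemma bounded_borel_add:
  assumes "g \<in> bounded_borel" "h \<in> bounded_borel" shows "(\<lambda>x. g x + h x) \<in> bounded_borel"
proof -
  obtain K L where KL: "\<And>x. cmod (g x) \<le> K" "\<And>x. cmod (h x) \<le> L"
    using bounded_borelD(2)[OF assms(1)] bounded_borelD(2)[OF assms(2)] by blast
  note [measurable] = bounded_borelD(1)[OF assms(1)] bounded_borelD(1)[OF assms(2)]
  show ?thesis
    by (rule bounded_borelI[where K="K + L"]) (measurable, intro norm_triangle_le add_mono KL)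
qed

lemma bounded_borel_mult:
  assumes "g \<in> bounded_borel" "h \<in> bounded_borel" shows "(\<lambda>x. g x * h x) \<in> bounded_borel"
proof -
  obtain K L where KL: "\<And>x. cmod (g x) \<le> K" "\<And>x. cmod (h x) \<le> L"
    using bounded_borelD(2)[OF assms(1)] bounded_borelD(2)[OF assms(2)] by blast
  note [measurable] = bounded_borelD(1)[OF assms(1)] bounded_borelD(1)[OF assms(2)]
  have "0 \<le> K" using KL(1)[of 0] norm_ge_zero[of "g 0"] by linarith
  then show ?thesis
    by (intro bounded_borelI[where K="K * L"]) (measurable, simp add: norm_mult mult_mono KL)
qed

lemma bounded_borel_scale: "g \<in> bounded_borel \<Longrightarrow> (\<lambda>x. c * g x) \<in> bounded_borel"
  by (intro bounded_borel_mult bounded_borel_const)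

lemma borel_measurable_cnj [measurable]: "cnj \<in> borel_measurable borel"
  by (rule borel_measurable_continuous_onI) (intro continuous_intros)

lemma bounded_borel_cnj:
  assumes "g \<in> bounded_borel" shows "(\<lambda>x. cnj (g x)) \<in> bounded_borel"
proof -
  obtain K where K: "\<And>x. cmod (g x) \<le> K" using bounded_borelD(2)[OF assms] by blast
  note [measurable] = bounded_borelD(1)[OF assms]
  show ?thesis by (rule bounded_borelI[where K=K]) (simp_all add: K)
qed

lemma bounded_borel_limit:
  assumes "\<And>k. gs k \<in> bounded_borel" "\<And>k x. cmod (gs k x) \<le> K" "\<And>x. (\<lambda>k. gs k x) \<longlonglongrightarrow> g x"
  shows "g \<in> bounded_borel" "\<And>x. cmod (g x) \<le> K"
proof -
  show K: "cmod (g x) \<le> K" for x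
    by (rule Lim_bounded[OF tendsto_norm[OF assms(3)[of x]], of 0]) (use assms(2) in blast)
  have "g \<in> borel_measurable borel"
    by (rule borel_measurable_LIMSEQ_metric[OF bounded_borelD(1)[OF assms(1)] assms(3)])
  then show "g \<in> bounded_borel" by (rule bounded_borelI) (rule K)
qed

section \<open>Expansion in orthonormal polynomials\<close>

locale jacobi_spectral = bounded_jacobi + M: real_distribution M for M +
  assumes supp: "AE x in M. x \<in> {-R..R}"
    and orth: "\<And>n m. n \<ge> 1 \<Longrightarrow> m \<ge> 1 \<Longrightarrow> (\<integral>x. jpoly v n x * jpoly v m x \<partial>M) = (if n = m then 1 else 0)"
begin

definition adm :: "(real \<Rightarrow> complex) \<Rightarrow> bool" where
  "adm h \<longleftrightarrow> h \<in> borel_measurable borel \<and> (\<exists>K. \<forall>x\<in>{-R..R}. cmod (h x) \<le> K)"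

lemma adm_measurable: "adm h \<Longrightarrow> h \<in> borel_measurable borel"
  by (simp add: adm_def)

lemma adm_integrable: 
  assumes "adm h" shows "integrable M h"
proof -
  obtain K where K: "\<forall>x\<in>{-R..R}. cmod (h x) \<le> K" using assms unfolding adm_def by blast
  show ?thesis
    by (rule integrable_supported_Icc[OF M.finite_measure_axioms M.events_eq_borel supp adm_measurable[OF assms], of K])
      (use K in blast)
qed

lemma adm_add: 
  assumes "adm g" "adm h" shows "adm (\<lambda>x. g x + h x)"
proof -
  obtain K L where KL: "\<And>x. x \<in> {-R..R} \<Longrightarrow> cmod (g x) \<le> K" "\<And>x. x \<in> {-R..R} \<Longrightarrow> cmod (h x) \<le> L"
    using assms unfolding adm_def by blast
  note [measurable] = adm_measurable[OF assms(1)] adm_measurable[OF assms(2)]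
  have "\<forall>x\<in>{-R..R}. cmod (g x + h x) \<le> K + L"
    by (intro ballI norm_triangle_le add_mono KL)
  moreover have "(\<lambda>x. g x + h x) \<in> borel_measurable borel" by measurable
  ultimately show ?thesis unfolding adm_def by blast
qed

lemma adm_mult: 
  assumes "adm g" "adm h" shows "adm (\<lambda>x. g x * h x)"
proof -
  obtain K L where KL: "\<And>x. x \<in> {-R..R} \<Longrightarrow> cmod (g x) \<le> K" "\<And>x. x \<in> {-R..R} \<Longrightarrow> cmod (h x) \<le> L"
    using assms unfolding adm_def by blast
  note [measurable] = adm_measurable[OF assms(1)] adm_measurable[OF assms(2)]
  have "0 \<le> K" using KL(1)[of 0] norm_ge_zero[of "g 0"] R_ge_1 by (simp del: norm_ge_zero)
  then have "\<forall>x\<in>{-R..R}. cmod (g x * h x) \<le> K * L"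
    unfolding norm_mult by (intro ballI mult_mono KL) auto
  moreover have "(\<lambda>x. g x * h x) \<in> borel_measurable borel" by measurable
  ultimately show ?thesis unfolding adm_def by blast
qed

lemma adm_continuous:
  assumes "continuous_on UNIV f" shows "adm f"
proof -
  have "bounded (f ` {-R..R})"
    by (intro compact_imp_bounded compact_continuous_image continuous_on_subset[OF assms]) auto
  then obtain K where K: "\<forall>y\<in>f ` {-R..R}. norm y \<le> K" unfolding bounded_iff by blast
  then show ?thesis using borel_measurable_continuous_onI[OF assms] unfolding adm_def by blast
qed

lemma adm_bounded_borel: "g \<in> bounded_borel \<Longrightarrow> adm g"
  using bounded_borelD unfolding adm_def by blast

lemma adm_jpoly: "adm (\<lambda>x. complex_of_real (jpoly v n x))"
  by (intro adm_continuous continuous_intros)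

lemma adm_const: "adm (\<lambda>x. c)"
  by (intro adm_continuous continuous_intros)

lemma adm_sum: "(\<And>i. i \<in> A \<Longrightarrow> adm (f i)) \<Longrightarrow> adm (\<lambda>x. \<Sum>i\<in>A. f i x)"
  by (induction A rule: infinite_finite_induct) (simp_all add: adm_const adm_add)

lemma adm_cnj: "adm g \<Longrightarrow> adm (\<lambda>x. cnj (g x))"
  unfolding adm_def complex_mod_cnj by (intro conjI) auto

lemmas adm_intros = adm_add adm_mult adm_jpoly adm_const adm_sum adm_cnj

lemma adm_norm_integrable: "adm h \<Longrightarrow> integrable M (\<lambda>x. (cmod (h x))\<^sup>2)"
proof -
  assume h: "adm h"
  have "integrable M (\<lambda>x. cmod (h x * cnj (h x)))"
    by (intro integrable_norm adm_integrable adm_intros h)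
  then show ?thesis by (simp add: norm_mult power2_eq_square)
qed

text \<open>The Fourier coefficients of h in the orthonormal polynomials; this map sends the n-th
  polynomial to \<open>delta n\<close> for n >= 1.\<close>

definition cf :: "(real \<Rightarrow> complex) \<Rightarrow> nat \<Rightarrow> complex" where
  "cf h n = (\<integral>x. h x * complex_of_real (jpoly v n x) \<partial>M)"

lemma cf_0: "cf h 0 = 0"
  by (simp add: cf_def)

lemma cf_add: "adm g \<Longrightarrow> adm h \<Longrightarrow> cf (\<lambda>x. g x + h x) n = cf g n + cf h n"
  unfolding cf_def distrib_right by (intro Bochner_Integration.integral_add adm_integrable adm_intros)

lemma cf_scale: "adm g \<Longrightarrow> cf (\<lambda>x. c * g x) n = c * cf g n"
  unfolding cf_def mult.assoc by (intro Bochner_Integration.integral_mult_right adm_integrable adm_intros)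

lemma cf_sum: "(\<And>i. i \<in> A \<Longrightarrow> adm (f i)) \<Longrightarrow> cf (\<lambda>x. \<Sum>i\<in>A. f i x) n = (\<Sum>i\<in>A. cf (f i) n)"
proof (induction A rule: infinite_finite_induct)
  case (insert a A)
  then show ?case by (simp add: cf_add adm_sum)
qed (simp_all add: cf_def)

lemma orth_complex:
  "(\<integral>x. complex_of_real (jpoly v n x) * complex_of_real (jpoly v m x) \<partial>M) = (if n = m \<and> n \<ge> 1 then 1 else 0)"
proof -
  have "(\<integral>x. complex_of_real (jpoly v n x * jpoly v m x) \<partial>M) = complex_of_real (if n = m \<and> n \<ge> 1 then 1 else 0)"
    unfolding integral_complex_of_real
    using orth[of n m] by (cases "n = 0"; cases "m = 0") auto
  then show ?thesis by simp
qed

lemma cf_jpoly: "cf (\<lambda>x. complex_of_real (jpoly v m x)) n = (if n = m \<and> n \<ge> 1 then 1 else 0)"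
  unfolding cf_def orth_complex by auto

lemma inner_expansion:
  assumes h: "adm h"
  shows "(\<integral>x. h x * cnj (\<Sum>k<N. c k * complex_of_real (jpoly v k x)) \<partial>M) = (\<Sum>k<N. cnj (c k) * cf h k)"
proof -
  have "(\<integral>x. h x * cnj (\<Sum>k<N. c k * complex_of_real (jpoly v k x)) \<partial>M)
      = (\<integral>x. (\<Sum>k<N. cnj (c k) * (h x * complex_of_real (jpoly v k x))) \<partial>M)"
    by (intro Bochner_Integration.integral_cong refl) (simp add: sum_distrib_left mult_ac)
  also have "\<dots> = (\<Sum>k<N. (\<integral>x. cnj (c k) * (h x * complex_of_real (jpoly v k x)) \<partial>M))"
    by (intro Bochner_Integration.integral_sum adm_integrable adm_intros h)
  also have "\<dots> = (\<Sum>k<N. cnj (c k) * cf h k)"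
    unfolding cf_def
    by (intro sum.cong refl Bochner_Integration.integral_mult_right adm_integrable adm_intros h)
  finally show ?thesis .
qed

lemma cf_expansion: 
  "cf (\<lambda>x. \<Sum>k<N. c k * complex_of_real (jpoly v k x)) n = (if n < N \<and> n \<ge> 1 then c n else 0)"
proof -
  have "cf (\<lambda>x. \<Sum>k<N. c k * complex_of_real (jpoly v k x)) n = (\<Sum>k<N. c k * (if n = k \<and> n \<ge> 1 then 1 else 0))"
    by (simp add: cf_sum cf_scale adm_intros cf_jpoly)
  also have "\<dots> = (\<Sum>k<N. if k = n then (if n \<ge> 1 then c n else 0) else 0)"
    by (intro sum.cong refl) auto
  also have "\<dots> = (if n < N \<and> n \<ge> 1 then c n else 0)" by simp
  finally show ?thesis .
qed

lemma norm_expansion: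
  assumes "c 0 = 0"
  shows "(\<integral>x. (cmod (\<Sum>k<N. c k * complex_of_real (jpoly v k x)))\<^sup>2 \<partial>M) = (\<Sum>k<N. (cmod (c k))\<^sup>2)"
proof -
  let ?s = "\<lambda>x. \<Sum>k<N. c k * complex_of_real (jpoly v k x)"
  have "complex_of_real (\<integral>x. (cmod (?s x))\<^sup>2 \<partial>M) = (\<integral>x. ?s x * cnj (?s x) \<partial>M)"
    unfolding integral_complex_of_real[symmetric] complex_norm_square ..
  also have "\<dots> = (\<Sum>k<N. cnj (c k) * cf ?s k)"
    by (intro inner_expansion adm_intros)
  also have "\<dots> = (\<Sum>k<N. complex_of_real ((cmod (c k))\<^sup>2))"
    unfolding cf_expansion complex_norm_square using assms by (intro sum.cong refl) (auto simp: Suc_le_eq)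
  finally show ?thesis unfolding of_real_sum[symmetric] of_real_eq_iff .
qed

lemma bessel:
  assumes h: "adm h"
  shows "(\<Sum>k<N. (cmod (cf h k))\<^sup>2) \<le> (\<integral>x. (cmod (h x))\<^sup>2 \<partial>M)"
proof -
  define s where "s = (\<lambda>x. \<Sum>k<N. cf h k * complex_of_real (jpoly v k x))"
  have s: "adm s" unfolding s_def by (intro adm_intros)
  \<comment> \<open>The identity |a - b|^2 + 2 Re (a cnj b) = |a|^2 + |b|^2, first over the complex
    numbers, where it is purely algebraic.\<close>
  have e: "complex_of_real ((cmod (a - b))\<^sup>2) + a * cnj b + cnj (a * cnj b) = complex_of_real ((cmod a)\<^sup>2) + complex_of_real ((cmod b)\<^sup>2)" for a b
    unfolding complex_norm_square by (simp add: algebra_simps)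
  have e': "(cmod (a - b))\<^sup>2 + 2 * Re (a * cnj b) = (cmod a)\<^sup>2 + (cmod b)\<^sup>2" for a b
    using arg_cong[OF e[of a b], of Re] by simp
  have i: "integrable M (\<lambda>x. Re (h x * cnj (s x)))"
    by (intro integrable_Re adm_integrable adm_intros h s)
  have d: "integrable M (\<lambda>x. (cmod (h x - s x))\<^sup>2)"
    using adm_norm_integrable[OF adm_add[OF h adm_mult[OF adm_const s]], of "-1"] by simp
  have "(\<integral>x. (cmod (h x - s x))\<^sup>2 \<partial>M) + 2 * (\<integral>x. Re (h x * cnj (s x)) \<partial>M) = 
        (\<integral>x. (cmod (h x - s x))\<^sup>2 + 2 * Re (h x * cnj (s x)) \<partial>M)"
    by (simp only: Bochner_Integration.integral_add[OF d integrable_mult_right[OF i]] integral_mult_right_zero)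
  also have "\<dots> = (\<integral>x. (cmod (h x))\<^sup>2 \<partial>M) + (\<integral>x. (cmod (s x))\<^sup>2 \<partial>M)"
    unfolding e' by (intro Bochner_Integration.integral_add adm_norm_integrable h s)
  also have "(\<integral>x. Re (h x * cnj (s x)) \<partial>M) = Re (\<integral>x. h x * cnj (s x) \<partial>M)"
    by (intro integral_Re adm_integrable adm_intros h s)
  also have "(\<integral>x. h x * cnj (s x) \<partial>M) = complex_of_real (\<Sum>k<N. (cmod (cf h k))\<^sup>2)"
    unfolding s_def inner_expansion[OF h] of_real_sum complex_norm_square by (simp add: mult.commute)
  also have "(\<integral>x. (cmod (s x))\<^sup>2 \<partial>M) = (\<Sum>k<N. (cmod (cf h k))\<^sup>2)"
    unfolding s_def by (rule norm_expansion) (rule cf_0)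
  finally have "(\<integral>x. (cmod (h x - s x))\<^sup>2 \<partial>M) + (\<Sum>k<N. (cmod (cf h k))\<^sup>2) = (\<integral>x. (cmod (h x))\<^sup>2 \<partial>M)"
    by simp
  moreover have "0 \<le> (\<integral>x. (cmod (h x - s x))\<^sup>2 \<partial>M)" by simp
  ultimately show ?thesis by linarith
qed

lemma cf_ell2:
  assumes h: "adm h"
  shows "cf h \<in> ell2" "ell2_norm (cf h) \<le> sqrt (\<integral>x. (cmod (h x))\<^sup>2 \<partial>M)"
proof -
  have "L2_set (\<lambda>k. cmod (cf h k)) {..<N} \<le> sqrt (\<integral>x. (cmod (h x))\<^sup>2 \<partial>M)" for N
    unfolding L2_set_def by (intro real_sqrt_le_mono bessel h)
  from ell2_bounded_partial[OF cf_0 this]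
  show "cf h \<in> ell2" "ell2_norm (cf h) \<le> sqrt (\<integral>x. (cmod (h x))\<^sup>2 \<partial>M)" by auto
qed

section \<open>The operators attached to admissible functions\<close>

definition Mat :: "(real \<Rightarrow> complex) \<Rightarrow> nat \<Rightarrow> nat \<Rightarrow> complex" where
  "Mat g n = cf (\<lambda>x. g x * complex_of_real (jpoly v n x))"

definition \<Phi> :: "(real \<Rightarrow> complex) \<Rightarrow> ell2_op" where
  "\<Phi> g u = (\<lambda>n. \<Sum>k. Mat g n k * u k)"

lemma Mat_sym: "Mat g n k = Mat g k n"
  by (simp add: Mat_def cf_def mult_ac)

lemma Mat_ell2: "adm g \<Longrightarrow> Mat g n \<in> ell2"
  unfolding Mat_def by (intro cf_ell2 adm_intros)

lemma summable_Mat: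
  assumes "adm g" "u \<in> ell2" shows "summable (\<lambda>k. Mat g n k * u k)"
proof -
  have "(\<lambda>k. cnj (Mat g n k)) \<in> ell2"
    using Mat_ell2[OF assms(1), of n] by (simp add: ell2_def)
  from summable_ell2_inner[OF this assms(2)] show ?thesis by simp
qed

lemma Phi_linear:
  assumes "adm g" "u \<in> ell2" "w \<in> ell2"
  shows "\<Phi> g (\<lambda>n. u n + w n) = (\<lambda>n. \<Phi> g u n + \<Phi> g w n)" "\<Phi> g (\<lambda>n. c * u n) = (\<lambda>n. c * \<Phi> g u n)"
proof -
  show "\<Phi> g (\<lambda>n. u n + w n) = (\<lambda>n. \<Phi> g u n + \<Phi> g w n)"
    unfolding \<Phi>_def distrib_left by (intro ext suminf_add[symmetric] summable_Mat assms)
  have "(\<lambda>k. Mat g n k * (c * u k)) = (\<lambda>k. c * (Mat g n k * u k))" for n by (simp add: mult_ac)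
  then show "\<Phi> g (\<lambda>n. c * u n) = (\<lambda>n. c * \<Phi> g u n)"
    unfolding \<Phi>_def by (simp add: suminf_mult summable_Mat assms)
qed

lemma Phi_delta: "\<Phi> g (delta l) = cf (\<lambda>x. g x * complex_of_real (jpoly v l x))"
proof
  fix n
  have "(\<lambda>k. Mat g n k * delta l k) = (\<lambda>k. if k = l then Mat g n k else 0)"
    by (auto simp: delta_def)
  then have "\<Phi> g (delta l) n = Mat g n l"
    unfolding \<Phi>_def using sums_single[of l "Mat g n"] by (simp add: sums_iff)
  then show "\<Phi> g (delta l) n = cf (\<lambda>x. g x * complex_of_real (jpoly v l x)) n"
    by (subst (asm) Mat_sym) (simp add: Mat_def)
qed

lemma Phi_trunc:
  assumes "adm g"
  shows "\<Phi> g (ell2_trunc N u) = cf (\<lambda>x. g x * (\<Sum>k<N. u k * complex_of_real (jpoly v k x)))"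
proof
  fix n
  have "\<Phi> g (ell2_trunc N u) n = (\<Sum>k<N. Mat g n k * u k)"
    unfolding \<Phi>_def by (subst suminf_finite[of "{..<N}"]) (auto simp: ell2_trunc_def)
  also have "\<dots> = (\<Sum>k<N. u k * cf (\<lambda>x. g x * complex_of_real (jpoly v k x)) n)"
    by (intro sum.cong refl) (subst Mat_sym, simp add: Mat_def)
  also have "\<dots> = cf (\<lambda>x. \<Sum>k<N. u k * (g x * complex_of_real (jpoly v k x))) n"
    by (simp add: cf_sum cf_scale adm_intros assms)
  finally show "\<Phi> g (ell2_trunc N u) n = cf (\<lambda>x. g x * (\<Sum>k<N. u k * complex_of_real (jpoly v k x))) n"
    by (simp add: sum_distrib_left mult.left_commute)
qed

text \<open>On a truncated vector \<open>\<Phi> g\<close> yields the coefficients of g times a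
  polynomial, so Bessel's inequality followed by |g| <= K on the support gives the bound. It passes
  to all of \<open>ell2\<close> because each finite segment of the image converges.\<close>

lemma Phi_bound:
  assumes g: "adm g" and K: "\<And>x. x \<in> {-R..R} \<Longrightarrow> cmod (g x) \<le> K" and u: "u \<in> ell2"
  shows "\<Phi> g u \<in> ell2" "ell2_norm (\<Phi> g u) \<le> K * ell2_norm u"
proof -
  have K0: "0 \<le> K" using K[of 0] norm_ge_zero[of "g 0"] R_ge_1 by (simp del: norm_ge_zero)
  have tr: "L2_set (\<lambda>n. cmod (\<Phi> g (ell2_trunc N u) n)) {..<N'} \<le> K * ell2_norm u" for N N'
  proof -
    let ?s = "\<lambda>x. \<Sum>k<N. u k * complex_of_real (jpoly v k x)"
    have a: "adm (\<lambda>x. g x * ?s x)" by (intro adm_intros g)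
    have s: "adm ?s" by (intro adm_intros)
    have "L2_set (\<lambda>n. cmod (\<Phi> g (ell2_trunc N u) n)) {..<N'} \<le> ell2_norm (cf (\<lambda>x. g x * ?s x))"
      unfolding Phi_trunc[OF g] by (intro L2_set_le_ell2_norm cf_ell2(1)[OF a]) auto
    also have "\<dots> \<le> sqrt (\<integral>x. (cmod (g x * ?s x))\<^sup>2 \<partial>M)" by (rule cf_ell2(2)[OF a])
    also have "\<dots> \<le> sqrt (\<integral>x. K\<^sup>2 * (cmod (?s x))\<^sup>2 \<partial>M)"
    proof (intro real_sqrt_le_mono integral_mono_AE adm_norm_integrable a)
      show "integrable M (\<lambda>x. K\<^sup>2 * (cmod (?s x))\<^sup>2)"
        by (intro integrable_mult_right adm_norm_integrable s)
      show "AE x in M. (cmod (g x * ?s x))\<^sup>2 \<le> K\<^sup>2 * (cmod (?s x))\<^sup>2"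
        using supp unfolding norm_mult power_mult_distrib
        by eventually_elim (intro mult_right_mono power_mono K, auto)
    qed
    also have "\<dots> = sqrt (K\<^sup>2 * (\<Sum>k<N. (cmod (u k))\<^sup>2))"
      using norm_expansion[of u N] ell2_zero[OF u] by simp
    also have "\<dots> = K * L2_set (\<lambda>k. cmod (u k)) {..<N}"
      using K0 by (simp add: L2_set_def real_sqrt_mult)
    also have "\<dots> \<le> K * ell2_norm u"
      by (intro mult_left_mono L2_set_le_ell2_norm u K0) auto
    finally show ?thesis .
  qed
  have lim: "(\<lambda>N. \<Phi> g (ell2_trunc N u) n) \<longlonglongrightarrow> \<Phi> g u n" for n
  proof -
    have "(\<lambda>N. \<Sum>k<N. Mat g n k * u k) \<longlonglongrightarrow> \<Phi> g u n"
      unfolding \<Phi>_def by (intro summable_LIMSEQ summable_Mat g u)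
    moreover have "(\<Sum>k<N. Mat g n k * u k) = \<Phi> g (ell2_trunc N u) n" for N
      unfolding \<Phi>_def by (subst suminf_finite[of "{..<N}"]) (auto simp: ell2_trunc_def)
    ultimately show ?thesis by simp
  qed
  have "L2_set (\<lambda>n. cmod (\<Phi> g u n)) {..<N'} \<le> K * ell2_norm u" for N'
  proof (rule Lim_bounded)
    show "(\<lambda>N. L2_set (\<lambda>n. cmod (\<Phi> g (ell2_trunc N u) n)) {..<N'}) \<longlonglongrightarrow> L2_set (\<lambda>n. cmod (\<Phi> g u n)) {..<N'}"
      unfolding L2_set_def by (intro tendsto_intros lim)
    show "\<forall>N\<ge>0. L2_set (\<lambda>n. cmod (\<Phi> g (ell2_trunc N u) n)) {..<N'} \<le> K * ell2_norm u"
      using tr by blast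
  qed
  moreover have "\<Phi> g u 0 = 0" by (simp add: \<Phi>_def Mat_def cf_def)
  ultimately show "\<Phi> g u \<in> ell2" "ell2_norm (\<Phi> g u) \<le> K * ell2_norm u"
    using ell2_bounded_partial[of "\<Phi> g u"] by auto
qed

lemma bounded_op_Phi: 
  assumes g: "adm g" shows "bounded_op (\<Phi> g)"
proof -
  obtain K where K: "\<And>x. x \<in> {-R..R} \<Longrightarrow> cmod (g x) \<le> K" using g unfolding adm_def by blast
  have "\<exists>K. \<forall>u\<in>ell2. ell2_norm (\<Phi> g u) \<le> K * ell2_norm u" using Phi_bound(2)[OF g K] by blast
  then show ?thesis unfolding bounded_op_def using Phi_bound(1)[OF g K] Phi_linear[OF g] by blast
qed

lemma Phi_one: "u \<in> ell2 \<Longrightarrow> \<Phi> (\<lambda>x. 1) u = u"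
proof (rule bounded_op_eqI[OF bounded_op_Phi, where S="\<lambda>u. u"])
  show "\<Phi> (\<lambda>x. 1) (delta l) = delta l" if "l \<ge> 1" for l
    unfolding Phi_delta using cf_jpoly[of l] that by (auto simp: delta_def)
  show "bounded_op (\<lambda>u. u)" using bounded_op_funpow[OF bounded_op_H, of 0] by (simp add: id_def)
qed (intro adm_intros)

lemma Mat_add: "adm g \<Longrightarrow> adm h \<Longrightarrow> Mat (\<lambda>x. g x + h x) n k = Mat g n k + Mat h n k"
  unfolding Mat_def distrib_right by (intro cf_add adm_intros)

lemma Mat_scale: "adm g \<Longrightarrow> Mat (\<lambda>x. c * g x) n k = c * Mat g n k"
  unfolding Mat_def mult.assoc by (intro cf_scale adm_intros)

lemma Phi_add:
  assumes "adm g" "adm h" "u \<in> ell2"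
  shows "\<Phi> (\<lambda>x. g x + h x) u = (\<lambda>n. \<Phi> g u n + \<Phi> h u n)"
  unfolding \<Phi>_def Mat_add[OF assms(1,2)] distrib_right by (intro ext suminf_add[symmetric] summable_Mat assms)

lemma Phi_scale:
  assumes "adm g" "u \<in> ell2"
  shows "\<Phi> (\<lambda>x. c * g x) u = (\<lambda>n. c * \<Phi> g u n)"
  unfolding \<Phi>_def Mat_scale[OF assms(1)] mult.assoc by (intro ext suminf_mult summable_Mat assms)

lemma Phi_adjoint:
  assumes g: "adm g" and u: "u \<in> ell2" and w: "w \<in> ell2"
  shows "ell2_inner (\<Phi> g u) w = ell2_inner u (\<Phi> (\<lambda>x. cnj (g x)) w)"
proof -
  note g' = adm_cnj[OF g]
  note Pg = bounded_opD[OF bounded_op_Phi[OF g]] and Pg' = bounded_opD[OF bounded_op_Phi[OF g']]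
  obtain K where K: "K \<ge> 0" "\<And>u. u \<in> ell2 \<Longrightarrow> ell2_norm (\<Phi> (\<lambda>x. cnj (g x)) u) \<le> K * ell2_norm u"
    using bounded_op_boundE[OF bounded_op_Phi[OF g']] by blast
  have "ell2_inner (\<Phi> g u) w - ell2_inner u (\<Phi> (\<lambda>x. cnj (g x)) w) = 0"
  proof (rule ell2_functional_eq_0[where C="ell2_norm (\<Phi> g u) + ell2_norm u * K", OF _ _ _ _ w])
    fix x assume x: "x \<in> ell2"
    have "cmod (ell2_inner (\<Phi> g u) x - ell2_inner u (\<Phi> (\<lambda>x. cnj (g x)) x)) \<le>
        cmod (ell2_inner (\<Phi> g u) x) + cmod (ell2_inner u (\<Phi> (\<lambda>x. cnj (g x)) x))"
      by (rule norm_triangle_ineq4)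
    also have "\<dots> \<le> ell2_norm (\<Phi> g u) * ell2_norm x + ell2_norm u * ell2_norm (\<Phi> (\<lambda>x. cnj (g x)) x)"
      by (intro add_mono ell2_Cauchy_Schwarz Pg(1) Pg'(1) u x)
    also have "\<dots> \<le> ell2_norm (\<Phi> g u) * ell2_norm x + ell2_norm u * (K * ell2_norm x)"
      by (intro add_mono mult_left_mono K u x ell2_norm_nonneg order_refl)
    finally show "cmod (ell2_inner (\<Phi> g u) x - ell2_inner u (\<Phi> (\<lambda>x. cnj (g x)) x))
        \<le> (ell2_norm (\<Phi> g u) + ell2_norm u * K) * ell2_norm x"
      by (simp add: algebra_simps)
  next
    fix l :: nat assume "l \<ge> 1"
    have c: "Mat (\<lambda>x. cnj (g x)) k j = cnj (Mat g k j)" for k j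
      using Bochner_Integration.integral_cnj[of M "\<lambda>x. g x * complex_of_real (jpoly v k x) * complex_of_real (jpoly v j x)"]
      by (simp add: Mat_def cf_def)
    have "(\<lambda>k. cnj (Mat g l k * u k)) sums cnj (\<Phi> g u l)"
      unfolding \<Phi>_def sums_cnj by (intro summable_sums summable_Mat g u)
    then have "cnj (\<Phi> g u l) = (\<Sum>k. cnj (u k) * Mat (\<lambda>x. cnj (g x)) l k)"
      by (simp add: sums_iff c mult.commute)
    also have "\<dots> = ell2_inner u (\<Phi> (\<lambda>x. cnj (g x)) (delta l))"
      unfolding ell2_inner_def Phi_delta by (simp add: Mat_def)
    finally show "ell2_inner (\<Phi> g u) (delta l) - ell2_inner u (\<Phi> (\<lambda>x. cnj (g x)) (delta l)) = 0"
      by (simp add: ell2_inner_delta_right)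
  qed (simp_all add: Pg Pg' ell2_inner_add_right ell2_inner_scale_right u algebra_simps)
  then show ?thesis by simp
qed

text \<open>Bessel's inequality bounds the image of a basis vector by an L^2 norm that tends to 0 by
  dominated convergence; the uniform operator bound 2 K then extends this to every vector.\<close>

lemma Phi_strong:
  assumes gs: "\<And>k. gs k \<in> bounded_borel" and K: "\<And>k x. cmod (gs k x) \<le> K"
    and lim: "\<And>x. (\<lambda>k. gs k x) \<longlonglongrightarrow> g x" and u: "u \<in> ell2"
  shows "(\<lambda>k. ell2_norm (\<lambda>n. \<Phi> (gs k) u n - \<Phi> g u n)) \<longlonglongrightarrow> 0"
proof -
  note g = bounded_borel_limit[OF gs K lim]
  define ds where "ds = (\<lambda>k x. gs k x + (-1) * g x)"
  have ds: "ds k \<in> bounded_borel" for k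
    unfolding ds_def by (intro bounded_borel_add bounded_borel_scale gs g)
  have dsa: "adm (ds k)" for k by (rule adm_bounded_borel[OF ds])
  have dK: "cmod (ds k x) \<le> 2 * K" for k x
    using norm_triangle_ineq4[of "gs k x" "g x"] K[of k x] g(2)[of x] by (simp add: ds_def)
  have eq: "(\<lambda>n. \<Phi> (gs k) u n - \<Phi> g u n) = \<Phi> (ds k) u" for k
    unfolding ds_def using Phi_add[OF adm_bounded_borel[OF gs[of k]] adm_mult[OF adm_const[of "-1"] adm_bounded_borel[OF g(1)]] u]
      Phi_scale[OF adm_bounded_borel[OF g(1)] u, of "-1"] by (simp only: mult_minus1 add_uminus_conv_diff)
  have "(\<lambda>k. ell2_norm (\<Phi> (ds k) u)) \<longlonglongrightarrow> 0"
  proof (rule ell2_strong_convergence[OF _ _ _ _ _ u])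
    show "ell2_norm (\<Phi> (ds k) w) \<le> 2 * K * ell2_norm w" if "w \<in> ell2" for k w
      by (rule Phi_bound(2)[OF dsa dK that])
    fix l :: nat
    let ?P = "\<lambda>x. complex_of_real (jpoly v l x)"
    have le: "ell2_norm (\<Phi> (ds k) (delta l)) \<le> sqrt (\<integral>x. (cmod (ds k x * ?P x))\<^sup>2 \<partial>M)" for k
      unfolding Phi_delta by (intro cf_ell2(2) adm_intros dsa)
    have "(\<lambda>k. \<integral>x. (cmod (ds k x * ?P x))\<^sup>2 \<partial>M) \<longlonglongrightarrow> (\<integral>x. 0 \<partial>M)"
    proof (rule integral_dominated_convergence)
      note [measurable] = adm_measurable[OF dsa]
      show "(\<lambda>x. 0) \<in> borel_measurable M" "(\<lambda>x. (cmod (ds k x * ?P x))\<^sup>2) \<in> borel_measurable M" for k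
        by measurable
      show "integrable M (\<lambda>x. (2 * K)\<^sup>2 * (cmod (?P x))\<^sup>2)"
        by (intro integrable_mult_right adm_norm_integrable adm_intros)
      show "AE x in M. (\<lambda>k. (cmod (ds k x * ?P x))\<^sup>2) \<longlonglongrightarrow> 0"
      proof (rule AE_I2)
        fix x
        have "(\<lambda>k. (cmod ((gs k x + (-1) * g x) * ?P x))\<^sup>2) \<longlonglongrightarrow> (cmod ((g x + (-1) * g x) * ?P x))\<^sup>2"
          by (intro tendsto_intros lim)
        then show "(\<lambda>k. (cmod (ds k x * ?P x))\<^sup>2) \<longlonglongrightarrow> 0" by (simp add: ds_def)
      qed
      show "AE x in M. norm ((cmod (ds k x * ?P x))\<^sup>2) \<le> (2 * K)\<^sup>2 * (cmod (?P x))\<^sup>2" for k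
      proof (rule AE_I2)
        fix x
        have "(cmod (ds k x))\<^sup>2 * (cmod (?P x))\<^sup>2 \<le> (2 * K)\<^sup>2 * (cmod (?P x))\<^sup>2"
          by (intro mult_right_mono power_mono dK) auto
        then show "norm ((cmod (ds k x * ?P x))\<^sup>2) \<le> (2 * K)\<^sup>2 * (cmod (?P x))\<^sup>2"
          by (simp add: norm_mult power_mult_distrib)
      qed
    qed
    from tendsto_real_sqrt[OF this] have lim0: "(\<lambda>k. sqrt (\<integral>x. (cmod (ds k x * ?P x))\<^sup>2 \<partial>M)) \<longlonglongrightarrow> 0" by simp
    assume "l \<ge> 1"
    then have "0 \<le> ell2_norm (\<Phi> (ds k) (delta l))" for k
      by (intro ell2_norm_nonneg bounded_opD(1)[OF bounded_op_Phi[OF dsa]] delta_ell2)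
    then show "(\<lambda>k. ell2_norm (\<Phi> (ds k) (delta l))) \<longlonglongrightarrow> 0"
      using le by (intro tendsto_sandwich[OF always_eventually always_eventually tendsto_const lim0]) auto
  qed (use bounded_opD[OF bounded_op_Phi[OF dsa]] in auto)
  then show ?thesis by (simp add: eq)
qed

end

section \<open>Multiplicativity of the functional calculus\<close>

lemma indicator_bounded_borel: "A \<in> sets borel \<Longrightarrow> (\<lambda>x. indicator A x) \<in> bounded_borel"
  by (rule bounded_borelI[where K=1]) (auto simp: indicator_def)

text \<open>The usual path from indicators to nonnegative functions by monotone limits, then to
  positive and negative parts and to real and imaginary parts, with all functions kept uniformly
  bounded so that a property closed under bounded pointwise limits is reached.\<close>

lemma bounded_borel_induct_indicator:
  assumes g: "g \<in> bounded_borel"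
    and ind: "\<And>A. A \<in> sets borel \<Longrightarrow> P (\<lambda>x. indicator A x)"
    and add: "\<And>g h. g \<in> bounded_borel \<Longrightarrow> h \<in> bounded_borel \<Longrightarrow> P g \<Longrightarrow> P h \<Longrightarrow> P (\<lambda>x. g x + h x)"
    and scale: "\<And>c g. g \<in> bounded_borel \<Longrightarrow> P g \<Longrightarrow> P (\<lambda>x. c * g x)"
    and lim: "\<And>gs g K. (\<And>k. gs k \<in> bounded_borel) \<Longrightarrow> (\<And>k. P (gs k)) \<Longrightarrow> (\<And>k x. cmod (gs k x) \<le> K) \<Longrightarrow>
        (\<And>x. (\<lambda>k. gs k x) \<longlonglongrightarrow> g x) \<Longrightarrow> P g"
  shows "P g"
proof -
  have zero: "P (\<lambda>x. 0)" using ind[of "{}"] by simp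
  \<comment> \<open>The bound sits inside the induction statement: when u is a sum, a multiple or an
    increasing limit, the pieces need bounds of their own.\<close>
  have nonneg: "(\<forall>x. u x \<le> K) \<longrightarrow> P (\<lambda>x. complex_of_real (u x))"
    if u: "u \<in> borel_measurable borel" "\<And>x. 0 \<le> u x" for u :: "real \<Rightarrow> real" and K
    using u
  proof (induction u arbitrary: K rule: borel_measurable_induct_real)
    case (set A)
    have "(\<lambda>x. complex_of_real (indicator A x)) = (\<lambda>x. indicator A x)" by (auto simp: indicator_def)
    then show ?case using ind[OF set] by simp
  next
    case (mult u c)
    show ?case
    proof (intro impI)
      assume b: "\<forall>x. c * u x \<le> K"
      show "P (\<lambda>x. complex_of_real (c * u x))"
      proof (cases "c = 0")
        case True then show ?thesis using zero by simp
      next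
        case False
        then have "c > 0" using mult.hyps by simp
        then have b': "\<forall>x. u x \<le> K / c" using b by (simp add: le_divide_eq mult.commute)
        have "(\<lambda>x. complex_of_real (u x)) \<in> bounded_borel"
          by (rule bounded_borelI[where K="K / c"]) (use b' mult.hyps in auto)
        from scale[OF this, of "complex_of_real c"] show ?thesis using mult.IH[of "K / c"] b' by simp
      qed
    qed
  next
    case (add u w)
    show ?case
    proof (intro impI)
      assume b: "\<forall>x. w x + u x \<le> K"
      have b': "u x \<le> K" "w x \<le> K" for x
        using spec[OF b, of x] add.hyps(2)[of x] add.hyps(4)[of x] by linarith+
      have "(\<lambda>x. complex_of_real (u x)) \<in> bounded_borel" "(\<lambda>x. complex_of_real (w x)) \<in> bounded_borel"
        by (rule bounded_borelI[where K=K]; use b' add.hyps in simp)+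
      then show "P (\<lambda>x. complex_of_real (w x + u x))"
        using assms(3)[of "\<lambda>x. complex_of_real (w x)" "\<lambda>x. complex_of_real (u x)"] add.IH(1)[of K] add.IH(2)[of K] b' by simp
    qed
  next
    case (seq U)
    show ?case
    proof (intro impI)
      assume b: "\<forall>x. u x \<le> K"
      have le: "U i x \<le> K" for i x
      proof -
        have "incseq (\<lambda>i. U i x)" using seq.hyps(3) by (auto simp: incseq_def le_fun_def)
        then have "U i x \<le> u x" by (rule incseq_le) (use seq.hyps(4) in simp)
        then show ?thesis using spec[OF b, of x] by linarith
      qed
      show "P (\<lambda>x. complex_of_real (u x))"
      proof (rule lim[where gs="\<lambda>i x. complex_of_real (U i x)" and K=K])
        show "(\<lambda>x. complex_of_real (U i x)) \<in> bounded_borel" for i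
          by (rule bounded_borelI[where K=K]) (use le seq.hyps in auto)
        show "P (\<lambda>x. complex_of_real (U i x))" for i using seq.IH[of i K] le by blast
        show "cmod (complex_of_real (U i x)) \<le> K" for i x using le seq.hyps(2) by simp
        show "(\<lambda>i. complex_of_real (U i x)) \<longlonglongrightarrow> complex_of_real (u x)" for x
          by (intro tendsto_of_real) (use seq.hyps(4) in simp)
      qed
    qed
  qed
  obtain K where K: "\<And>x. cmod (g x) \<le> K" using bounded_borelD(2)[OF g] by blast
  note [measurable] = bounded_borelD(1)[OF g]
  have real: "P (\<lambda>x. complex_of_real (w x)) \<and> (\<lambda>x. complex_of_real (w x)) \<in> bounded_borel"
    if [measurable]: "w \<in> borel_measurable borel" and w: "\<And>x. \<bar>w x\<bar> \<le> K" for w :: "real \<Rightarrow> real"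
  proof -
    have p: "P (\<lambda>x. complex_of_real (max 0 (f x)))" "(\<lambda>x. complex_of_real (max 0 (f x))) \<in> bounded_borel"
      if [measurable]: "f \<in> borel_measurable borel" and f: "\<And>x. \<bar>f x\<bar> \<le> K" for f
    proof -
      have K0: "\<bar>max 0 (f x)\<bar> \<le> K" for x using f[of x] by arith
      show "P (\<lambda>x. complex_of_real (max 0 (f x)))"
        using nonneg[of "\<lambda>x. max 0 (f x)" K] K0 by (simp add: abs_le_iff)
      show "(\<lambda>x. complex_of_real (max 0 (f x))) \<in> bounded_borel"
        by (rule bounded_borelI[where K=K]) (use K0 in auto)
    qed
    have eq: "(\<lambda>x. complex_of_real (w x)) = (\<lambda>x. complex_of_real (max 0 (w x)) + (-1) * complex_of_real (max 0 (- w x)))"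
      by (auto simp: max_def)
    have n: "(\<lambda>x. - w x) \<in> borel_measurable borel" "\<And>x. \<bar>- w x\<bar> \<le> K" using w by auto
    show ?thesis unfolding eq
      by (intro conjI add bounded_borel_add scale bounded_borel_scale p that n w)
  qed
  have re: "P (\<lambda>x. complex_of_real (Re (g x))) \<and> (\<lambda>x. complex_of_real (Re (g x))) \<in> bounded_borel"
    by (rule real) (use order_trans[OF abs_Re_le_cmod K] in auto)
  have im: "P (\<lambda>x. complex_of_real (Im (g x))) \<and> (\<lambda>x. complex_of_real (Im (g x))) \<in> bounded_borel"
    by (rule real) (use order_trans[OF abs_Im_le_cmod K] in auto)
  have "P (\<lambda>x. complex_of_real (Re (g x)) + \<i> * complex_of_real (Im (g x)))"
    by (intro add scale bounded_borel_scale) (use re im in auto)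
  then show ?thesis by (simp add: complex_eq[symmetric])
qed

text \<open>Half-lines are bounded limits of continuous ramps and form an intersection-stable
  generator of the Borel sets; closure under complements and disjoint unions then yields all
  indicators by Dynkin's argument.\<close>

lemma bounded_borel_induct_continuous:
  assumes g: "g \<in> bounded_borel"
    and cont: "\<And>\<phi>. continuous_on UNIV \<phi> \<Longrightarrow> (\<And>x. \<bar>\<phi> x\<bar> \<le> 1) \<Longrightarrow> P (\<lambda>x. complex_of_real (\<phi> x))"
    and add: "\<And>g h. g \<in> bounded_borel \<Longrightarrow> h \<in> bounded_borel \<Longrightarrow> P g \<Longrightarrow> P h \<Longrightarrow> P (\<lambda>x. g x + h x)"
    and scale: "\<And>c g. g \<in> bounded_borel \<Longrightarrow> P g \<Longrightarrow> P (\<lambda>x. c * g x)"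
    and lim: "\<And>gs g K. (\<And>k. gs k \<in> bounded_borel) \<Longrightarrow> (\<And>k. P (gs k)) \<Longrightarrow> (\<And>k x. cmod (gs k x) \<le> K) \<Longrightarrow>
        (\<And>x. (\<lambda>k. gs k x) \<longlonglongrightarrow> g x) \<Longrightarrow> P g"
  shows "P g"
  using g
proof (rule bounded_borel_induct_indicator)
  fix A :: "real set" assume A: "A \<in> sets borel"
  have one: "P (\<lambda>x. 1)" using cont[of "\<lambda>x. 1"] by simp
  have zero: "P (\<lambda>x. 0)" using scale[OF bounded_borel_const one, of 0] by simp
  have mem: "A \<in> sigma_sets UNIV (range (\<lambda>a::real. {..a}))"
    using A unfolding borel_eq_atMost by simp
  have stable: "Int_stable (range (\<lambda>a::real. {..a}))"
    by (auto simp: Int_stable_def)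
  have "range (\<lambda>a::real. {..a}) \<subseteq> Pow UNIV" by simp
  from stable this mem show "P (\<lambda>x. indicator A x)"
  proof (induction A rule: sigma_sets_induct_disjoint)
    case (basic A)
    then obtain a where A: "A = {..a}" by auto
    \<comment> \<open>For k >= 1 a ramp that equals 1 up to a and falls to 0 at a + 1/k.\<close>
    define \<phi> where "\<phi> = (\<lambda>(k::nat) x. max 0 (min 1 (1 - real k * (x - a))))"
    have b: "\<bar>\<phi> k x\<bar> \<le> 1" for k x by (auto simp: \<phi>_def)
    have c: "continuous_on UNIV (\<phi> k)" for k unfolding \<phi>_def by (intro continuous_intros)
    show ?case
    proof (rule lim[where gs="\<lambda>k x. complex_of_real (\<phi> k x)" and K=1])
      show "(\<lambda>x. complex_of_real (\<phi> k x)) \<in> bounded_borel" for k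
        by (rule bounded_borelI[where K=1]) (use b borel_measurable_continuous_onI[OF c] in auto)
      show "P (\<lambda>x. complex_of_real (\<phi> k x))" for k by (rule cont[OF c b])
      show "cmod (complex_of_real (\<phi> k x)) \<le> 1" for k x using b by simp
      show "(\<lambda>k. complex_of_real (\<phi> k x)) \<longlonglongrightarrow> indicator A x" for x
      proof (cases "x \<le> a")
        case True
        then have "\<phi> k x = 1" for k by (simp add: \<phi>_def mult_nonneg_nonpos)
        then show ?thesis using True by (simp add: A)
      next
        case False
        obtain k0 :: nat where k0: "real k0 * (x - a) > 1"
          using reals_Archimedean3[of "x - a"] False by auto
        have "\<phi> k x = 0" if "k \<ge> k0" for k
        proof -
          have "real k0 * (x - a) \<le> real k * (x - a)" using that False by (intro mult_right_mono) auto
          then show ?thesis using k0 by (simp add: \<phi>_def)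
        qed
        then have "eventually (\<lambda>k. complex_of_real (\<phi> k x) = 0) sequentially"
          unfolding eventually_sequentially by auto
        then show ?thesis using False by (simp add: A tendsto_eventually)
      qed
    qed
  next
    case empty
    then show ?case using zero by simp
  next
    case (compl A)
    then have "A \<in> sets borel" unfolding borel_eq_atMost by simp
    from add[OF bounded_borel_const bounded_borel_scale[OF indicator_bounded_borel[OF this]] one scale[OF indicator_bounded_borel[OF this] compl(2)], of "-1"]
    have "P (\<lambda>x. 1 + (-1) * indicator A x)" .
    also have "(\<lambda>x. 1 + (-1) * indicator A x) = (\<lambda>x. indicator (UNIV - A) x :: complex)" by (auto simp: indicator_def)
    finally show ?case .
  next
    case (union A)
    have A: "A i \<in> sets borel" for i using union(2) unfolding borel_eq_atMost by (simp add: image_subset_iff)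
    have fin: "(\<lambda>x. indicator (\<Union>i<n. A i) x) \<in> bounded_borel \<and> P (\<lambda>x. indicator (\<Union>i<n. A i) x)" for n
    proof (induction n)
      case 0
      then show ?case using zero bounded_borel_const[of 0] by simp
    next
      case (Suc n)
      have "A n \<inter> A i = {}" if "i < n" for i
        using disjoint_family_onD[OF union(1), of n i] that by simp
      then have "A n \<inter> (\<Union>i<n. A i) = {}" by blast
      then have "(\<lambda>x. indicator (\<Union>i<Suc n. A i) x) = (\<lambda>x. indicator (\<Union>i<n. A i) x + indicator (A n) x :: complex)"
        by (intro ext) (simp add: lessThan_Suc, subst indicator_add[symmetric], auto)
      then show ?case using Suc add bounded_borel_add union(3)[of n] indicator_bounded_borel[OF A[of n]] by simp
    qed
    show ?case
    proof (rule lim[where gs="\<lambda>n x. indicator (\<Union>i<n. A i) x" and K=1])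
      show "(\<lambda>n. indicator (\<Union>i<n. A i) x :: complex) \<longlonglongrightarrow> indicator (\<Union> (range A)) x" for x
        by (rule LIMSEQ_indicator_UN)
    qed (use fin in \<open>auto simp: indicator_def\<close>)
  qed
qed (fact add scale lim)+

section \<open>From the coordinate function to all bounded Borel functions\<close>

context jacobi_spectral
begin

lemma cf_cong_AE: 
  assumes "adm g" "adm h" "\<And>x. x \<in> {-R..R} \<Longrightarrow> g x = h x" shows "cf g = cf h"
proof
  fix n
  note [measurable] = adm_measurable[OF assms(1)] adm_measurable[OF assms(2)]
  show "cf g n = cf h n"
    unfolding cf_def
  proof (rule integral_cong_AE)
    show "AE x in M. g x * complex_of_real (jpoly v n x) = h x * complex_of_real (jpoly v n x)"
      using supp by eventually_elim (simp add: assms(3))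
  qed measurable
qed

lemma Phi_cong: 
  assumes "adm g" "adm h" "\<And>x. x \<in> {-R..R} \<Longrightarrow> g x = h x" shows "\<Phi> g = \<Phi> h"
proof -
  have "Mat g n = Mat h n" for n
    unfolding Mat_def by (intro cf_cong_AE adm_intros assms(1,2)) (simp add: assms(3))
  then show ?thesis unfolding \<Phi>_def by simp
qed

lemma adm_of_real: "adm complex_of_real"
  by (intro adm_continuous continuous_intros)

text \<open>The three-term recurrence read under the integral: multiplication by x acts on
  coefficients as the Jacobi matrix. This ties the constructed operators to
  \<open>H\<close>.\<close>

lemma cf_times_x:
  assumes h: "adm h" shows "cf (\<lambda>x. complex_of_real x * h x) = H (cf h)"
proof
  fix n
  show "cf (\<lambda>x. complex_of_real x * h x) n = H (cf h) n"
  proof (cases n)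
    case 0
    then show ?thesis by (simp add: cf_0 jacobi_def)
  next
    case (Suc m)
    have i: "integrable M (\<lambda>x. h x * complex_of_real (jpoly v k x))" for k
      by (intro adm_integrable adm_intros h)
    have "cf (\<lambda>x. complex_of_real x * h x) n = (\<integral>x. h x * complex_of_real (jpoly v (Suc n) x)
        + h x * complex_of_real (jpoly v m x) + complex_of_real (v n) * (h x * complex_of_real (jpoly v n x)) \<partial>M)"
      unfolding cf_def Suc by (intro Bochner_Integration.integral_cong refl) (simp add: algebra_simps)
    also have "\<dots> = cf h (Suc n) + cf h m + complex_of_real (v n) * cf h n"
      unfolding cf_def using i[of "Suc n"] i[of m] i[of n] by simp
    finally show ?thesis by (simp add: jacobi_def Suc)
  qed
qed

lemma Phi_id:
  assumes g: "adm g" and eq: "\<And>x. x \<in> {-R..R} \<Longrightarrow> g x = complex_of_real x" and u: "u \<in> ell2"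
  shows "\<Phi> g u = H u"
proof (rule bounded_op_eqI[OF bounded_op_Phi[OF g] bounded_op_H _ u])
  fix l :: nat assume l: "l \<ge> 1"
  have "\<Phi> g (delta l) = cf (\<lambda>x. complex_of_real x * complex_of_real (jpoly v l x))"
    unfolding Phi_delta by (intro cf_cong_AE adm_intros adm_of_real g) (simp add: eq)
  also have "\<dots> = H (cf (\<lambda>x. complex_of_real (jpoly v l x)))"
    by (intro cf_times_x adm_intros)
  also have "cf (\<lambda>x. complex_of_real (jpoly v l x)) = delta l"
    using l by (auto simp: cf_jpoly delta_def)
  finally show "\<Phi> g (delta l) = H (delta l)" .
qed

text \<open>Multiplicativity in the first factor, against every admissible second factor. With h
  universally quantified the class is closed under sums and products, so it contains all polynomials
  once it contains constants and x.\<close>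

definition mult_class :: "(real \<Rightarrow> complex) set" where
  "mult_class = {g. adm g \<and> (\<forall>h. adm h \<longrightarrow> (\<forall>u\<in>ell2. \<Phi> (\<lambda>x. g x * h x) u = \<Phi> g (\<Phi> h u)))}"

lemma mult_classI:
  assumes g: "adm g" and eq: "\<And>h l. adm h \<Longrightarrow> l \<ge> 1 \<Longrightarrow> \<Phi> (\<lambda>x. g x * h x) (delta l) = \<Phi> g (\<Phi> h (delta l))"
  shows "g \<in> mult_class"
  unfolding mult_class_def
proof (intro CollectI conjI allI impI ballI g)
  fix h u assume h: "adm h" and u: "u \<in> ell2"
  show "\<Phi> (\<lambda>x. g x * h x) u = \<Phi> g (\<Phi> h u)"
    by (rule bounded_op_eqI[OF bounded_op_Phi[OF adm_mult[OF g h]] bounded_op_compose[OF bounded_op_Phi[OF g] bounded_op_Phi[OF h]] eq[OF h] u])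
qed

lemma mult_classD:
  assumes "g \<in> mult_class" 
  shows "adm g" "\<And>h u. adm h \<Longrightarrow> u \<in> ell2 \<Longrightarrow> \<Phi> (\<lambda>x. g x * h x) u = \<Phi> g (\<Phi> h u)"
  using assms by (auto simp: mult_class_def)

lemma Phi_ell2: "adm h \<Longrightarrow> u \<in> ell2 \<Longrightarrow> \<Phi> h u \<in> ell2"
  using bounded_opD(1)[OF bounded_op_Phi] .

lemma mult_class_add:
  assumes g: "g \<in> mult_class" and f: "f \<in> mult_class" shows "(\<lambda>x. g x + f x) \<in> mult_class"
proof (rule mult_classI)
  note a = mult_classD(1)[OF g] mult_classD(1)[OF f]
  show "adm (\<lambda>x. g x + f x)" by (intro adm_intros a)
  fix h and l :: nat assume h: "adm h" and l: "l \<ge> 1"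
  have u: "delta l \<in> ell2" by (rule delta_ell2[OF l])
  show "\<Phi> (\<lambda>x. (g x + f x) * h x) (delta l) = \<Phi> (\<lambda>x. g x + f x) (\<Phi> h (delta l))"
    unfolding distrib_right Phi_add[OF a Phi_ell2[OF h u]] Phi_add[OF adm_mult[OF a(1) h] adm_mult[OF a(2) h] u]
      mult_classD(2)[OF g h u] mult_classD(2)[OF f h u] ..
qed

lemma mult_class_const: "(\<lambda>x. c) \<in> mult_class"
proof (rule mult_classI[OF adm_const])
  fix h and l :: nat assume h: "adm h" and l: "l \<ge> 1"
  have u: "delta l \<in> ell2" by (rule delta_ell2[OF l])
  have "\<Phi> (\<lambda>x. c) (\<Phi> h (delta l)) = \<Phi> (\<lambda>x. c * 1) (\<Phi> h (delta l))" by simp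
  also have "\<dots> = (\<lambda>n. c * \<Phi> h (delta l) n)"
    unfolding Phi_scale[OF adm_const Phi_ell2[OF h u]] Phi_one[OF Phi_ell2[OF h u]] ..
  finally show "\<Phi> (\<lambda>x. c * h x) (delta l) = \<Phi> (\<lambda>x. c) (\<Phi> h (delta l))"
    unfolding Phi_scale[OF h u] by simp
qed

lemma mult_class_mult:
  assumes g: "g \<in> mult_class" and f: "f \<in> mult_class" shows "(\<lambda>x. g x * f x) \<in> mult_class"
proof (rule mult_classI)
  note a = mult_classD(1)[OF g] mult_classD(1)[OF f]
  show "adm (\<lambda>x. g x * f x)" by (intro adm_intros a)
  fix h and l :: nat assume h: "adm h" and l: "l \<ge> 1"
  have u: "delta l \<in> ell2" by (rule delta_ell2[OF l])
  show "\<Phi> (\<lambda>x. (g x * f x) * h x) (delta l) = \<Phi> (\<lambda>x. g x * f x) (\<Phi> h (delta l))"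
    unfolding mult.assoc mult_classD(2)[OF g adm_mult[OF a(2) h] u] mult_classD(2)[OF f h u] 
      mult_classD(2)[OF g a(2) Phi_ell2[OF h u]] ..
qed

lemma mult_class_cong:
  assumes g: "g \<in> mult_class" and f: "adm f" and eq: "\<And>x. x \<in> {-R..R} \<Longrightarrow> f x = g x"
  shows "f \<in> mult_class"
proof (rule mult_classI[OF f])
  fix h and l :: nat assume h: "adm h" and l: "l \<ge> 1"
  have "\<Phi> (\<lambda>x. f x * h x) = \<Phi> (\<lambda>x. g x * h x)" "\<Phi> f = \<Phi> g"
    by (intro Phi_cong adm_intros mult_classD(1)[OF g] f h; simp add: eq)+
  then show "\<Phi> (\<lambda>x. f x * h x) (delta l) = \<Phi> f (\<Phi> h (delta l))"
    using mult_classD(2)[OF g h delta_ell2[OF l]] by simp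
qed

lemma mult_class_x: "complex_of_real \<in> mult_class"
proof (rule mult_classI[OF adm_of_real])
  fix h and l :: nat assume h: "adm h" and l: "l \<ge> 1"
  have "\<Phi> (\<lambda>x. complex_of_real x * h x) (delta l) = H (\<Phi> h (delta l))"
    unfolding Phi_delta mult.assoc by (intro cf_times_x adm_intros h)
  then show "\<Phi> (\<lambda>x. complex_of_real x * h x) (delta l) = \<Phi> complex_of_real (\<Phi> h (delta l))"
    using Phi_id[OF adm_of_real refl Phi_ell2[OF h delta_ell2[OF l]]] by simp
qed

lemma ell2_limit_unique:
  assumes "(\<lambda>k. ell2_norm (\<lambda>n. us k n - u n)) \<longlonglongrightarrow> 0" "(\<lambda>k. ell2_norm (\<lambda>n. us k n - w n)) \<longlonglongrightarrow> 0"
    and "\<And>k. us k \<in> ell2" "u \<in> ell2" "w \<in> ell2"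
  shows "u = w"
proof
  fix n
  have pt: "(\<lambda>k. us k n) \<longlonglongrightarrow> z n" if "(\<lambda>k. ell2_norm (\<lambda>n. us k n - z n)) \<longlonglongrightarrow> 0" "z \<in> ell2" for z
  proof (rule LIM_zero_cancel, rule tendsto_norm_zero_cancel, rule tendsto_sandwich[OF _ _ tendsto_const that(1)])
    show "\<forall>\<^sub>F k in sequentially. norm (us k n - z n) \<le> ell2_norm (\<lambda>n. us k n - z n)"
      using cmod_le_ell2_norm[OF ell2_diff[OF assms(3) that(2)]] by simp
  qed simp
  show "u n = w n" by (rule LIMSEQ_unique[OF pt[OF assms(1,4)] pt[OF assms(2,5)]])
qed

lemma mult_class_limit:
  assumes gs: "\<And>k. gs k \<in> bounded_borel" "\<And>k. gs k \<in> mult_class" and K: "\<And>k x. cmod (gs k x) \<le> K"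
    and lim: "\<And>x. (\<lambda>k. gs k x) \<longlonglongrightarrow> g x"
  shows "g \<in> mult_class"
proof -
  note g = bounded_borel_limit[OF gs(1) K lim]
  have ga: "adm g" by (rule adm_bounded_borel[OF g(1)])
  have bb: "\<Phi> (\<lambda>x. g x * h x) u = \<Phi> g (\<Phi> h u)" if h: "h \<in> bounded_borel" and u: "u \<in> ell2" for h u
  proof (rule ell2_limit_unique)
    have ha: "adm h" by (rule adm_bounded_borel[OF h])
    obtain L where L: "\<And>x. cmod (h x) \<le> L" using bounded_borelD(2)[OF h] by blast
    have K0: "0 \<le> K" using order_trans[OF norm_ge_zero K] .
    show "(\<lambda>k. ell2_norm (\<lambda>n. \<Phi> (\<lambda>x. gs k x * h x) u n - \<Phi> (\<lambda>x. g x * h x) u n)) \<longlonglongrightarrow> 0"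
    proof (rule Phi_strong[OF _ _ _ u])
      show "(\<lambda>x. gs k x * h x) \<in> bounded_borel" for k by (intro bounded_borel_mult gs h)
      show "cmod (gs k x * h x) \<le> K * L" for k x
        unfolding norm_mult by (intro mult_mono K L K0) auto
      show "(\<lambda>k. gs k x * h x) \<longlonglongrightarrow> g x * h x" for x by (intro tendsto_intros lim)
    qed
    show "(\<lambda>k. ell2_norm (\<lambda>n. \<Phi> (\<lambda>x. gs k x * h x) u n - \<Phi> g (\<Phi> h u) n)) \<longlonglongrightarrow> 0"
      unfolding mult_classD(2)[OF gs(2) ha u] by (rule Phi_strong[OF gs(1) K lim Phi_ell2[OF ha u]])
    show "\<Phi> (\<lambda>x. gs k x * h x) u \<in> ell2" for k
      by (intro Phi_ell2 adm_intros u ha mult_classD(1) gs)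
    show "\<Phi> (\<lambda>x. g x * h x) u \<in> ell2" "\<Phi> g (\<Phi> h u) \<in> ell2"
      by (intro Phi_ell2 adm_intros u ha ga)+
  qed
  show ?thesis
  proof (rule mult_classI[OF ga])
    fix h and l :: nat assume h: "adm h" and l: "l \<ge> 1"
    \<comment> \<open>Strong convergence is available for globally bounded functions only; cutting h
      off outside the support changes none of the operators.\<close>
    define h' where "h' = (\<lambda>x. h x * indicator {-R..R} x)"
    obtain L where L: "\<forall>x\<in>{-R..R}. cmod (h x) \<le> L" using h unfolding adm_def by blast
    note [measurable] = adm_measurable[OF h]
    have "h' \<in> borel_measurable borel" unfolding h'_def by measurable
    then have h': "h' \<in> bounded_borel"
      by (rule bounded_borelI[where K="max 0 L"]) (use L in \<open>auto simp: h'_def indicator_def le_max_iff_disj\<close>)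
    have "\<Phi> (\<lambda>x. g x * h x) = \<Phi> (\<lambda>x. g x * h' x)" "\<Phi> h = \<Phi> h'"
      by (intro Phi_cong adm_intros adm_bounded_borel ga h h'; simp add: h'_def)+
    then show "\<Phi> (\<lambda>x. g x * h x) (delta l) = \<Phi> g (\<Phi> h (delta l))"
      using bb[OF h' delta_ell2[OF l]] by simp
  qed
qed

lemma mult_class_real_polynomial: "real_polynomial_function p \<Longrightarrow> (\<lambda>x. complex_of_real (p x)) \<in> mult_class"
proof (induction p rule: real_polynomial_function.induct)
  case (linear f)
  then obtain c where "f = (\<lambda>x. c * x)" using real_bounded_linear[of f] by (auto simp: mult.commute)
  then show ?case using mult_class_mult[OF mult_class_const mult_class_x, of "complex_of_real c"] by simp
next
  case (add f g)
  then show ?case using mult_class_add by fastforce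
next
  case (mult f g)
  then show ?case using mult_class_mult by fastforce
qed (rule mult_class_const)

text \<open>Weierstrass approximation works on the compact interval \<open>{-R..R}\<close> only. Cut
  off there, the polynomials are bounded by 1 + 1 everywhere and form a bounded convergent sequence;
  values outside the interval are invisible to the operators.\<close>

lemma mult_class_continuous:
  assumes c: "continuous_on UNIV \<phi>" and b: "\<And>x. \<bar>\<phi> x\<bar> \<le> (1::real)"
  shows "(\<lambda>x. complex_of_real (\<phi> x)) \<in> mult_class"
proof -
  define e where "e = (\<lambda>k::nat. 1 / real (Suc k))"
  have e: "0 < e k" "e k \<le> 1" for k by (auto simp: e_def)
  have "\<exists>p. real_polynomial_function p \<and> (\<forall>x\<in>{-R..R}. \<bar>\<phi> x - p x\<bar> < e k)" for k
    using Stone_Weierstrass_real_polynomial_function[of "{-R..R}" \<phi> "e k"] continuous_on_subset[OF c] e by (metis compact_Icc subset_UNIV)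
  then obtain p where p: "\<And>k. real_polynomial_function (p k)" "\<And>k x. x \<in> {-R..R} \<Longrightarrow> \<bar>\<phi> x - p k x\<bar> < e k" by metis
  define gs where "gs = (\<lambda>k x. complex_of_real (p k x) * indicator {-R..R} x)"
  define \<phi>' where "\<phi>' = (\<lambda>x. complex_of_real (\<phi> x) * indicator {-R..R} x)"
  have [measurable]: "(\<lambda>x. complex_of_real (p k x)) \<in> borel_measurable borel" for k
    by (rule adm_measurable[OF mult_classD(1)[OF mult_class_real_polynomial[OF p(1)]]])
  have gm: "gs k \<in> borel_measurable borel" for k unfolding gs_def by measurable
  have gb: "cmod (gs k x) \<le> 2" for k x
  proof (cases "x \<in> {-R..R}")
    case True
    then have "\<bar>p k x\<bar> \<le> 2" using p(2)[OF True, of k] b[of x] e(2)[of k] by linarith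
    then show ?thesis using True by (simp add: gs_def)
  qed (simp add: gs_def)
  have gbb: "gs k \<in> bounded_borel" for k by (rule bounded_borelI[OF gm gb])
  have "\<phi>' \<in> mult_class"
  proof (rule mult_class_limit[OF gbb _ gb])
    show "gs k \<in> mult_class" for k
      by (rule mult_class_cong[OF mult_class_real_polynomial[OF p(1)] adm_bounded_borel[OF gbb]]) (simp add: gs_def)
    show "(\<lambda>k. gs k x) \<longlonglongrightarrow> \<phi>' x" for x
    proof (cases "x \<in> {-R..R}")
      case True
      have e0: "e \<longlonglongrightarrow> 0" unfolding e_def by (rule LIMSEQ_Suc[OF lim_1_over_n])
      have "(\<lambda>k. p k x - \<phi> x) \<longlonglongrightarrow> 0"
        by (rule Lim_null_comparison[OF always_eventually e0])
          (use p(2)[OF True] in \<open>auto simp: abs_minus_commute intro: less_imp_le\<close>)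
      then have "(\<lambda>k. p k x) \<longlonglongrightarrow> \<phi> x" by (rule LIM_zero_cancel)
      then show ?thesis using True by (simp add: gs_def \<phi>'_def tendsto_of_real)
    qed (simp add: gs_def \<phi>'_def)
  qed
  then show ?thesis
    by (rule mult_class_cong) (auto simp: \<phi>'_def intro!: adm_continuous continuous_intros c)
qed

lemma mult_class_bounded_borel: "g \<in> bounded_borel \<Longrightarrow> g \<in> mult_class"
proof (erule bounded_borel_induct_continuous)
  show "(\<lambda>x. complex_of_real (\<phi> x)) \<in> mult_class" if "continuous_on UNIV \<phi>" "\<And>x. \<bar>\<phi> x\<bar> \<le> 1" for \<phi>
    using that by (rule mult_class_continuous)
  show "(\<lambda>x. c * g x) \<in> mult_class" if "g \<in> mult_class" for c g
    by (rule mult_class_mult[OF mult_class_const that])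
  show "(\<lambda>x. g x + h x) \<in> mult_class" if "g \<in> mult_class" "h \<in> mult_class" for g h
    using that by (rule mult_class_add)
qed (rule mult_class_limit)

lemma is_borel_calculus_Phi:
  assumes Hop: "\<And>u. u \<in> ell2 \<Longrightarrow> Hop u = H u"
  shows "is_borel_calculus Hop \<Phi>"
  unfolding is_borel_calculus_def
proof (intro conjI ballI allI impI)
  fix g h :: "real \<Rightarrow> complex" and u assume "g \<in> bounded_borel" "h \<in> bounded_borel" "u \<in> ell2"
  then show "\<Phi> (\<lambda>x. g x * h x) u = \<Phi> g (\<Phi> h u)"
    by (intro mult_classD(2) mult_class_bounded_borel adm_bounded_borel)
next
  fix gs :: "nat \<Rightarrow> real \<Rightarrow> complex" and g K u
  assume "(\<forall>k. gs k \<in> bounded_borel) \<and> (\<forall>k x. cmod (gs k x) \<le> K) \<and> (\<forall>x. (\<lambda>k. gs k x) \<longlonglongrightarrow> g x)" "u \<in> ell2"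
  then show "(\<lambda>k. ell2_norm (\<lambda>n. \<Phi> (gs k) u n - \<Phi> g u n)) \<longlonglongrightarrow> 0"
    by (intro Phi_strong[where K=K]) auto
next
  fix r and g :: "real \<Rightarrow> complex" and u assume g: "g \<in> bounded_borel"
    and a: "(\<forall>u\<in>ell2. ell2_norm (Hop u) \<le> r * ell2_norm u) \<and> (\<forall>x\<in>{-r..r}. g x = complex_of_real x)" and u: "u \<in> ell2"
  \<comment> \<open>Since R is the least norm bound, agreement with x on \<open>{-r..r}\<close>
    covers the support.\<close>
  have "R \<le> r" by (rule R_le) (use a Hop in auto)
  then have "\<Phi> g u = H u" using a by (intro Phi_id adm_bounded_borel g u) auto
  then show "\<Phi> g u = Hop u" by (simp add: Hop u)
qed (auto intro: bounded_op_Phi Phi_one Phi_add Phi_scale Phi_adjoint adm_bounded_borel)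

end

text \<open>Existence makes the choice in \<open>borel_calculus\<close> meaningful, so that its
  defining properties may be used.\<close>

theorem (in bounded_jacobi) borel_calculus_exists:
  assumes "\<And>u. u \<in> ell2 \<Longrightarrow> Hop u = H u"
  shows "is_borel_calculus Hop (borel_calculus Hop)"
proof -
  obtain M where M: "real_distribution M" "AE x in M. x \<in> {-R..R}"
    "\<And>n m. n \<ge> 1 \<Longrightarrow> m \<ge> 1 \<Longrightarrow> (\<integral>x. jpoly v n x * jpoly v m x \<partial>M) = (if n = m then 1 else 0)"
    using spectral_measure_exists by blast
  interpret real_distribution M by (rule M(1))
  interpret jacobi_spectral v B M by unfold_locales (use M in auto)
  show ?thesis unfolding borel_calculus_def by (rule someI[of "is_borel_calculus Hop" \<Phi>, OF is_borel_calculus_Phi[of Hop, OF assms]])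
qed

section \<open>Spectral measures and resolvents\<close>

text \<open>Agreement is required on \<open>ell2\<close> only: for a sequence with u(0) \<noteq> 0,
  \<open>jacobi\<close> reads this value at n = 1 where \<open>schroedinger\<close> overwrites
  it.\<close>

locale jacobi_calculus = bounded_jacobi +
  fixes Hop :: ell2_op
  assumes Hop: "\<And>u. u \<in> ell2 \<Longrightarrow> Hop u = jacobi v u"
begin

abbreviation "\<Psi> \<equiv> borel_calculus Hop"

lemma calculus: "is_borel_calculus Hop \<Psi>"
  by (rule borel_calculus_exists[OF Hop])

lemma bounded_op_Psi: "g \<in> bounded_borel \<Longrightarrow> bounded_op (\<Psi> g)"
  using calculus[unfolded is_borel_calculus_def, THEN conjunct1] by blast

lemma Psi_one: "u \<in> ell2 \<Longrightarrow> \<Psi> (\<lambda>x. 1) u = u"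
  using calculus[unfolded is_borel_calculus_def, THEN conjunct2, THEN conjunct1] by blast

lemma Psi_add: "g \<in> bounded_borel \<Longrightarrow> h \<in> bounded_borel \<Longrightarrow> u \<in> ell2 \<Longrightarrow>
    \<Psi> (\<lambda>x. g x + h x) u = (\<lambda>n. \<Psi> g u n + \<Psi> h u n)"
  using calculus[unfolded is_borel_calculus_def, THEN conjunct2, THEN conjunct2, THEN conjunct1] by blast

lemma Psi_scale: "g \<in> bounded_borel \<Longrightarrow> u \<in> ell2 \<Longrightarrow> \<Psi> (\<lambda>x. c * g x) u = (\<lambda>n. c * \<Psi> g u n)"
  using calculus[unfolded is_borel_calculus_def, THEN conjunct2, THEN conjunct2, THEN conjunct2, THEN conjunct1] by blast

lemma Psi_mult: "g \<in> bounded_borel \<Longrightarrow> h \<in> bounded_borel \<Longrightarrow> u \<in> ell2 \<Longrightarrow> \<Psi> (\<lambda>x. g x * h x) u = \<Psi> g (\<Psi> h u)"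
  using calculus[unfolded is_borel_calculus_def, THEN conjunct2, THEN conjunct2, THEN conjunct2, THEN conjunct2, THEN conjunct1] by blast

lemma Psi_adjoint: "g \<in> bounded_borel \<Longrightarrow> u \<in> ell2 \<Longrightarrow> w \<in> ell2 \<Longrightarrow>
    ell2_inner (\<Psi> g u) w = ell2_inner u (\<Psi> (\<lambda>x. cnj (g x)) w)"
  using calculus[unfolded is_borel_calculus_def, THEN conjunct2, THEN conjunct2, THEN conjunct2, THEN conjunct2, THEN conjunct2, THEN conjunct1] by blast

lemma Psi_strong:
  assumes "\<And>k. gs k \<in> bounded_borel" "\<And>k x. cmod (gs k x) \<le> K" "\<And>x. (\<lambda>k. gs k x) \<longlonglongrightarrow> g x" "u \<in> ell2"
  shows "(\<lambda>k. ell2_norm (\<lambda>n. \<Psi> (gs k) u n - \<Psi> g u n)) \<longlonglongrightarrow> 0"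
proof -
  note lim = calculus[unfolded is_borel_calculus_def, THEN conjunct2, THEN conjunct2, THEN conjunct2, THEN conjunct2, THEN conjunct2, THEN conjunct2, THEN conjunct1, rule_format]
  show ?thesis by (rule lim[of gs K g]) (use assms in auto)
qed

lemma Psi_id:
  assumes "R \<le> r" "g \<in> bounded_borel" "\<And>x. x \<in> {-r..r} \<Longrightarrow> g x = complex_of_real x" "u \<in> ell2"
  shows "\<Psi> g u = jacobi v u"
proof -
  note id = calculus[unfolded is_borel_calculus_def, THEN conjunct2, THEN conjunct2, THEN conjunct2, THEN conjunct2, THEN conjunct2, THEN conjunct2, THEN conjunct2, rule_format]
  have "ell2_norm (Hop u) \<le> r * ell2_norm u" if u: "u \<in> ell2" for u
    using R_bound[OF u] mult_right_mono[OF assms(1) ell2_norm_nonneg[OF u]] by (simp add: Hop u)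
  then have "\<Psi> g u = Hop u" by (intro id[of g r]) (use assms(2-4) in auto)
  then show ?thesis by (simp add: Hop assms(4))
qed

lemmas Psi_ell2 = bounded_opD(1)[OF bounded_op_Psi]

section \<open>Quadratic forms and spectral measures\<close>

definition quad :: "(nat \<Rightarrow> complex) \<Rightarrow> (real \<Rightarrow> complex) \<Rightarrow> complex" where
  "quad \<psi> g = ell2_inner \<psi> (\<Psi> g \<psi>)"

lemma quad_add: "g \<in> bounded_borel \<Longrightarrow> h \<in> bounded_borel \<Longrightarrow> \<psi> \<in> ell2 \<Longrightarrow> quad \<psi> (\<lambda>x. g x + h x) = quad \<psi> g + quad \<psi> h"
  unfolding quad_def by (simp add: Psi_add ell2_inner_add_right Psi_ell2)

lemma quad_scale: "g \<in> bounded_borel \<Longrightarrow> \<psi> \<in> ell2 \<Longrightarrow> quad \<psi> (\<lambda>x. c * g x) = c * quad \<psi> g"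
  unfolding quad_def by (simp add: Psi_scale ell2_inner_scale_right Psi_ell2)

lemma quad_limit:
  assumes gs: "\<And>k. gs k \<in> bounded_borel" and K: "\<And>k x. cmod (gs k x) \<le> K"
    and lim: "\<And>x. (\<lambda>k. gs k x) \<longlonglongrightarrow> g x" and u: "\<psi> \<in> ell2"
  shows "(\<lambda>k. quad \<psi> (gs k)) \<longlonglongrightarrow> quad \<psi> g"
proof (rule LIM_zero_cancel, rule tendsto_norm_zero_cancel)
  note g = bounded_borel_limit(1)[OF gs K lim]
  have l: "(\<lambda>k. ell2_norm \<psi> * ell2_norm (\<lambda>n. \<Psi> (gs k) \<psi> n - \<Psi> g \<psi> n)) \<longlonglongrightarrow> 0"
    using tendsto_mult_left[OF Psi_strong[OF gs K lim u], of "ell2_norm \<psi>"] by simp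
  have "norm (quad \<psi> (gs k) - quad \<psi> g) \<le> ell2_norm \<psi> * ell2_norm (\<lambda>n. \<Psi> (gs k) \<psi> n - \<Psi> g \<psi> n)" for k
  proof -
    have "quad \<psi> (gs k) - quad \<psi> g = ell2_inner \<psi> (\<lambda>n. \<Psi> (gs k) \<psi> n + (-1) * \<Psi> g \<psi> n)"
      unfolding quad_def
      by (simp only: ell2_inner_add_right ell2_inner_scale_right u Psi_ell2[OF gs u] Psi_ell2[OF g u] ell2_scale) simp
    also have "\<dots> = ell2_inner \<psi> (\<lambda>n. \<Psi> (gs k) \<psi> n - \<Psi> g \<psi> n)" by simp
    finally show ?thesis
      using ell2_Cauchy_Schwarz[OF u ell2_diff[OF Psi_ell2[OF gs[of k] u] Psi_ell2[OF g u]]] by simp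
  qed
  then show "(\<lambda>k. norm (quad \<psi> (gs k) - quad \<psi> g)) \<longlonglongrightarrow> 0"
    by (intro tendsto_sandwich[OF always_eventually always_eventually tendsto_const l]) auto
qed

text \<open>Adjointness and multiplicativity: passing from \<psi> to h(H) \<psi> multiplies the
  spectral measure by |h|^2.\<close>

lemma quad_Psi:
  assumes "\<psi> \<in> ell2" "h \<in> bounded_borel" "g \<in> bounded_borel"
  shows "quad (\<Psi> h \<psi>) g = quad \<psi> (\<lambda>x. g x * (cnj (h x) * h x))"
proof -
  have "quad (\<Psi> h \<psi>) g = ell2_inner \<psi> (\<Psi> (\<lambda>x. cnj (h x)) (\<Psi> g (\<Psi> h \<psi>)))"
    unfolding quad_def by (intro Psi_adjoint Psi_ell2 assms)
  also have "\<Psi> (\<lambda>x. cnj (h x)) (\<Psi> g (\<Psi> h \<psi>)) = \<Psi> (\<lambda>x. cnj (h x) * (g x * h x)) \<psi>"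
    using assms by (simp add: Psi_mult bounded_borel_mult bounded_borel_cnj)
  finally show ?thesis unfolding quad_def by (simp add: mult_ac)
qed

lemma quad_indicator:
  assumes "\<psi> \<in> ell2" "A \<in> sets borel"
  shows "quad \<psi> (\<lambda>x. indicator A x) = complex_of_real ((ell2_norm (\<Psi> (\<lambda>x. indicator A x) \<psi>))\<^sup>2)"
proof -
  note i = indicator_bounded_borel[OF assms(2)]
  have "complex_of_real ((ell2_norm (\<Psi> (\<lambda>x. indicator A x) \<psi>))\<^sup>2) = quad (\<Psi> (\<lambda>x. indicator A x) \<psi>) (\<lambda>x. 1)"
    unfolding quad_def
    by (simp only: Psi_one[OF Psi_ell2[OF i assms(1)]] ell2_inner_self[OF Psi_ell2[OF i assms(1)]])
  also have "\<dots> = quad \<psi> (\<lambda>x. 1 * (cnj (indicator A x) * indicator A x))"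
    by (intro quad_Psi assms i bounded_borel_const)
  also have "(\<lambda>x. 1 * (cnj (indicator A x) * indicator A x)) = (\<lambda>x. indicator A x :: complex)"
    by (auto simp: indicator_def)
  finally show ?thesis by simp
qed

text \<open>Spectral projections are symmetric idempotents, so A -> |1_A(H) \<psi>|^2 is a quadratic
  form value; additivity and strong continuity of the calculus make it countably additive.
  Indicators as test functions give uniqueness, as the \<open>THE\<close> in
  \<open>spectral_measure\<close> demands.\<close>

lemma spectral_measure_unique_exists:
  assumes \<psi>: "\<psi> \<in> ell2"
  defines "P \<equiv> \<lambda>\<mu>. sets \<mu> = sets borel \<and> finite_measure \<mu> \<and> (\<forall>g\<in>bounded_borel. ell2_inner \<psi> (\<Psi> g \<psi>) = (LINT x|\<mu>. g x))"
  shows "\<exists>!\<mu>. P \<mu>"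
proof -
  define m where "m = (\<lambda>A. (ell2_norm (\<Psi> (\<lambda>x. indicator A x) \<psi>))\<^sup>2)"
  have qm: "quad \<psi> (\<lambda>x. indicator A x) = complex_of_real (m A)" if "A \<in> sets borel" for A
    unfolding m_def by (rule quad_indicator[OF \<psi> that])
  have m0: "0 \<le> m A" for A by (simp add: m_def)
  have mempty: "m {} = 0"
  proof -
    have "quad \<psi> (\<lambda>x. 0 * 1) = 0" by (subst quad_scale[OF bounded_borel_const \<psi>]) simp
    then show ?thesis using qm[of "{}"] by simp
  qed
  define \<mu> where "\<mu> = measure_of UNIV (sets borel) (\<lambda>A. ennreal (m A))"
  have sets: "sets \<mu> = sets borel" unfolding \<mu>_def using sets.sigma_sets_eq[of borel] by simp
  have space: "space \<mu> = UNIV" unfolding \<mu>_def by (subst space_measure_of) auto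
  have em: "emeasure \<mu> A = ennreal (m A)" if A: "A \<in> sets borel" for A
  proof (rule emeasure_measure_of[OF \<mu>_def])
    show "A \<in> sets \<mu>" using A sets by simp
    show "positive (sets \<mu>) (\<lambda>A. ennreal (m A))" by (simp add: positive_def mempty)
    show "countably_additive (sets \<mu>) (\<lambda>A. ennreal (m A))"
    proof (rule countably_additiveI)
      fix A :: "nat \<Rightarrow> real set" assume A: "range A \<subseteq> sets \<mu>" and d: "disjoint_family A" and U: "\<Union> (range A) \<in> sets \<mu>"
      have Ai: "A i \<in> sets borel" for i using A sets by auto
      define B where "B = (\<lambda>n. \<Union>i<n. A i)"
      have B: "B n \<in> sets borel" for n unfolding B_def using Ai by auto
      have Bsum: "m (B n) = (\<Sum>i<n. m (A i))" for n
      proof (induction n)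
        case 0
        then show ?case by (simp add: B_def mempty)
      next
        case (Suc n)
        have "A n \<inter> A i = {}" if "i < n" for i
          using disjoint_family_onD[OF d, of n i] that by simp
        then have disj: "A n \<inter> B n = {}" unfolding B_def by blast
        have "(\<lambda>x. indicator (B (Suc n)) x) = (\<lambda>x. indicator (B n) x + indicator (A n) x :: complex)"
          using disj unfolding B_def by (intro ext) (simp add: lessThan_Suc, subst indicator_add[symmetric], auto)
        then have "complex_of_real (m (B (Suc n))) = complex_of_real (m (B n)) + complex_of_real (m (A n))"
          unfolding qm[OF B, symmetric] qm[OF Ai, symmetric]
          using quad_add[OF indicator_bounded_borel[OF B] indicator_bounded_borel[OF Ai] \<psi>] by simp
        then have "m (B (Suc n)) = m (B n) + m (A n)" unfolding of_real_add[symmetric] of_real_eq_iff .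
        then show ?case using Suc by simp
      qed
      have "(\<lambda>n. quad \<psi> (\<lambda>x. indicator (B n) x)) \<longlonglongrightarrow> quad \<psi> (\<lambda>x. indicator (\<Union> (range A)) x)"
      proof (rule quad_limit[OF indicator_bounded_borel[OF B] _ _ \<psi>])
        show "cmod (indicator (B n) x) \<le> 1" for n x by (auto simp: indicator_def)
        show "(\<lambda>n. indicator (B n) x :: complex) \<longlonglongrightarrow> indicator (\<Union> (range A)) x" for x
          unfolding B_def by (rule LIMSEQ_indicator_UN)
      qed
      then have "(\<lambda>n. complex_of_real (m (B n))) \<longlonglongrightarrow> complex_of_real (m (\<Union> (range A)))"
        using U sets by (simp add: qm B del: of_real_power)
      then have "(\<lambda>i. m (A i)) sums m (\<Union> (range A))"
        unfolding tendsto_of_real_iff sums_def Bsum .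
      then show "(\<Sum>i. ennreal (m (A i))) = ennreal (m (\<Union> (range A)))"
        by (intro suminf_ennreal_eq m0)
    qed
  qed (auto simp: sets.space_closed)
  have fin: "finite_measure \<mu>"
    by (rule finite_measureI) (simp add: space em)
  interpret \<mu>: finite_measure \<mu> by (rule fin)
  note [measurable_cong] = sets
  have int: "ell2_inner \<psi> (\<Psi> g \<psi>) = (LINT x|\<mu>. g x)" if g: "g \<in> bounded_borel" for g
  proof -
    have ib: "integrable \<mu> h" if hb: "h \<in> bounded_borel" for h
    proof -
      obtain K where K: "\<And>x. cmod (h x) \<le> K" using bounded_borelD(2)[OF hb] by blast
      note [measurable] = bounded_borelD(1)[OF hb]
      show ?thesis by (rule \<mu>.integrable_const_bound[of _ K]) (use K in auto)
    qed
    have "quad \<psi> g = (LINT x|\<mu>. g x)"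
      using g
    proof (rule bounded_borel_induct_indicator)
      fix A :: "real set" assume A: "A \<in> sets borel"
      have "(LINT x|\<mu>. indicator A x) = complex_of_real (LINT x|\<mu>. indicator A x)"
        unfolding integral_complex_of_real[symmetric] by (intro Bochner_Integration.integral_cong refl) (auto simp: indicator_def)
      also have "(LINT x|\<mu>. indicator A x) = m A"
        using A m0[of A] by (simp add: measure_def em space)
      finally show "quad \<psi> (\<lambda>x. indicator A x) = (LINT x|\<mu>. indicator A x)" by (simp add: qm A)
    next
      fix g h assume *: "g \<in> bounded_borel" "h \<in> bounded_borel" "quad \<psi> g = (LINT x|\<mu>. g x)" "quad \<psi> h = (LINT x|\<mu>. h x)"
      then show "quad \<psi> (\<lambda>x. g x + h x) = (LINT x|\<mu>. g x + h x)"
        by (simp add: quad_add \<psi> ib)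
    next
      fix c g assume "g \<in> bounded_borel" "quad \<psi> g = (LINT x|\<mu>. g x)"
      then show "quad \<psi> (\<lambda>x. c * g x) = (LINT x|\<mu>. c * g x)"
        by (simp add: quad_scale \<psi> ib)
    next
      fix gs g and K :: real
      assume gs: "\<And>k. gs k \<in> bounded_borel" and q: "\<And>k. quad \<psi> (gs k) = (LINT x|\<mu>. gs k x)"
        and K: "\<And>k x. cmod (gs k x) \<le> K" and lim: "\<And>x. (\<lambda>k. gs k x) \<longlonglongrightarrow> g x"
      note [measurable] = bounded_borelD(1)[OF gs] bounded_borelD(1)[OF bounded_borel_limit(1)[OF gs K lim]]
      have "(\<lambda>k. LINT x|\<mu>. gs k x) \<longlonglongrightarrow> (LINT x|\<mu>. g x)"
        by (rule integral_dominated_convergence[where w="\<lambda>_. K"]) (use lim K in auto)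
      then show "quad \<psi> g = (LINT x|\<mu>. g x)"
        using quad_limit[OF gs K lim \<psi>] unfolding q by (rule LIMSEQ_unique[rotated])
    qed
    then show ?thesis by (simp add: quad_def)
  qed
  show ?thesis
  proof (rule ex1I[of _ \<mu>])
    show "P \<mu>" unfolding P_def using sets fin int by blast
    fix \<nu> assume "P \<nu>"
    then have \<nu>: "sets \<nu> = sets borel" "finite_measure \<nu>" "\<And>g. g \<in> bounded_borel \<Longrightarrow> ell2_inner \<psi> (\<Psi> g \<psi>) = (LINT x|\<nu>. g x)"
      unfolding P_def by auto
    interpret \<nu>: finite_measure \<nu> by (rule \<nu>(2))
    show "\<nu> = \<mu>"
    proof (rule measure_eqI)
      fix A assume "A \<in> sets \<nu>"
      then have A: "A \<in> sets borel" using \<nu>(1) by simp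
      have "complex_of_real (measure \<nu> A) = (LINT x|\<nu>. complex_of_real (indicator A x))"
        unfolding integral_complex_of_real using A \<nu>(1) sets_eq_imp_space_eq[OF \<nu>(1)] by simp
      also have "(\<lambda>x. complex_of_real (indicator A x)) = (\<lambda>x. indicator A x)" by (auto simp: indicator_def)
      also have "(LINT x|\<nu>. indicator A x) = complex_of_real (m A)"
        unfolding \<nu>(3)[OF indicator_bounded_borel[OF A], symmetric] using qm[OF A] by (simp add: quad_def)
      finally show "emeasure \<nu> A = emeasure \<mu> A"
        unfolding of_real_eq_iff by (simp add: \<nu>.emeasure_eq_measure em A)
    qed (simp add: \<nu> sets)
  qed
qed

lemma spectral_measure:
  assumes "\<psi> \<in> ell2"
  shows sets_spectral_measure: "sets (spectral_measure Hop \<psi>) = sets borel"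
    and finite_spectral_measure: "finite_measure (spectral_measure Hop \<psi>)"
    and quad_eq_integral: "\<And>g. g \<in> bounded_borel \<Longrightarrow> quad \<psi> g = (LINT x|spectral_measure Hop \<psi>. g x)"
  using theI'[OF spectral_measure_unique_exists[OF assms]]
  unfolding spectral_measure_def[symmetric] quad_def by auto

lemma space_spectral_measure: "\<psi> \<in> ell2 \<Longrightarrow> space (spectral_measure Hop \<psi>) = UNIV"
  using sets_eq_imp_space_eq[OF sets_spectral_measure] by simp

lemma measure_spectral_measure:
  assumes "\<psi> \<in> ell2" "A \<in> sets borel"
  shows "measure (spectral_measure Hop \<psi>) A = (ell2_norm (\<Psi> (\<lambda>x. indicator A x) \<psi>))\<^sup>2"
proof -
  have "complex_of_real (measure (spectral_measure Hop \<psi>) A) = (LINT x|spectral_measure Hop \<psi>. complex_of_real (indicator A x))"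
    unfolding integral_complex_of_real using assms by (simp add: space_spectral_measure sets_spectral_measure)
  also have "(\<lambda>x. complex_of_real (indicator A x)) = (\<lambda>x. indicator A x)" by (auto simp: indicator_def)
  also have "(LINT x|spectral_measure Hop \<psi>. indicator A x) = complex_of_real ((ell2_norm (\<Psi> (\<lambda>x. indicator A x) \<psi>))\<^sup>2)"
    using quad_eq_integral[OF assms(1) indicator_bounded_borel[OF assms(2)]] quad_indicator[OF assms] by simp
  finally show ?thesis unfolding of_real_eq_iff .
qed

lemma clamp_bounded_borel: "0 \<le> r \<Longrightarrow> (\<lambda>x. complex_of_real (max (- r) (min r x))) \<in> bounded_borel"
  by (rule bounded_borelI[where K=r]) auto

text \<open>The vector \<open>\<delta>\<^sub>1\<close> is cyclic, so its spectral measure is a maximal one.\<close>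

lemma null_delta1_imp_null:
  assumes A: "A \<in> sets borel" and null: "measure (spectral_measure Hop (delta 1)) A = 0" and \<psi>: "\<psi> \<in> ell2"
  shows "measure (spectral_measure Hop \<psi>) A = 0"
proof -
  note d = d1
  let ?i = "\<lambda>x. indicator A x :: complex"
  note i = indicator_bounded_borel[OF A]
  note B = bounded_op_Psi[OF i]
  \<comment> \<open>A bounded function equal to x on \<open>{-R..R}\<close>, hence one that the
    calculus sends to \<open>H\<close>; through it spectral projections commute with
    \<open>H\<close>.\<close>
  let ?c = "\<lambda>x. complex_of_real (max (- R) (min R x))"
  have c: "?c \<in> bounded_borel" using R_ge_1 by (intro clamp_bounded_borel) simp
  have cH: "\<Psi> ?c u = H u" if "u \<in> ell2" for u by (rule Psi_id[OF order_refl c _ that]) auto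
  have comm: "\<Psi> ?i (H u) = H (\<Psi> ?i u)" if u: "u \<in> ell2" for u
    using Psi_mult[OF i c u] Psi_mult[OF c i u] by (simp add: cH u Psi_ell2 i mult.commute)
  have z: "\<Psi> ?i (delta n) = (\<lambda>_. 0)" if "n \<ge> 1" for n
    using that
  proof (induction n rule: less_induct)
    case (less n)
    show ?case
    proof (cases "n = 1")
      case True
      have "ell2_norm (\<Psi> ?i (delta 1)) = 0" using null measure_spectral_measure[OF d A] by simp
      then show ?thesis using True ell2_norm_eq_0[OF Psi_ell2[OF i d]] by simp
    next
      case False
      define k where "k = n - 1"
      have k: "k \<ge> 1" "n = k + 1" using False less.prems by (auto simp: k_def)
      have dk: "delta k \<in> ell2" "delta (k + 1) \<in> ell2" using k by (auto intro: delta_ell2)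
      \<comment> \<open>The left neighbour of \<open>delta k\<close>, absent for k = 1. Solving
        \<open>jacobi_delta\<close> for the right neighbour expresses \<open>delta (k + 1)\<close>
        through earlier vectors.\<close>
      define e where "e = (if k = 1 then (\<lambda>_. 0) else delta (k - 1))"
      have e: "e \<in> ell2" "\<Psi> ?i e = (\<lambda>_. 0)"
        using k less.IH[of "k - 1"] bounded_opD(3)[OF B ell2_zero_seq, of 0]
        by (auto simp: e_def ell2_zero_seq intro!: delta_ell2)
      have k0: "\<Psi> ?i (delta k) = (\<lambda>_. 0)" using k less.IH[of k] by simp
      have dn: "delta n = (\<lambda>m. H (delta k) m + ((-1) * e m + (- of_real (v k)) * delta k m))"
        using jacobi_delta[OF k(1), of v] by (auto simp: k(2) e_def)
      have "\<Psi> ?i (delta n) = (\<lambda>m. \<Psi> ?i (H (delta k)) m + ((-1) * \<Psi> ?i e m + (- of_real (v k)) * \<Psi> ?i (delta k) m))"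
        unfolding dn
        by (simp only: bounded_opD(2,3)[OF B] ell2_add ell2_scale e(1) dk H_ell2)
      moreover have "\<Psi> ?i (H (delta k)) = (\<lambda>_. 0)"
        unfolding comm[OF dk(1)] k0 using bounded_opD(3)[OF bounded_op_H ell2_zero_seq, of 0] by simp
      ultimately show ?thesis by (simp only: e k0 mult_zero_right add_0_right)
    qed
  qed
  have "\<Psi> ?i \<psi> = (\<lambda>u n. 0) \<psi>"
  proof (rule bounded_op_eqI[OF B _ z \<psi>])
    show "bounded_op (\<lambda>u n. 0)"
      using bounded_op_affine[OF bounded_op_H, of 0 0] by simp
  qed
  then show ?thesis unfolding measure_spectral_measure[OF \<psi> A] by (simp add: ell2_norm_zero_seq)
qed

text \<open>The cutoff level exceeds both the norm, so that the calculus turns this function into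
  \<open>H\<close>, and 2, so that it is the identity on the band where the Borel transform is
  inverted.\<close>

definition clamp :: "real \<Rightarrow> real" where
  "clamp x = max (- max R 2) (min (max R 2) x)"

lemma clamp_eq: "x \<in> {-2..2} \<Longrightarrow> clamp x = x"
  by (auto simp: clamp_def)

lemma borel_measurable_clamp [measurable]: "clamp \<in> borel_measurable borel"
  unfolding clamp_def by measurable

section \<open>Resolvents\<close>

lemma resolvent_bounded_borel:
  assumes "Im E \<noteq> 0" shows "(\<lambda>x. 1 / (complex_of_real (clamp x) - E)) \<in> bounded_borel"
proof (rule bounded_borelI[where K="1 / \<bar>Im E\<bar>"])
  fix x
  have "\<bar>Im E\<bar> \<le> cmod (complex_of_real (clamp x) - E)"
    using abs_Im_le_cmod[of "complex_of_real (clamp x) - E"] by simp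
  then show "cmod (1 / (complex_of_real (clamp x) - E)) \<le> 1 / \<bar>Im E\<bar>"
    using assms by (simp add: norm_divide frac_le)
qed measurable

lemma resolvent_formula:
  assumes f: "f \<in> ell2" and E: "Im E \<noteq> 0" and eq: "\<And>n. n \<ge> 1 \<Longrightarrow> jacobi v f n = E * f n - F * delta 1 n"
  shows "f 1 = - F * (LINT y|spectral_measure Hop (delta 1). 1 / (complex_of_real (clamp y) - E))"
proof -
  let ?c = "\<lambda>x. complex_of_real (clamp x)" and ?r = "\<lambda>x. 1 / (complex_of_real (clamp x) - E)"
  have c: "?c \<in> bounded_borel" unfolding clamp_def by (intro clamp_bounded_borel) simp
  note r = resolvent_bounded_borel[OF E]
  have cE: "(\<lambda>x. ?c x + (-E) * 1) \<in> bounded_borel" by (intro bounded_borel_add c bounded_borel_scale bounded_borel_const)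
  have "\<Psi> ?c f = jacobi v f"
    by (rule Psi_id[of "max R 2", OF _ c _ f]) (auto simp: clamp_def)
  then have "\<Psi> (\<lambda>x. ?c x + (-E) * 1) f = (\<lambda>n. jacobi v f n + (-E) * f n)"
    using Psi_add[OF c bounded_borel_scale[OF bounded_borel_const] f, of "-E" 1] Psi_scale[OF bounded_borel_const f, of "-E" 1]
      Psi_one[OF f] by simp
  also have "\<dots> = (\<lambda>n. (-F) * delta 1 n)"
  proof
    fix n show "jacobi v f n + (-E) * f n = (-F) * delta 1 n"
      using eq[of n] ell2_zero[OF f] by (cases "n = 0") (auto simp: jacobi_def delta_def)
  qed
  finally have 1: "\<Psi> (\<lambda>x. ?c x + (-E) * 1) f = (\<lambda>n. (-F) * delta 1 n)" .
  have ne: "?c x - E \<noteq> 0" for x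
    using E by (metis Im_complex_of_real eq_iff_diff_eq_0)
  \<comment> \<open>Writing 1 as resolvent function times (x - E) inside the calculus inverts H - E
    on the known image of f.\<close>
  have "f = \<Psi> (\<lambda>x. ?r x * (?c x + (-E) * 1)) f"
    using Psi_one[OF f] ne by simp
  also have "\<dots> = \<Psi> ?r (\<lambda>n. (-F) * delta 1 n)"
    unfolding Psi_mult[OF r cE f] 1 ..
  also have "\<dots> = (\<lambda>n. (-F) * \<Psi> ?r (delta 1) n)"
    by (rule bounded_opD(3)[OF bounded_op_Psi[OF r] d1])
  finally have "f 1 = (-F) * \<Psi> ?r (delta 1) 1" by (rule fun_cong)
  also have "\<Psi> ?r (delta 1) 1 = quad (delta 1) ?r" unfolding quad_def ell2_inner_delta_left ..
  finally show ?thesis unfolding quad_eq_integral[OF d1 r] .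
qed

end

section \<open>Mean squares of Fourier transforms\<close>

text \<open>The antiderivative 2 arctan (t (y - x)) varies by at most 2 \<pi>, uniformly in x and t;
  this uniformity is what the Schur test needs.\<close>

lemma nn_integral_Poisson_kernel_le:
  assumes t: "t > 0"
  shows "(\<integral>\<^sup>+y. ennreal (2 * t / (1 + (t * (x - y))\<^sup>2)) * indicator {-2<..<2} y \<partial>lborel) \<le> ennreal (2 * pi)"
proof -
  let ?f = "\<lambda>y. 2 * t / (1 + (t * (x - y))\<^sup>2)" and ?F = "\<lambda>y. 2 * arctan (t * (y - x))"
  have "(\<integral>\<^sup>+y. ennreal (?f y) * indicator {-2<..<2} y \<partial>lborel) \<le> (\<integral>\<^sup>+y. ennreal (?f y) * indicator {-2..2} y \<partial>lborel)"
    by (intro nn_integral_mono) (auto simp: indicator_def)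
  also have "\<dots> = ennreal (?F 2 - ?F (-2))"
  proof (rule nn_integral_FTC_Icc)
    show "(?F has_real_derivative ?f y) (at y)" for y
    proof -
      have "(t * (x - y))\<^sup>2 = (t * (y - x))\<^sup>2" by (simp add: power2_eq_square algebra_simps)
      then show ?thesis
        by (auto intro!: derivative_eq_intros simp: field_simps inverse_eq_divide)
    qed
    show "0 \<le> ?f y" for y using t by (intro divide_nonneg_nonneg) (auto simp: add_nonneg_nonneg)
  qed auto
  also have "\<dots> \<le> ennreal (2 * pi)"
    using arctan_ubound[of "t * (2 - x)"] arctan_lbound[of "t * (- 2 - x)"] by (intro ennreal_leI) linarith
  finally show ?thesis .
qed

lemma nn_integral_le_density:
  assumes sets: "sets \<nu> = sets borel" and \<omega> [measurable]: "\<omega> \<in> borel_measurable borel"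
    and le: "\<And>A. A \<in> sets borel \<Longrightarrow> emeasure \<nu> A \<le> (\<integral>\<^sup>+x. ennreal (\<omega> x) * indicator A x \<partial>lborel)"
    and g [measurable]: "g \<in> borel_measurable borel"
  shows "(\<integral>\<^sup>+x. g x \<partial>\<nu>) \<le> (\<integral>\<^sup>+x. ennreal (\<omega> x) * g x \<partial>lborel)"
proof -
  let ?N = "density lborel (\<lambda>x. ennreal (\<omega> x))"
  have "\<nu> \<le> ?N"
    by (subst le_measure) (auto simp: sets emeasure_density le)
  then have "(\<integral>\<^sup>+x. g x \<partial>\<nu>) \<le> (\<integral>\<^sup>+x. g x \<partial>?N)"
    by (intro nn_integral_mono_measure) (auto simp: sets)
  also have "\<dots> = (\<integral>\<^sup>+x. ennreal (\<omega> x) * g x \<partial>lborel)"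
    by (rule nn_integral_density) auto
  finally show ?thesis .
qed

text \<open>By \<omega>(x) \<omega>(y) \<le> (\<omega>(x)^2 + \<omega>(y)^2)/2 and the symmetry of
  the kernel, the double integral splits into two equal halves, each at most \<pi> times the
  integral of \<omega>^2.\<close>

lemma Schur_Poisson_kernel:
  assumes sets: "sets \<nu> = sets borel" and \<omega> [measurable]: "\<omega> \<in> borel_measurable borel"
    and le: "\<And>A. A \<in> sets borel \<Longrightarrow> emeasure \<nu> A \<le> (\<integral>\<^sup>+x. ennreal (\<omega> x) * indicator A x \<partial>lborel)"
    and \<omega>0: "\<And>x. 0 \<le> \<omega> x" "\<And>x. x \<notin> {-2<..<2} \<Longrightarrow> \<omega> x = 0" and t: "t > 0"
    and fin: "finite_measure \<nu>"
  shows "(\<integral>\<^sup>+x. \<integral>\<^sup>+y. ennreal (2 * t / (1 + (t * (x - y))\<^sup>2)) \<partial>\<nu> \<partial>\<nu>) \<le> ennreal (2 * pi) * (\<integral>\<^sup>+x. ennreal ((\<omega> x)\<^sup>2) \<partial>lborel)"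
proof -
  interpret \<nu>: finite_measure \<nu> by (rule fin)
  note [measurable_cong] = sets
  let ?k = "\<lambda>x y. 2 * t / (1 + (t * (x - y))\<^sup>2)"
  let ?I = "\<lambda>x. indicator {-2<..<2::real} x :: real"
  have k0: "0 \<le> ?k x y" for x y using t by (intro divide_nonneg_nonneg) (auto simp: add_nonneg_nonneg)
  have ksym: "?k x y = ?k y x" for x y by (simp add: power2_eq_square algebra_simps)
  have half: "(\<integral>\<^sup>+x. \<integral>\<^sup>+y. ennreal ((\<omega> x)\<^sup>2 / 2 * (?k x y * ?I y)) \<partial>lborel \<partial>lborel) \<le> ennreal pi * (\<integral>\<^sup>+x. ennreal ((\<omega> x)\<^sup>2) \<partial>lborel)"
  proof -
    have "(\<integral>\<^sup>+x. \<integral>\<^sup>+y. ennreal ((\<omega> x)\<^sup>2 / 2 * (?k x y * ?I y)) \<partial>lborel \<partial>lborel)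
      = (\<integral>\<^sup>+x. ennreal ((\<omega> x)\<^sup>2 / 2) * (\<integral>\<^sup>+y. ennreal (?k x y) * indicator {-2<..<2} y \<partial>lborel) \<partial>lborel)"
    proof -
      have "ennreal (c * (k * indicator S y)) = ennreal c * (ennreal k * indicator S y)"
        if "0 \<le> c" "0 \<le> k" for c k and S :: "real set" and y
        by (cases "y \<in> S") (simp_all add: ennreal_mult that)
      then have "ennreal ((\<omega> x)\<^sup>2 / 2 * (?k x y * ?I y)) = ennreal ((\<omega> x)\<^sup>2 / 2) * (ennreal (?k x y) * indicator {-2<..<2} y)" for x y
        using k0[of x y] by (simp del: times_divide_eq_left times_divide_eq_right)
      then show ?thesis by (simp only:) (intro nn_integral_cong nn_integral_cmult, measurable)
    qed
    also have "\<dots> \<le> (\<integral>\<^sup>+x. ennreal ((\<omega> x)\<^sup>2 / 2) * ennreal (2 * pi) \<partial>lborel)"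
      by (intro nn_integral_mono mult_left_mono nn_integral_Poisson_kernel_le t) auto
    also have "\<dots> = (\<integral>\<^sup>+x. ennreal pi * ennreal ((\<omega> x)\<^sup>2) \<partial>lborel)"
      by (intro nn_integral_cong) (simp add: ennreal_mult[symmetric] mult.commute)
    also have "\<dots> = ennreal pi * (\<integral>\<^sup>+x. ennreal ((\<omega> x)\<^sup>2) \<partial>lborel)"
      by (rule nn_integral_cmult) auto
    finally show ?thesis .
  qed
  have "(\<integral>\<^sup>+x. \<integral>\<^sup>+y. ennreal (?k x y) \<partial>\<nu> \<partial>\<nu>) \<le> (\<integral>\<^sup>+x. ennreal (\<omega> x) * (\<integral>\<^sup>+y. ennreal (?k x y) \<partial>\<nu>) \<partial>lborel)"
  proof (rule nn_integral_le_density[OF sets \<omega> le])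
    show "(\<lambda>x. \<integral>\<^sup>+y. ennreal (?k x y) \<partial>\<nu>) \<in> borel_measurable borel"
      by (rule \<nu>.borel_measurable_nn_integral) measurable
  qed
  also have "\<dots> \<le> (\<integral>\<^sup>+x. ennreal (\<omega> x) * (\<integral>\<^sup>+y. ennreal (\<omega> y) * ennreal (?k x y) \<partial>lborel) \<partial>lborel)"
    by (intro nn_integral_mono mult_left_mono nn_integral_le_density[OF sets \<omega> le]) auto
  also have "\<dots> = (\<integral>\<^sup>+x. \<integral>\<^sup>+y. ennreal (\<omega> x * \<omega> y * ?k x y) \<partial>lborel \<partial>lborel)"
  proof -
    have "ennreal (a * b * c) = ennreal a * (ennreal b * ennreal c)" if "0 \<le> a" "0 \<le> b" "0 \<le> c" for a b c
      by (simp add: ennreal_mult that mult.assoc)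
    then have "ennreal (\<omega> x * \<omega> y * ?k x y) = ennreal (\<omega> x) * (ennreal (\<omega> y) * ennreal (?k x y))" for x y
      using k0[of x y] \<omega>0(1)[of x] \<omega>0(1)[of y] by (simp del: times_divide_eq_left times_divide_eq_right)
    then show ?thesis by (simp only:) (intro nn_integral_cong nn_integral_cmult[symmetric], measurable)
  qed
  also have "\<dots> \<le> (\<integral>\<^sup>+x. \<integral>\<^sup>+y. ennreal ((\<omega> x)\<^sup>2 / 2 * (?k x y * ?I y)) + ennreal ((\<omega> y)\<^sup>2 / 2 * (?k y x * ?I x)) \<partial>lborel \<partial>lborel)"
  proof (intro nn_integral_mono)
    fix x y
    have "\<omega> x * \<omega> y * ?k x y \<le> (\<omega> x)\<^sup>2 / 2 * (?k x y * ?I y) + (\<omega> y)\<^sup>2 / 2 * (?k y x * ?I x)"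
    proof (cases "x \<in> {-2<..<2} \<and> y \<in> {-2<..<2}")
      case True
      have "\<omega> x * \<omega> y \<le> (\<omega> x)\<^sup>2 / 2 + (\<omega> y)\<^sup>2 / 2"
        using sum_squares_bound[of "\<omega> x" "\<omega> y"] by simp
      from mult_right_mono[OF this k0[of x y]] show ?thesis
        unfolding ksym[of y x] using True by (simp add: distrib_right add_divide_distrib)
    next
      case False
      then have "\<omega> x * \<omega> y = 0" using \<omega>0(2) by auto
      moreover have "0 \<le> (\<omega> x)\<^sup>2 / 2 * (?k x y * ?I y)" "0 \<le> (\<omega> y)\<^sup>2 / 2 * (?k y x * ?I x)"
        by (intro mult_nonneg_nonneg k0; simp)+
      ultimately show ?thesis by (simp only: mult_zero_left add_nonneg_nonneg)
    qed
    then have "ennreal (\<omega> x * \<omega> y * ?k x y) \<le> ennreal ((\<omega> x)\<^sup>2 / 2 * (?k x y * ?I y) + (\<omega> y)\<^sup>2 / 2 * (?k y x * ?I x))"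
      by (rule ennreal_leI)
    also have "\<dots> = ennreal ((\<omega> x)\<^sup>2 / 2 * (?k x y * ?I y)) + ennreal ((\<omega> y)\<^sup>2 / 2 * (?k y x * ?I x))"
      by (intro ennreal_plus mult_nonneg_nonneg k0) auto
    finally show "ennreal (\<omega> x * \<omega> y * ?k x y) \<le> \<dots>" .
  qed
  also have "\<dots> = (\<integral>\<^sup>+x. \<integral>\<^sup>+y. ennreal ((\<omega> x)\<^sup>2 / 2 * (?k x y * ?I y)) \<partial>lborel \<partial>lborel)
     + (\<integral>\<^sup>+x. \<integral>\<^sup>+y. ennreal ((\<omega> y)\<^sup>2 / 2 * (?k y x * ?I x)) \<partial>lborel \<partial>lborel)"
  proof -
    have "(\<integral>\<^sup>+y. ennreal ((\<omega> x)\<^sup>2 / 2 * (?k x y * ?I y)) + ennreal ((\<omega> y)\<^sup>2 / 2 * (?k y x * ?I x)) \<partial>lborel) =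
      (\<integral>\<^sup>+y. ennreal ((\<omega> x)\<^sup>2 / 2 * (?k x y * ?I y)) \<partial>lborel) + (\<integral>\<^sup>+y. ennreal ((\<omega> y)\<^sup>2 / 2 * (?k y x * ?I x)) \<partial>lborel)" for x
      by (rule nn_integral_add) auto
    then show ?thesis by (simp only:) (rule nn_integral_add, measurable)
  qed
  also have "(\<integral>\<^sup>+x. \<integral>\<^sup>+y. ennreal ((\<omega> y)\<^sup>2 / 2 * (?k y x * ?I x)) \<partial>lborel \<partial>lborel) =
    (\<integral>\<^sup>+y. \<integral>\<^sup>+x. ennreal ((\<omega> y)\<^sup>2 / 2 * (?k y x * ?I x)) \<partial>lborel \<partial>lborel)"
    by (rule lborel_pair.Fubini') measurable
  also have "(\<integral>\<^sup>+x. \<integral>\<^sup>+y. ennreal ((\<omega> x)\<^sup>2 / 2 * (?k x y * ?I y)) \<partial>lborel \<partial>lborel) + \<dots>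
    \<le> ennreal pi * (\<integral>\<^sup>+x. ennreal ((\<omega> x)\<^sup>2) \<partial>lborel) + ennreal pi * (\<integral>\<^sup>+x. ennreal ((\<omega> x)\<^sup>2) \<partial>lborel)"
    by (intro add_mono half)
  also have "\<dots> = ennreal (2 * pi) * (\<integral>\<^sup>+x. ennreal ((\<omega> x)\<^sup>2) \<partial>lborel)"
    by (simp add: distrib_right[symmetric] ennreal_plus[symmetric] del: ennreal_plus)
  finally show ?thesis .
qed

text \<open>The triangular weight replaces a sharp cutoff at t: it is at least 1/2 on
  \<open>{0..t}\<close>, and its cosine transform, the Fejer kernel, is nonnegative, whereas the
  transform of the cutoff changes sign.\<close>

lemma Fejer_integral:
  fixes t u :: real
  assumes t: "t > 0"
  shows "((\<lambda>s. (1 - s / (2 * t)) * cos (s * u)) has_integral (if u = 0 then t else (sin (t * u))\<^sup>2 / (t * u\<^sup>2))) {0..2 * t}"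
proof (cases "u = 0")
  case True
  have "((\<lambda>s. 1 - s / (2 * t)) has_integral ((2 * t - (2 * t)\<^sup>2 / (4 * t)) - (0 - 0\<^sup>2 / (4 * t)))) {0..2 * t}"
    using t by (intro fundamental_theorem_of_calculus)
      (auto intro!: derivative_eq_intros simp flip: has_real_derivative_iff_has_vector_derivative)
  moreover have "(2 * t - (2 * t)\<^sup>2 / (4 * t)) - (0 - 0\<^sup>2 / (4 * t)) = t" using t by (simp add: power2_eq_square)
  ultimately show ?thesis using True by simp
next
  case False
  let ?G = "\<lambda>s. (1 - s / (2 * t)) * sin (s * u) / u - cos (s * u) / (2 * t * u\<^sup>2)"
  have "((\<lambda>s. (1 - s / (2 * t)) * cos (s * u)) has_integral (?G (2 * t) - ?G 0)) {0..2 * t}"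
  proof (rule fundamental_theorem_of_calculus)
    fix s assume "s \<in> {0..2 * t}"
    have "(?G has_real_derivative (1 - s / (2 * t)) * cos (s * u)) (at s within {0..2 * t})"
      using t False
      by (auto intro!: derivative_eq_intros simp: field_simps power2_eq_square)
    then show "(?G has_vector_derivative (1 - s / (2 * t)) * cos (s * u)) (at s within {0..2 * t})"
      by (simp add: has_real_derivative_iff_has_vector_derivative)
  qed (use t in simp)
  moreover have "?G (2 * t) - ?G 0 = (sin (t * u))\<^sup>2 / (t * u\<^sup>2)"
  proof -
    have "cos (2 * t * u) = 1 - 2 * (sin (t * u))\<^sup>2"
      using cos_double_sin[of "t * u"] by (simp add: mult.assoc)
    moreover have "?G (2 * t) - ?G 0 = (1 - cos (2 * t * u)) / (2 * t * u\<^sup>2)"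
      using t by (simp add: diff_divide_distrib)
    ultimately show ?thesis by simp
  qed
  ultimately show ?thesis using False by simp
qed

text \<open>With a = t u, adding (sin a)^2 <= a^2 to (sin a)^2 a^2 <= a^2 gives (sin a)^2 (1 + a^2)
  <= 2 a^2.\<close>

lemma Fejer_le_Poisson:
  fixes t u :: real
  assumes t: "t > 0"
  shows "(if u = 0 then t else (sin (t * u))\<^sup>2 / (t * u\<^sup>2)) \<le> 2 * t / (1 + (t * u)\<^sup>2)"
proof (cases "u = 0")
  case False
  define a where "a = t * u"
  have a: "a\<^sup>2 > 0" using t False unfolding zero_less_power2 by (simp add: a_def)
  have "(sin a)\<^sup>2 \<le> 1" using sin_cos_squared_add[of a] zero_le_power2[of "cos a"] by linarith
  moreover have "(sin a)\<^sup>2 \<le> a\<^sup>2" using abs_sin_x_le_abs_x[of a] by (rule abs_le_square_iff[THEN iffD1])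
  ultimately have "(sin a)\<^sup>2 * 1 + (sin a)\<^sup>2 * a\<^sup>2 \<le> a\<^sup>2 + 1 * a\<^sup>2"
    by (intro add_mono mult_right_mono) auto
  then have "(sin a)\<^sup>2 * (1 + a\<^sup>2) \<le> 2 * a\<^sup>2" by (simp add: distrib_left)
  then have "(sin a)\<^sup>2 / a\<^sup>2 \<le> 2 / (1 + a\<^sup>2)"
    using a by (simp add: divide_le_eq pos_le_divide_eq add_pos_pos)
  then have "t * ((sin a)\<^sup>2 / a\<^sup>2) \<le> t * (2 / (1 + a\<^sup>2))" using t by (intro mult_left_mono) auto
  moreover have "t * ((sin a)\<^sup>2 / a\<^sup>2) = (sin (t * u))\<^sup>2 / (t * u\<^sup>2)"
    using t by (simp add: a_def power2_eq_square)
  ultimately show ?thesis using False by (simp add: a_def mult.commute)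
qed (use t in simp)

text \<open>The squared modulus of a Fourier transform is the double integral of cos (s (x - y));
  averaging over s first, by Fubini, leaves the Fejer kernel and hence the Poisson bound.\<close>

lemma fourier_square_le:
  fixes \<nu> :: "real measure"
  assumes sets: "sets \<nu> = sets borel" and fin: "finite_measure \<nu>" and t: "t > 0"
  shows "(\<lambda>s. (cmod (LINT x|\<nu>. exp (- \<i> * of_real s * of_real x)))\<^sup>2) integrable_on {0..t}"
    and "ennreal (integral {0..t} (\<lambda>s. (cmod (LINT x|\<nu>. exp (- \<i> * of_real s * of_real x)))\<^sup>2))
     \<le> 2 * (\<integral>\<^sup>+x. \<integral>\<^sup>+y. ennreal (2 * t / (1 + (t * (x - y))\<^sup>2)) \<partial>\<nu> \<partial>\<nu>)"
proof -
  interpret \<nu>: finite_measure \<nu> by (rule fin)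
  note [measurable_cong] = sets
  have space\<nu>: "space \<nu> = UNIV" using sets_eq_imp_space_eq[OF sets] by simp
  interpret P: pair_sigma_finite \<nu> \<nu> ..
  define Q where "Q = \<nu> \<Otimes>\<^sub>M \<nu>"
  interpret Q: finite_measure Q unfolding Q_def by (rule finite_measure_pair_measure[OF fin fin])
  define q where "q = (\<lambda>s. (cmod (LINT x|\<nu>. exp (- \<i> * of_real s * of_real x)))\<^sup>2)"
  have int1: "integrable \<nu> (\<lambda>x. cos (s * x))" "integrable \<nu> (\<lambda>x. sin (s * x))" for s
    by (rule \<nu>.integrable_const_bound[of _ 1]; simp)+
  have intQ: "integrable Q (\<lambda>p. cos (s * (fst p - snd p)))" for s
    unfolding Q_def by (rule Q.integrable_const_bound[unfolded Q_def, of _ 1]) (simp, measurable)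
  have q_eq: "q s = (LINT p|Q. cos (s * (fst p - snd p)))" for s
  proof -
    have ie: "integrable \<nu> (\<lambda>x. exp (- \<i> * of_real s * complex_of_real x))"
      by (rule \<nu>.integrable_const_bound[of _ 1]) (simp_all add: norm_exp_eq_Re)
    have "Re (LINT x|\<nu>. exp (- \<i> * of_real s * complex_of_real x)) = (LINT x|\<nu>. cos (s * x))"
      unfolding integral_Re[OF ie, symmetric] by (simp add: Re_exp)
    moreover have "Im (LINT x|\<nu>. exp (- \<i> * of_real s * complex_of_real x)) = - (LINT x|\<nu>. sin (s * x))"
      unfolding integral_Im[OF ie, symmetric] by (simp add: Im_exp)
    ultimately have "q s = (LINT x|\<nu>. cos (s * x))\<^sup>2 + (LINT x|\<nu>. sin (s * x))\<^sup>2"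
      by (simp add: q_def cmod_power2)
    also have "\<dots> = (LINT x|\<nu>. cos (s * x) * (LINT y|\<nu>. cos (s * y)) + sin (s * x) * (LINT y|\<nu>. sin (s * y)))"
      using int1 by (simp add: power2_eq_square)
    also have "\<dots> = (LINT x|\<nu>. LINT y|\<nu>. cos (s * x) * cos (s * y) + sin (s * x) * sin (s * y))"
      using int1 by (intro Bochner_Integration.integral_cong refl) simp
    also have "\<dots> = (LINT x|\<nu>. LINT y|\<nu>. cos (s * (fst (x, y) - snd (x, y))))"
      by (simp add: right_diff_distrib cos_diff)
    also have "\<dots> = (LINT p|Q. cos (s * (fst p - snd p)))"
      unfolding Q_def by (rule P.integral_fst') (use intQ[of s] in \<open>simp add: Q_def\<close>)
    finally show ?thesis .
  qed
  have q0: "0 \<le> q s" for s by (simp add: q_def)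
  have qB: "q s \<le> measure Q (space Q)" for s
  proof -
    have "q s \<le> (LINT p|Q. 1)" unfolding q_eq by (intro integral_mono intQ) auto
    then show ?thesis by simp
  qed
  interpret PQ: pair_sigma_finite lborel Q ..
  have setsQ[measurable_cong]: "sets Q = sets (borel \<Otimes>\<^sub>M borel)"
    unfolding Q_def by (intro sets_pair_measure_cong sets)
  have qm [measurable]: "q \<in> borel_measurable borel"
    unfolding q_eq by measurable
  have bd: "integrable lborel (\<lambda>s. indicator {0..c} s * h s)"
    if [measurable]: "h \<in> borel_measurable borel" and b: "\<And>s. s \<in> {0..c} \<Longrightarrow> \<bar>h s\<bar> \<le> B" for h :: "real \<Rightarrow> real" and c B
  proof (rule Bochner_Integration.integrable_bound)
    show "integrable lborel (\<lambda>s. B * indicator {0..c} s)"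
      by (intro integrable_mult_right integrable_real_indicator) (auto simp: emeasure_lborel_Icc_eq)
    have "\<bar>h s\<bar> \<le> \<bar>B\<bar>" if "s \<in> {0..c}" for s using b[OF that] by linarith
    then show "AE s in lborel. norm (indicator {0..c} s * h s) \<le> norm (B * indicator {0..c} s)"
      by (intro AE_I2) (simp add: indicator_def)
  qed measurable
  have iq: "set_integrable lborel {0..t} q"
    unfolding set_integrable_def using bd[of q t "measure Q (space Q)"] q0 qB by simp
  show "q integrable_on {0..t}" by (rule set_borel_integral_eq_integral(1)[OF iq])
  let ?w = "\<lambda>s. 1 - s / (2 * t)"
  let ?F = "\<lambda>u. if u = 0 then t else (sin (t * u))\<^sup>2 / (t * u\<^sup>2)"
  have w01: "0 \<le> ?w s" "?w s \<le> 1" if "s \<in> {0..2 * t}" for s using that t by (auto simp: divide_le_eq)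
  have "integral {0..t} q = (LINT s|lborel. indicator {0..t} s * q s)"
    using set_borel_integral_eq_integral(2)[OF iq] by (simp add: set_lebesgue_integral_def)
  \<comment> \<open>The factor 2 pays for the triangular weight, which is at least 1/2 on
    \<open>{0..t}\<close>; on the rest of \<open>{0..2 * t}\<close> the integrand is
    nonnegative.\<close>
  also have "\<dots> \<le> (LINT s|lborel. 2 * (indicator {0..2 * t} s * (?w s * q s)))"
  proof (rule integral_mono)
    show "integrable lborel (\<lambda>s. indicator {0..t} s * q s)" using iq by (simp add: set_integrable_def)
    have "\<bar>?w s * q s\<bar> \<le> 1 * measure Q (space Q)" if "s \<in> {0..2 * t}" for s
      unfolding abs_mult using w01[OF that] q0[of s] qB[of s] by (intro mult_mono) auto
    then show "integrable lborel (\<lambda>s. 2 * (indicator {0..2 * t} s * (?w s * q s)))"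
      by (intro integrable_mult_right bd) auto
    fix s
    show "indicator {0..t} s * q s \<le> 2 * (indicator {0..2 * t} s * (?w s * q s))"
    proof (cases "s \<in> {0..t}")
      case True
      then have "1 \<le> 2 * ?w s" using t by (simp add: field_simps)
      from mult_right_mono[OF this q0[of s]] have "q s \<le> 2 * (?w s * q s)" by (simp only: mult_1_left mult.assoc)
      moreover have "indicator {0..t} s = (1 :: real)" "indicator {0..2 * t} s = (1 :: real)" using True t by auto
      ultimately show ?thesis by (simp only: mult_1_left)
    next
      case False
      have "0 \<le> indicator {0..2 * t} s * (?w s * q s)"
        using w01[of s] q0[of s] by (cases "s \<in> {0..2 * t}") auto
      then show ?thesis using False by simp
    qed
  qed
  also have "\<dots> = 2 * (LINT s|lborel. indicator {0..2 * t} s * (?w s * q s))" by simp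
  also have "(LINT s|lborel. indicator {0..2 * t} s * (?w s * q s))
     = (LINT s|lborel. LINT p|Q. indicator {0..2 * t} s * (?w s * cos (s * (fst p - snd p))))"
    unfolding q_eq by simp
  also have "\<dots> = (LINT p|Q. LINT s|lborel. indicator {0..2 * t} s * (?w s * cos (s * (fst p - snd p))))"
  proof (rule PQ.Fubini_integral[symmetric])
    have "integrable (lborel \<Otimes>\<^sub>M Q) (\<lambda>z. indicator {0..2 * t} (fst z) * (?w (fst z) * cos (fst z * (fst (snd z) - snd (snd z)))))"
    proof (rule Bochner_Integration.integrable_bound)
      show "integrable (lborel \<Otimes>\<^sub>M Q) (indicator ({0..2 * t} \<times> space Q) :: real \<times> real \<times> real \<Rightarrow> real)"
        using t by (intro integrable_real_indicator) (auto simp: Q.emeasure_pair_measure_Times Q.emeasure_eq_measure ennreal_mult_less_top)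
      show "AE z in lborel \<Otimes>\<^sub>M Q. norm (indicator {0..2 * t} (fst z) * (?w (fst z) * cos (fst z * (fst (snd z) - snd (snd z)))))
          \<le> norm (indicator ({0..2 * t} \<times> space Q) z :: real)"
      proof (rule AE_I2)
        fix z :: "real \<times> real \<times> real" assume z: "z \<in> space (lborel \<Otimes>\<^sub>M Q)"
        show "norm (indicator {0..2 * t} (fst z) * (?w (fst z) * cos (fst z * (fst (snd z) - snd (snd z)))))
          \<le> norm (indicator ({0..2 * t} \<times> space Q) z :: real)"
        proof (cases "fst z \<in> {0..2 * t}")
          case True
          then have "\<bar>?w (fst z) * cos (fst z * (fst (snd z) - snd (snd z)))\<bar> \<le> 1 * 1"
            unfolding abs_mult using w01[OF True] by (intro mult_mono) auto
          then show ?thesis using True z by (simp add: indicator_def space_pair_measure mem_Times_iff)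
        qed simp
      qed
    qed measurable
    then show "integrable (lborel \<Otimes>\<^sub>M Q) (\<lambda>(s, p). indicator {0..2 * t} s * (?w s * cos (s * (fst p - snd p))))"
      by (simp add: case_prod_unfold)
  qed
  also have "\<dots> = (LINT p|Q. ?F (fst p - snd p))"
  proof (intro Bochner_Integration.integral_cong refl)
    fix p :: "real \<times> real"
    let ?h = "\<lambda>s. ?w s * cos (s * (fst p - snd p))"
    have b: "\<bar>?h s\<bar> \<le> 1" if "s \<in> {0..2 * t}" for s
    proof -
      have "\<bar>?h s\<bar> \<le> 1 * 1" unfolding abs_mult using w01[OF that] by (intro mult_mono) auto
      then show ?thesis by simp
    qed
    have si: "set_integrable lborel {0..2 * t} ?h"
      using bd[of ?h "2 * t" 1] b by (simp add: set_integrable_def)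
    have "(LINT s|lborel. indicator {0..2 * t} s * ?h s) = integral {0..2 * t} ?h"
      using set_borel_integral_eq_integral(2)[OF si] by (simp only: set_lebesgue_integral_def real_scaleR_def)
    also have "\<dots> = ?F (fst p - snd p)" by (rule integral_unique[OF Fejer_integral[OF t]])
    finally show "(LINT s|lborel. indicator {0..2 * t} s * ?h s) = ?F (fst p - snd p)" .
  qed
  finally have le: "integral {0..t} q \<le> 2 * (LINT p|Q. ?F (fst p - snd p))" by simp
  have F0: "0 \<le> ?F u" for u using t by simp
  have "ennreal (integral {0..t} q) \<le> ennreal (2 * (LINT p|Q. ?F (fst p - snd p)))" by (rule ennreal_leI[OF le])
  also have "\<dots> = 2 * ennreal (LINT p|Q. ?F (fst p - snd p))"
  proof -
    have nn: "0 \<le> (LINT p|Q. ?F (fst p - snd p))"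
      by (rule integral_nonneg_AE, rule AE_I2, rule F0)
    show ?thesis by (simp only: ennreal_mult[OF zero_le_numeral nn] ennreal_numeral)
  qed
  \<comment> \<open>This direction holds even for an infinite right side, because
    \<open>enn2real\<close> sends infinity to 0.\<close>
  also have "ennreal (LINT p|Q. ?F (fst p - snd p)) \<le> (\<integral>\<^sup>+p. ennreal (?F (fst p - snd p)) \<partial>Q)"
  proof -
    have [measurable]: "(\<lambda>p. ?F (fst p - snd p)) \<in> borel_measurable Q" by measurable
    show ?thesis
      unfolding integral_eq_nn_integral[OF \<open>(\<lambda>p. ?F (fst p - snd p)) \<in> borel_measurable Q\<close> AE_I2[OF F0]]
      by (simp add: ennreal_enn2real_if)
  qed
  also have "(\<integral>\<^sup>+p. ennreal (?F (fst p - snd p)) \<partial>Q) \<le> (\<integral>\<^sup>+p. ennreal (2 * t / (1 + (t * (fst p - snd p))\<^sup>2)) \<partial>Q)"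
    by (intro nn_integral_mono ennreal_leI Fejer_le_Poisson t)
  also have "\<dots> = (\<integral>\<^sup>+x. \<integral>\<^sup>+y. ennreal (2 * t / (1 + (t * (x - y))\<^sup>2)) \<partial>\<nu> \<partial>\<nu>)"
    unfolding Q_def by (subst \<nu>.nn_integral_fst[symmetric]) auto
  finally show "ennreal (integral {0..t} q) \<le> 2 * (\<integral>\<^sup>+x. \<integral>\<^sup>+y. ennreal (2 * t / (1 + (t * (x - y))\<^sup>2)) \<partial>\<nu> \<partial>\<nu>)"
    by (simp add: mult_left_mono)
qed

section \<open>Stieltjes inversion and measures with a square root singularity\<close>

text \<open>On the interval of length 2 \<eta> around y the kernel is at least 1/(2 \<eta>). The
  kernel lacks the normalization 1/\<pi>, so the mass 1 is not sharp, but it suffices for an upper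
  bound with no extra constant.\<close>

lemma Poisson_mass_ge_1:
  assumes \<eta>: "0 < \<eta>" and U: "ball y \<eta> \<subseteq> U" and c: "c y = y" and U': "U \<in> sets borel"
  shows "1 \<le> (\<integral>\<^sup>+x. ennreal (\<eta> / ((c y - x)\<^sup>2 + \<eta>\<^sup>2)) * indicator U x \<partial>lborel)"
proof -
  have "1 = (\<integral>\<^sup>+x. ennreal (1 / (2 * \<eta>)) * indicator {y - \<eta><..<y + \<eta>} x \<partial>lborel)"
    using \<eta> by (simp add: nn_integral_cmult_indicator ennreal_mult[symmetric])
  also have "\<dots> \<le> (\<integral>\<^sup>+x. ennreal (\<eta> / ((c y - x)\<^sup>2 + \<eta>\<^sup>2)) * indicator U x \<partial>lborel)"
  proof (intro nn_integral_mono)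
    fix x
    show "ennreal (1 / (2 * \<eta>)) * indicator {y - \<eta><..<y + \<eta>} x \<le> ennreal (\<eta> / ((c y - x)\<^sup>2 + \<eta>\<^sup>2)) * indicator U x"
    proof (cases "x \<in> {y - \<eta><..<y + \<eta>}")
      case True
      then have xU: "x \<in> U" using U by (auto simp: subset_iff dist_real_def abs_less_iff)
      have "\<bar>y - x\<bar> \<le> \<eta>" using True by auto
      then have "(y - x)\<^sup>2 \<le> \<eta>\<^sup>2" using power_mono[of "\<bar>y - x\<bar>" \<eta> 2] by simp
      then have "\<eta> / (2 * \<eta>\<^sup>2) \<le> \<eta> / ((y - x)\<^sup>2 + \<eta>\<^sup>2)"
        using \<eta> by (intro divide_left_mono) (auto intro!: mult_pos_pos add_nonneg_pos)
      moreover have "\<eta> / (2 * \<eta>\<^sup>2) = 1 / (2 * \<eta>)" using \<eta> by (simp add: power2_eq_square)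
      ultimately show ?thesis using True xU by (simp add: c ennreal_leI)
    qed simp
  qed
  finally show ?thesis .
qed

text \<open>An upper bound in Stieltjes inversion that needs no boundary values of the Borel transform
  \<open>m\<close>: the mass of an open set is bounded by Fatou's lemma applied to the Poisson kernels, and
  outer regularity does the rest. The cutoff \<open>c\<close> keeps the resolvent functions bounded.\<close>

lemma Stieltjes_upper_bound:
  fixes M :: "real measure" and c W :: "real \<Rightarrow> real"
  defines "m \<equiv> \<lambda>x \<eta>. (LINT y|M. 1 / (complex_of_real (c y) - Complex x \<eta>))"
  assumes fin: "finite_measure M" and sets: "sets M = sets borel"
    and c [measurable]: "c \<in> borel_measurable borel" and c_eq: "\<And>x. x \<in> {-2..2} \<Longrightarrow> c x = x"
    and W [measurable]: "W \<in> borel_measurable borel" 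
    and \<rho>: "\<rho> > 0"
    and bound: "\<And>\<eta> x. 0 < \<eta> \<Longrightarrow> \<eta> < \<rho> \<Longrightarrow> x \<in> {-2<..<2} \<Longrightarrow> cmod (m x \<eta>) \<le> W x"
    and ends: "\<And>\<eta> x. 0 < \<eta> \<Longrightarrow> \<eta> < \<rho> \<Longrightarrow> x \<in> {-2, 2} \<Longrightarrow> \<eta> * cmod (m x \<eta>) \<le> C * sqrt \<eta>"
    and Wfin: "(\<integral>\<^sup>+x. ennreal (W x) * indicator {-2<..<2} x \<partial>lborel) < \<infinity>"
    and A: "A \<in> sets borel"
  shows "emeasure M (A \<inter> {-2..2}) \<le> (\<integral>\<^sup>+x. ennreal (W x) * indicator {-2<..<2} x * indicator A x \<partial>lborel)"
proof -
  interpret M: finite_measure M by (rule fin)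
  note [measurable_cong] = sets
  have space: "space M = UNIV" using sets_eq_imp_space_eq[OF sets] by simp
  interpret LM: pair_sigma_finite M lborel ..
  define k where "k = (\<lambda>\<eta> x y. \<eta> / ((c y - x)\<^sup>2 + \<eta>\<^sup>2))"
  have k0: "0 \<le> k \<eta> x y" if "0 < \<eta>" for \<eta> x y using that by (simp add: k_def)
  have kint: "(\<integral>\<^sup>+y. ennreal (k \<eta> x y) \<partial>M) \<le> ennreal (cmod (m x \<eta>))" if \<eta>: "0 < \<eta>" for \<eta> x
  proof -
    let ?r = "\<lambda>y. 1 / (complex_of_real (c y) - Complex x \<eta>)"
    have i: "integrable M ?r"
    proof (rule M.integrable_const_bound[of _ "1 / \<eta>"])
      show "AE y in M. norm (?r y) \<le> 1 / \<eta>"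
      proof (rule AE_I2)
        fix y
        have "\<eta> \<le> cmod (complex_of_real (c y) - Complex x \<eta>)"
          using abs_Im_le_cmod[of "complex_of_real (c y) - Complex x \<eta>"] \<eta> by simp
        then show "norm (?r y) \<le> 1 / \<eta>" using \<eta> by (simp add: norm_divide frac_le)
      qed
    qed measurable
    \<comment> \<open>The Poisson kernel is the imaginary part of the resolvent function, which
      brings in the bound on m.\<close>
    have kr: "k \<eta> x y = Im (?r y)" for y
      by (simp add: k_def Im_divide power2_eq_square)
    have "(\<integral>\<^sup>+y. ennreal (k \<eta> x y) \<partial>M) = ennreal (LINT y|M. k \<eta> x y)"
      unfolding kr by (intro nn_integral_eq_integral integrable_Im i AE_I2) (simp only: kr[symmetric] k0[OF \<eta>])
    also have "(LINT y|M. k \<eta> x y) = Im (m x \<eta>)"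
      unfolding kr m_def by (rule integral_Im[OF i])
    finally show ?thesis
      using abs_Im_le_cmod[of "m x \<eta>"] by (simp add: ennreal_leI)
  qed
  have open_bound: "emeasure M U \<le> (\<integral>\<^sup>+x. ennreal (W x) * indicator U x \<partial>lborel)"
    if U: "open U" "U \<subseteq> {-2<..<2}" for U
  proof -
    have [measurable]: "U \<in> sets borel" using U by simp
    \<comment> \<open>The double successor makes the first term \<rho>/2, strictly below
      \<rho>.\<close>
    define e where "e = (\<lambda>j::nat. \<rho> / real (Suc (Suc j)))"
    have e: "0 < e j" "e j < \<rho>" for j
    proof -
      have "\<rho> * 1 < \<rho> * real (Suc (Suc j))" using \<rho> by (intro mult_strict_left_mono) auto
      then show "0 < e j" "e j < \<rho>" using \<rho> by (auto simp: e_def divide_less_eq)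
    qed
    have e0: "e \<longlonglongrightarrow> 0" unfolding e_def by (intro LIMSEQ_Suc[OF LIMSEQ_Suc[OF lim_const_over_n]])
    define I where "I = (\<lambda>j y. \<integral>\<^sup>+x. ennreal (k (e j) x y) * indicator U x \<partial>lborel)"
    have Im [measurable]: "I j \<in> borel_measurable M" for j
      unfolding I_def k_def by measurable
    have Ile: "(\<integral>\<^sup>+y. I j y \<partial>M) \<le> (\<integral>\<^sup>+x. ennreal (W x) * indicator U x \<partial>lborel)" for j
    proof -
      have "(\<integral>\<^sup>+y. I j y \<partial>M) = (\<integral>\<^sup>+x. \<integral>\<^sup>+y. ennreal (k (e j) x y) * indicator U x \<partial>M \<partial>lborel)"
        unfolding I_def k_def by (rule LM.Fubini'[symmetric]) measurable
      also have "\<dots> = (\<integral>\<^sup>+x. (\<integral>\<^sup>+y. ennreal (k (e j) x y) \<partial>M) * indicator U x \<partial>lborel)"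
        unfolding k_def by (intro nn_integral_cong nn_integral_multc) measurable
      also have "\<dots> \<le> (\<integral>\<^sup>+x. ennreal (W x) * indicator U x \<partial>lborel)"
      proof (intro nn_integral_mono)
        fix x
        show "(\<integral>\<^sup>+y. ennreal (k (e j) x y) \<partial>M) * indicator U x \<le> ennreal (W x) * indicator U x"
        proof (cases "x \<in> U")
          case True
          then have "x \<in> {-2<..<2}" using U by auto
          from order_trans[OF kint[OF e(1)] ennreal_leI[OF bound[OF e this]]]
          show ?thesis using True by simp
        qed simp
      qed
      finally show ?thesis .
    qed
    have "emeasure M U = (\<integral>\<^sup>+y. indicator U y \<partial>M)" by simp
    also have "\<dots> \<le> (\<integral>\<^sup>+y. liminf (\<lambda>j. I j y) \<partial>M)"
    proof (intro nn_integral_mono)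
      fix y
      show "indicator U y \<le> liminf (\<lambda>j. I j y)"
      proof (cases "y \<in> U")
        case True
        then obtain h where h: "h > 0" "ball y h \<subseteq> U" using U open_contains_ball by blast
        have "eventually (\<lambda>j. e j < h) sequentially" using order_tendstoD(2)[OF e0 h(1)] .
        then have "eventually (\<lambda>j. 1 \<le> I j y) sequentially"
        proof eventually_elim
          case (elim j)
          have "ball y (e j) \<subseteq> U" using h(2) elim by (auto simp: subset_iff)
          moreover have "c y = y" using True U by (intro c_eq) auto
          ultimately show ?case unfolding I_def k_def by (intro Poisson_mass_ge_1 e) auto
        qed
        then have "1 \<le> liminf (\<lambda>j. I j y)" by (rule Liminf_bounded)
        then show ?thesis using True by simp
      qed simp
    qed
    also have "\<dots> \<le> liminf (\<lambda>j. \<integral>\<^sup>+y. I j y \<partial>M)" by (rule nn_integral_liminf) measurable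
    also have "\<dots> \<le> liminf (\<lambda>j::nat. \<integral>\<^sup>+x. ennreal (W x) * indicator U x \<partial>lborel)"
      by (intro Liminf_mono always_eventually allI Ile)
    also have "\<dots> = (\<integral>\<^sup>+x. ennreal (W x) * indicator U x \<partial>lborel)" by (simp add: Liminf_const)
    finally show ?thesis .
  qed
  \<comment> \<open>Open subsets of the open band say nothing about its end points. At its centre
    the Poisson kernel is 1/\<eta>, so \<eta> |m| dominates the mass of the point, and the
    hypothesis \<open>ends\<close> forces it to 0.\<close>
  have point: "emeasure M {x} = 0" if x: "x \<in> {-2, 2}" for x
  proof -
    have le: "measure M {x} \<le> C * sqrt \<eta>" if \<eta>: "0 < \<eta>" "\<eta> < \<rho>" for \<eta>
    proof -
      have cx: "c x = x" using x by (intro c_eq) auto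
      have "ennreal (1 / \<eta>) * emeasure M {x} = (\<integral>\<^sup>+y. ennreal (1 / \<eta>) * indicator {x} y \<partial>M)"
        by (subst nn_integral_cmult_indicator) (auto simp: sets)
      also have "\<dots> \<le> (\<integral>\<^sup>+y. ennreal (k \<eta> x y) \<partial>M)"
        using \<eta> by (intro nn_integral_mono) (auto simp: indicator_def k_def cx power2_eq_square)
      also have "\<dots> \<le> ennreal (cmod (m x \<eta>))" by (rule kint[OF \<eta>(1)])
      finally have "measure M {x} / \<eta> \<le> cmod (m x \<eta>)"
        using \<eta> by (simp add: M.emeasure_eq_measure ennreal_mult[symmetric] ennreal_le_iff)
      then have "measure M {x} \<le> \<eta> * cmod (m x \<eta>)" using \<eta> by (simp add: divide_le_eq mult.commute)
      then show ?thesis using ends[OF \<eta> x] by linarith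
    qed
    have "((\<lambda>\<eta>. C * sqrt \<eta>) \<longlongrightarrow> C * sqrt 0) (at_right 0)"
      by (intro tendsto_intros)
    moreover have "eventually (\<lambda>\<eta>. measure M {x} \<le> C * sqrt \<eta>) (at_right 0)"
      using eventually_at_right_less[of 0] eventually_at_right_real[OF \<rho>] by eventually_elim (auto intro: le)
    ultimately have "measure M {x} \<le> C * sqrt 0"
      by (intro tendsto_lowerbound[of _ _ "at_right 0"]) auto
    then show ?thesis using measure_nonneg[of M "{x}"] by (simp add: M.emeasure_eq_measure)
  qed
  let ?N = "density lborel (\<lambda>x. ennreal (W x) * indicator {-2<..<2} x)"
  have N: "emeasure ?N B = (\<integral>\<^sup>+x. ennreal (W x) * indicator {-2<..<2} x * indicator B x \<partial>lborel)" if "B \<in> sets borel" for B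
    using that by (intro emeasure_density) auto
  have "emeasure M (A \<inter> {-2<..<2}) \<le> emeasure ?N A"
  proof -
    \<comment> \<open>Finiteness of the dominating measure gives access to outer regularity.\<close>
    have "emeasure ?N (space ?N) \<noteq> \<infinity>" using N[of UNIV] Wfin by simp
    then have "emeasure ?N A = (INF U\<in>{U. A \<subseteq> U \<and> open U}. emeasure ?N U)"
      by (intro outer_regular) (use A in auto)
    moreover have "emeasure M (A \<inter> {-2<..<2}) \<le> (INF U\<in>{U. A \<subseteq> U \<and> open U}. emeasure ?N U)"
    proof (intro INF_greatest)
      fix U assume "U \<in> {U. A \<subseteq> U \<and> open U}"
      then have U: "A \<subseteq> U" "open U" by auto
      have "emeasure M (A \<inter> {-2<..<2}) \<le> emeasure M (U \<inter> {-2<..<2})"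
        using U by (intro emeasure_mono) (auto simp: sets)
      also have "\<dots> \<le> (\<integral>\<^sup>+x. ennreal (W x) * indicator (U \<inter> {-2<..<2}) x \<partial>lborel)"
        using U by (intro open_bound) auto
      also have "\<dots> = emeasure ?N U"
        using U by (subst N) (auto simp: indicator_inter_arith mult_ac)
      finally show "emeasure M (A \<inter> {-2<..<2}) \<le> emeasure ?N U" .
    qed
    ultimately show ?thesis by simp
  qed
  moreover have "emeasure M (A \<inter> {-2..2}) \<le> emeasure M (A \<inter> {-2<..<2}) + (emeasure M {-2} + emeasure M {2})"
  proof -
    have "emeasure M (A \<inter> {-2..2}) \<le> emeasure M ((A \<inter> {-2<..<2}) \<union> ({-2} \<union> {2}))"
      using A by (intro emeasure_mono) (auto simp: sets)
    also have "\<dots> \<le> emeasure M (A \<inter> {-2<..<2}) + emeasure M ({-2} \<union> {2})"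
      using A by (intro emeasure_subadditive) (auto simp: sets)
    also have "\<dots> \<le> emeasure M (A \<inter> {-2<..<2}) + (emeasure M {-2} + emeasure M {2})"
      by (intro add_left_mono emeasure_subadditive) (auto simp: sets)
    finally show ?thesis .
  qed
  ultimately show ?thesis unfolding N[OF A] using point by simp
qed

section \<open>Interval masses and return probabilities of the singular density\<close>

lemma nn_integral_inverse_sqrt:
  assumes "0 \<le> p"
  shows "(\<integral>\<^sup>+x. ennreal (1 / sqrt \<bar>2 + x\<bar>) * indicator {-2..-2+p} x \<partial>lborel) = ennreal (2 * sqrt p)"
proof -
  have "((\<lambda>x. 1 / sqrt \<bar>2 + x\<bar>) has_integral (2 * sqrt (2 + (-2 + p)) - 2 * sqrt (2 + (-2)))) {-2..-2+p}"
  proof (rule fundamental_theorem_of_calculus_interior)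
    fix x assume "x \<in> {-2<..<-2+p}"
    then have x: "2 + x > 0" by auto
    have "((\<lambda>x. 2 * sqrt (2 + x)) has_real_derivative 1 / sqrt \<bar>2 + x\<bar>) (at x)"
      using x by (auto intro!: derivative_eq_intros simp: field_simps)
    then show "((\<lambda>x. 2 * sqrt (2 + x)) has_vector_derivative 1 / sqrt \<bar>2 + x\<bar>) (at x)"
      by (simp add: has_real_derivative_iff_has_vector_derivative)
  qed (use assms in \<open>auto intro!: continuous_intros\<close>)
  then have "((\<lambda>x. 1 / sqrt \<bar>2 + x\<bar>) has_integral 2 * sqrt p) {-2..-2+p}" by simp
  from nn_integral_has_integral_lebesgue'[OF _ this] show ?thesis by simp
qed

text \<open>The split is at distance h from the singularity: the near part contributes at most 2
  sqrt h, and farther away the density is at most 1/sqrt h on a set of measure h.\<close>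

lemma sqrt_density_mass_le:
  assumes I: "I \<in> sets borel" and h: "emeasure lborel I = ennreal h" "h > 0"
  shows "(\<integral>\<^sup>+x. ennreal (1 / sqrt \<bar>2 + x\<bar>) * indicator {-2<..<2} x * indicator I x \<partial>lborel) \<le> ennreal (3 * sqrt h)"
proof -
  have "(\<integral>\<^sup>+x. ennreal (1 / sqrt \<bar>2 + x\<bar>) * indicator {-2<..<2} x * indicator I x \<partial>lborel)
    \<le> (\<integral>\<^sup>+x. ennreal (1 / sqrt \<bar>2 + x\<bar>) * indicator {-2..-2+h} x + ennreal (1 / sqrt h) * indicator I x \<partial>lborel)"
  proof (intro nn_integral_mono)
    fix x
    show "ennreal (1 / sqrt \<bar>2 + x\<bar>) * indicator {-2<..<2} x * indicator I x
        \<le> ennreal (1 / sqrt \<bar>2 + x\<bar>) * indicator {-2..-2+h} x + ennreal (1 / sqrt h) * indicator I x"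
    proof (cases "x \<in> {-2..-2+h}")
      case True
      then show ?thesis by (auto simp: indicator_def)
    next
      case False
      show ?thesis
      proof (cases "x \<in> {-2<..<2} \<and> x \<in> I")
        case True
        then have "h \<le> \<bar>2 + x\<bar>" using False by auto
        then have "1 / sqrt \<bar>2 + x\<bar> \<le> 1 / sqrt h" using h by (intro frac_le) auto
        then show ?thesis using True False by (auto simp: indicator_def intro: ennreal_leI)
      qed (auto simp: indicator_def)
    qed
  qed
  also have "\<dots> = ennreal (2 * sqrt h) + ennreal (1 / sqrt h) * ennreal h"
    using nn_integral_inverse_sqrt[of h] h I by (subst nn_integral_add) (auto simp: nn_integral_cmult_indicator)
  also have "\<dots> = ennreal (2 * sqrt h + 1 / sqrt h * h)"
    using h by (simp add: ennreal_mult[symmetric] ennreal_plus[symmetric] del: ennreal_plus)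
  also have "1 / sqrt h * h = sqrt h" using h by (simp add: real_div_sqrt)
  finally show ?thesis by simp
qed

lemma holder_continuous_measureI:
  assumes C: "C > 0" and le: "\<And>I h. I \<in> sets borel \<Longrightarrow> 0 < h \<Longrightarrow> emeasure lborel I = ennreal h \<Longrightarrow> emeasure \<mu> I \<le> ennreal (C * h powr \<alpha>)"
  shows "holder_continuous_measure \<alpha> \<mu>"
  unfolding holder_continuous_measure_def
\<comment> \<open>Doubling C turns the weak inequality into the strict one of the
  definition.\<close>
proof (intro exI[of _ "2 * C"] conjI allI impI)
  fix I :: "real set" assume I: "is_interval I \<and> 0 < emeasure lborel I \<and> emeasure lborel I < 1"
  \<comment> \<open>A set outside the Borel algebra has \<open>emeasure\<close> 0 by convention,
    against the positivity assumed of I.\<close>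
  have Ib: "I \<in> sets borel"
    using I emeasure_notin_sets[of I lborel] by (cases "I \<in> sets borel") auto
  define h where "h = measure lborel I"
  have eh: "emeasure lborel I = ennreal h"
    using I unfolding h_def by (intro emeasure_eq_ennreal_measure) auto
  then have h: "h > 0" using I by (simp add: ennreal_less_zero_iff)
  have "emeasure \<mu> I \<le> ennreal (C * h powr \<alpha>)" by (rule le[OF Ib h eh])
  also have "\<dots> < ennreal (2 * C * h powr \<alpha>)"
    using C h by (intro ennreal_lessI) auto
  finally show "emeasure \<mu> I < ennreal (2 * C * measure lborel I powr \<alpha>)" by (simp add: h_def)
qed (use C in auto)

lemma fourier_L2_le:
  fixes \<nu> :: "real measure"
  assumes sets: "sets \<nu> = sets borel" and fin: "finite_measure \<nu>" and \<omega>: "\<omega> \<in> borel_measurable borel"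
    and le: "\<And>A. A \<in> sets borel \<Longrightarrow> emeasure \<nu> A \<le> (\<integral>\<^sup>+x. ennreal (\<omega> x) * indicator A x \<partial>lborel)"
    and \<omega>0: "\<And>x. 0 \<le> \<omega> x" "\<And>x. x \<notin> {-2<..<2} \<Longrightarrow> \<omega> x = 0"
    and L: "(\<integral>\<^sup>+x. ennreal ((\<omega> x)\<^sup>2) \<partial>lborel) \<le> ennreal L" "0 \<le> L" and t: "t > 0"
  shows "integral {0..t} (\<lambda>s. (cmod (LINT x|\<nu>. exp (- \<i> * of_real s * of_real x)))\<^sup>2) \<le> 4 * pi * L"
proof -
  note fourier_square_le(2)[OF sets fin t]
  also have "2 * (\<integral>\<^sup>+x. \<integral>\<^sup>+y. ennreal (2 * t / (1 + (t * (x - y))\<^sup>2)) \<partial>\<nu> \<partial>\<nu>) \<le> 2 * (ennreal (2 * pi) * ennreal L)"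
    by (intro mult_left_mono order_trans[OF Schur_Poisson_kernel[OF sets \<omega> le \<omega>0 t fin]] L) auto
  also have "\<dots> = ennreal (2 * (2 * pi * L))"
    using L by (simp only: ennreal_mult[OF zero_le_numeral mult_nonneg_nonneg] ennreal_mult ennreal_numeral pi_ge_zero mult_nonneg_nonneg zero_le_numeral)
  finally show ?thesis using L by (subst (asm) ennreal_le_iff) auto
qed

text \<open>The cut at 2 + x = 1/t balances two costs. The near part has mass O(t^(-1/2)), so its
  squared Fourier transform is O(1/t) and contributes O(1) over \<open>{0..t}\<close>; the far part
  has a square-integrable density with squared norm O(log t), to which the Schur bound
  applies.\<close>

lemma return_bound_sqrt_density:
  fixes \<nu> :: "real measure"
  assumes sets: "sets \<nu> = sets borel" and fin: "finite_measure \<nu>" and c: "0 \<le> c"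
    and le: "\<And>A. A \<in> sets borel \<Longrightarrow>
      emeasure \<nu> A \<le> (\<integral>\<^sup>+x. ennreal (c / sqrt \<bar>2 + x\<bar> * indicator {-2<..<2} x) * indicator A x \<partial>lborel)"
    and t: "t > 2"
  shows "integral {0..t} (\<lambda>s. (cmod (LINT x|\<nu>. exp (- \<i> * of_real s * of_real x)))\<^sup>2) \<le> (16 * c\<^sup>2 + 24 * pi * c\<^sup>2) * ln t"
proof -
  interpret \<nu>: finite_measure \<nu> by (rule fin)
  note [measurable_cong] = sets
  define \<omega> where "\<omega> = (\<lambda>x. c / sqrt \<bar>2 + x\<bar> * indicator {-2<..<2} x)"
  have [measurable]: "\<omega> \<in> borel_measurable borel" unfolding \<omega>_def by measurable
  have \<omega>0: "0 \<le> \<omega> x" for x using c by (simp add: \<omega>_def)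
  define A1 where "A1 = {x::real. 2 + x < 1 / t}"
  define A2 where "A2 = {x::real. 1 / t \<le> 2 + x}"
  have [measurable]: "A1 \<in> sets borel" "A2 \<in> sets borel" unfolding A1_def A2_def by measurable
  define \<nu>2 where "\<nu>2 = density \<nu> (indicator A2)"
  have sets2: "sets \<nu>2 = sets borel" by (simp add: \<nu>2_def sets)
  have em2: "emeasure \<nu>2 A = emeasure \<nu> (A \<inter> A2)" if [measurable]: "A \<in> sets borel" for A
    unfolding \<nu>2_def by (subst emeasure_density) (auto simp: sets indicator_inter_arith[symmetric] Int_commute)
  have fin2: "finite_measure \<nu>2"
    by (rule finite_measureI) (use em2[of UNIV] sets_eq_imp_space_eq[OF sets2] in simp)
  define \<omega>2 where "\<omega>2 = (\<lambda>x. \<omega> x * indicator A2 x)"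
  define e where "e = (\<lambda>s x. exp (- \<i> * of_real s * complex_of_real x))"
  have em [measurable]: "e s \<in> borel_measurable borel" for s unfolding e_def by measurable
  have en: "cmod (e s x) = 1" for s x by (simp add: e_def norm_exp_eq_Re)
  define q where "q = (\<lambda>s. (cmod (LINT x|\<nu>. e s x))\<^sup>2)"
  define q2 where "q2 = (\<lambda>s. (cmod (LINT x|\<nu>2. e s x))\<^sup>2)"
  have I2: "integral {0..t} q2 \<le> 4 * pi * (3 * c\<^sup>2 * ln t)"
    unfolding q2_def e_def
  proof (rule fourier_L2_le[OF sets2 fin2])
    show "\<omega>2 \<in> borel_measurable borel" unfolding \<omega>2_def by measurable
    fix A :: "real set" assume [measurable]: "A \<in> sets borel"
    have "emeasure \<nu>2 A \<le> (\<integral>\<^sup>+x. ennreal (\<omega> x) * indicator (A \<inter> A2) x \<partial>lborel)"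
      unfolding em2[OF \<open>A \<in> sets borel\<close>] \<omega>_def by (rule le) measurable
    also have "\<dots> = (\<integral>\<^sup>+x. ennreal (\<omega>2 x) * indicator A x \<partial>lborel)"
      by (intro nn_integral_cong) (auto simp: \<omega>2_def indicator_def)
    finally show "emeasure \<nu>2 A \<le> (\<integral>\<^sup>+x. ennreal (\<omega>2 x) * indicator A x \<partial>lborel)" .
  next
    have lt: "0 \<le> ln t" using t by simp
    then show "0 \<le> 3 * c\<^sup>2 * ln t" by simp
    have "(\<integral>\<^sup>+x. ennreal ((\<omega>2 x)\<^sup>2) \<partial>lborel) \<le> (\<integral>\<^sup>+x. ennreal (c\<^sup>2 / (2 + x)) * indicator {-2 + 1 / t..2} x \<partial>lborel)"
    proof (intro nn_integral_mono)
      fix x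
      show "ennreal ((\<omega>2 x)\<^sup>2) \<le> ennreal (c\<^sup>2 / (2 + x)) * indicator {-2 + 1 / t..2} x"
      proof (cases "x \<in> {-2<..<2} \<and> x \<in> A2")
        case True
        then show ?thesis by (auto simp: \<omega>2_def \<omega>_def A2_def power_divide)
      qed (auto simp: \<omega>2_def \<omega>_def)
    qed
    also have "\<dots> = ennreal (c\<^sup>2 * ln (2 + 2) - c\<^sup>2 * ln (2 + (-2 + 1 / t)))"
    proof (rule nn_integral_FTC_Icc[where F="\<lambda>x. c\<^sup>2 * ln (2 + x)"])
      fix x assume "x \<in> {-2 + 1 / t..2}"
      then have "-2 + 1 / t \<le> x" by simp
      moreover have "0 < 1 / t" using t by simp
      ultimately have x: "0 < 2 + x" by linarith
      then show "((\<lambda>x. c\<^sup>2 * ln (2 + x)) has_real_derivative c\<^sup>2 / (2 + x)) (at x)"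
        by (auto intro!: derivative_eq_intros)
      show "0 \<le> c\<^sup>2 / (2 + x)" using x by simp
    next
      have "1 / t \<le> 1" using t by simp
      then show "-2 + 1 / t \<le> 2" by linarith
    qed measurable
    also have "\<dots> \<le> ennreal (3 * c\<^sup>2 * ln t)"
    proof (rule ennreal_leI)
      \<comment> \<open>The integral above equals c^2 (ln 4 + ln t), and t > 2 gives ln 4 <= 2 ln
        t.\<close>
      have "ln 4 = 2 * ln (2::real)" using ln_realpow[of 2 2] by simp
      also have "\<dots> \<le> 2 * ln t" using t by simp
      finally have "ln 4 + ln t \<le> 3 * ln t" by simp
      from mult_left_mono[OF this, of "c\<^sup>2"]
      show "c\<^sup>2 * ln (2 + 2) - c\<^sup>2 * ln (2 + (-2 + 1 / t)) \<le> 3 * c\<^sup>2 * ln t"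
        using t by (simp add: ln_div algebra_simps)
    qed
    finally show "(\<integral>\<^sup>+x. ennreal ((\<omega>2 x)\<^sup>2) \<partial>lborel) \<le> ennreal (3 * c\<^sup>2 * ln t)" .
    show "0 \<le> \<omega>2 x" for x unfolding \<omega>2_def by (intro mult_nonneg_nonneg \<omega>0) auto
  qed (use t in \<open>auto simp: \<omega>2_def \<omega>_def\<close>)
  have m1: "measure \<nu> A1 \<le> 2 * c / sqrt t"
  proof -
    have "emeasure \<nu> A1 \<le> (\<integral>\<^sup>+x. ennreal (\<omega> x) * indicator A1 x \<partial>lborel)"
      unfolding \<omega>_def by (rule le) measurable
    also have "\<dots> \<le> (\<integral>\<^sup>+x. ennreal c * (ennreal (1 / sqrt \<bar>2 + x\<bar>) * indicator {-2..-2 + 1 / t} x) \<partial>lborel)"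
      using c by (intro nn_integral_mono) (auto simp: \<omega>_def A1_def indicator_def ennreal_mult[symmetric])
    also have "\<dots> = ennreal c * ennreal (2 * sqrt (1 / t))"
    proof -
      have "0 \<le> 1 / t" using t by simp
      then show ?thesis by (subst nn_integral_cmult) (measurable, simp only: nn_integral_inverse_sqrt)
    qed
    also have "\<dots> = ennreal (2 * c / sqrt t)"
      using c t by (simp add: ennreal_mult[symmetric] real_sqrt_divide mult.commute)
    finally show ?thesis using c t by (simp add: \<nu>.emeasure_eq_measure ennreal_le_iff)
  qed
  have q_le: "q s \<le> 8 * c\<^sup>2 / t + 2 * q2 s" for s
  proof -
    have ind: "complex_of_real (indicator A1 x) + complex_of_real (indicator A2 x) = 1" for x
      by (auto simp: indicator_def A1_def A2_def)
    have i: "integrable \<nu> (\<lambda>x. complex_of_real (indicator B x) * e s x)" if [measurable]: "B \<in> sets borel" for B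
      by (rule \<nu>.integrable_const_bound[of _ 1]) (auto simp: norm_mult en indicator_def)
    have "(LINT x|\<nu>. e s x) = (LINT x|\<nu>. complex_of_real (indicator A1 x) * e s x + complex_of_real (indicator A2 x) * e s x)"
      unfolding distrib_right[symmetric] ind by simp
    also have "\<dots> = (LINT x|\<nu>. complex_of_real (indicator A1 x) * e s x) + (LINT x|\<nu>. complex_of_real (indicator A2 x) * e s x)"
      by (intro Bochner_Integration.integral_add i) auto
    also have "(LINT x|\<nu>. complex_of_real (indicator A2 x) * e s x) = (LINT x|\<nu>2. e s x)"
    proof -
      have "\<nu>2 = density \<nu> (\<lambda>x. ennreal (indicator A2 x))" unfolding \<nu>2_def by (simp add: ennreal_indicator)
      then show ?thesis by (simp add: integral_density scaleR_conv_of_real)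
    qed
    finally have split: "(LINT x|\<nu>. e s x) = (LINT x|\<nu>. complex_of_real (indicator A1 x) * e s x) + (LINT x|\<nu>2. e s x)" .
    have "cmod (LINT x|\<nu>. complex_of_real (indicator A1 x) * e s x) \<le> (LINT x|\<nu>. cmod (complex_of_real (indicator A1 x) * e s x))"
      by (rule integral_norm_bound)
    also have "\<dots> = (LINT x|\<nu>. indicator A1 x)" by (simp add: norm_mult en)
    also have "\<dots> = measure \<nu> A1" using sets_eq_imp_space_eq[OF sets] by (simp add: sets)
    finally have b1: "cmod (LINT x|\<nu>. complex_of_real (indicator A1 x) * e s x) \<le> 2 * c / sqrt t" using m1 by linarith
    have sq: "(cmod (a + b))\<^sup>2 \<le> 2 * (cmod a)\<^sup>2 + 2 * (cmod b)\<^sup>2" for a b :: complex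
    proof -
      have "(cmod (a + b))\<^sup>2 \<le> (cmod a + cmod b)\<^sup>2" by (intro power_mono norm_triangle_ineq) auto
      also have "\<dots> \<le> 2 * (cmod a)\<^sup>2 + 2 * (cmod b)\<^sup>2"
        using sum_squares_bound[of "cmod a" "cmod b"] by (simp add: power2_sum)
      finally show ?thesis .
    qed
    have "q s \<le> 2 * (cmod (LINT x|\<nu>. complex_of_real (indicator A1 x) * e s x))\<^sup>2 + 2 * q2 s"
      unfolding q_def split q2_def by (rule sq)
    also have "\<dots> \<le> 2 * (2 * c / sqrt t)\<^sup>2 + 2 * q2 s"
      by (intro add_right_mono mult_left_mono power_mono b1) auto
    also have "(2 * c / sqrt t)\<^sup>2 = 4 * c\<^sup>2 / t" using t by (simp add: power_divide power_mult_distrib)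
    finally show ?thesis by simp
  qed
  have iq: "q integrable_on {0..t}" "q2 integrable_on {0..t}"
    unfolding q_def q2_def e_def using t by (intro fourier_square_le(1) sets fin sets2 fin2; simp)+
  have i2: "(\<lambda>s. 2 * q2 s) integrable_on {0..t}" using integrable_cmul[OF iq(2), of 2] by simp
  have "integral {0..t} q \<le> integral {0..t} (\<lambda>s. 8 * c\<^sup>2 / t + 2 * q2 s)"
    by (intro integral_le iq integrable_add integrable_const_ivl q_le i2)
  also have "\<dots> = integral {0..t} (\<lambda>s. 8 * c\<^sup>2 / t) + integral {0..t} (\<lambda>s. 2 * q2 s)"
    by (intro Henstock_Kurzweil_Integration.integral_add i2 integrable_const_ivl)
  also have "\<dots> = 8 * c\<^sup>2 + 2 * integral {0..t} q2" using t by simp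
  also have "\<dots> \<le> 8 * c\<^sup>2 * (2 * ln t) + 2 * (4 * pi * (3 * c\<^sup>2 * ln t))"
  proof (intro add_mono mult_left_mono I2)
    \<comment> \<open>For t > 2 the logarithm exceeds 1/2, which absorbs the constant contribution
      of the near part.\<close>
    have "1 / 2 \<le> ln (2::real)" using ln2_ge_two_thirds by simp
    also have "\<dots> \<le> ln t" using t by simp
    finally have "8 * c\<^sup>2 * 1 \<le> 8 * c\<^sup>2 * (2 * ln t)" by (intro mult_left_mono) auto
    then show "8 * c\<^sup>2 \<le> 8 * c\<^sup>2 * (2 * ln t)" by simp
  qed simp
  finally show ?thesis unfolding q_def e_def by (simp add: algebra_simps)
qed

section \<open>Jost solutions\<close>

text \<open>The free Volterra kernel z (1 - z^(2 m)) / (1 - z^2), written as a sum so that z = 1 and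
  z = -1 need no limit. The type is left general so that z = -1 can also be taken over the reals,
  where the Jost solution is visibly real.\<close>

definition odd_power_sum :: "'a \<Rightarrow> nat \<Rightarrow> 'a :: {real_normed_field, banach}" where
  "odd_power_sum z m = (\<Sum>i<m. z ^ (2 * i + 1))"

lemma odd_power_sum_0 [simp]: "odd_power_sum z 0 = 0"
  by (simp add: odd_power_sum_def)

lemma odd_power_sum_1 [simp]: "odd_power_sum z (Suc 0) = z"
  by (simp add: odd_power_sum_def)

lemma odd_power_sum_rec: "odd_power_sum z (Suc (Suc m)) - (1 + z\<^sup>2) * odd_power_sum z (Suc m) + z\<^sup>2 * odd_power_sum z m = 0"
proof -
  have s: "odd_power_sum z (Suc m) = z + z\<^sup>2 * odd_power_sum z m" for m
    unfolding odd_power_sum_def by (subst sum.lessThan_Suc_shift) (simp add: sum_distrib_left power2_eq_square mult_ac)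
  show ?thesis using s[of "Suc m"] s[of m] by (simp add: algebra_simps)
qed

lemma norm_odd_power_sum_le: 
  assumes "norm z \<le> 1" shows "norm (odd_power_sum z m) \<le> real m"
proof -
  have "norm (odd_power_sum z m) \<le> (\<Sum>i<m. norm (z ^ (2 * i + 1)))" unfolding odd_power_sum_def by (rule norm_sum)
  also have "\<dots> \<le> (\<Sum>i<m. 1)" using assms unfolding norm_power by (intro sum_mono power_le_one) auto
  finally show ?thesis by simp
qed

text \<open>The exponents 1, 3, 5, ... act as Lipschitz constants and add up to m^2; this is the
  source of the weight n^2 on the potential.\<close>

lemma norm_odd_power_sum_diff_le:
  assumes "norm z \<le> 1" "norm w \<le> 1" shows "norm (odd_power_sum z m - odd_power_sum w m) \<le> (real m)\<^sup>2 * norm (z - w)"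
proof -
  have "norm (odd_power_sum z m - odd_power_sum w m) \<le> (\<Sum>i<m. norm (z ^ (2 * i + 1) - w ^ (2 * i + 1)))"
    unfolding odd_power_sum_def sum_subtractf[symmetric] by (rule norm_sum)
  also have "\<dots> \<le> (\<Sum>i<m. real (2 * i + 1) * norm (z - w))"
    by (intro sum_mono norm_power_diff assms)
  also have "\<dots> = (\<Sum>i<m. real (2 * i + 1)) * norm (z - w)" by (simp only: sum_distrib_right)
  also have "(\<Sum>i<m. real (2 * i + 1)) = (real m)\<^sup>2"
    by (induction m) (auto simp: power2_eq_square algebra_simps)
  finally show ?thesis .
qed

text \<open>The supremum K satisfies K <= a + S K, so K <= 2 a because S <= 1/2; the a priori bound
  C only makes the supremum finite.\<close>

lemma contraction_bound:
  fixes f :: "nat \<Rightarrow> real"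
  assumes "\<And>n. f n \<le> C" and step: "\<And>n K. (\<And>k. f k \<le> K) \<Longrightarrow> f n \<le> a + S * K" and "S \<le> 1 / 2" "0 \<le> a" 
  shows "f n \<le> 2 * a"
proof -
  define K where "K = (SUP k. f k)"
  have K: "f k \<le> K" for k unfolding K_def using assms(1) by (intro cSUP_upper bdd_aboveI2[where M=C]) auto
  have "K \<le> a + S * K" unfolding K_def by (rule cSUP_least) (use step[OF K] in \<open>auto simp: K_def\<close>)
  then have "K * (1 - S) \<le> a" by (simp add: algebra_simps)
  then have "K \<le> 2 * a"
  proof (cases "K \<le> 0")
    case False
    then have "K * (1 / 2) \<le> K * (1 - S)" using assms(3) by (intro mult_left_mono) auto
    then show ?thesis using \<open>K * (1 - S) \<le> a\<close> by simp
  qed (use assms(4) in simp)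
  then show ?thesis using K[of n] by linarith
qed

text \<open>The weight n^2 makes Jost solutions Lipschitz in z up to the unit circle. The value
  1/100 is fixed by \<open>cmod_jost_sum_ge\<close>, where errors 4 S and 10 S |1 + z| have to leave
  half of |1 + z|.\<close>

locale small_potential =
  fixes V :: "nat \<Rightarrow> real" and S :: real
  assumes sumV: "summable (\<lambda>n. (real n)\<^sup>2 * \<bar>V n\<bar>)" and SV: "(\<Sum>n. (real n)\<^sup>2 * \<bar>V n\<bar>) \<le> S" and S_le: "S \<le> 1 / 100"
begin

lemma S_nonneg: "0 \<le> S"
  using suminf_nonneg[OF sumV] SV by simp

text \<open>Stated for any kernel growing at most like k^2, so that it covers the Volterra kernel as
  well as the difference of two such kernels.\<close>

lemma kernel_bound:
  fixes d :: "nat \<Rightarrow> 'a :: {real_normed_field, banach}"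
  assumes d: "\<And>k. norm (d k) \<le> (real k)\<^sup>2 * L" and g: "\<And>k. norm (g k) \<le> G"
  shows "summable (\<lambda>k. d k * of_real (V k) * g k)" "norm (\<Sum>k. d k * of_real (V k) * g k) \<le> S * (L * G)"
proof -
  have G0: "0 \<le> G" using g[of 0] norm_ge_zero order_trans by blast
  have L0: "0 \<le> L" using order_trans[OF norm_ge_zero d[of 1]] by simp
  have le: "norm (d k * of_real (V k) * g k) \<le> ((real k)\<^sup>2 * \<bar>V k\<bar>) * (L * G)" for k
  proof -
    have "norm (d k * of_real (V k) * g k) \<le> ((real k)\<^sup>2 * L * \<bar>V k\<bar>) * G"
      unfolding norm_mult norm_of_real using L0 by (intro mult_mono d g) auto
    then show ?thesis by (simp add: mult_ac)
  qed
  have s: "summable (\<lambda>k. ((real k)\<^sup>2 * \<bar>V k\<bar>) * (L * G))" by (rule summable_mult2[OF sumV])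
  have sn: "summable (\<lambda>k. norm (d k * of_real (V k) * g k))"
    by (rule summable_comparison_test'[OF s, of 0]) (use le in simp)
  then show "summable (\<lambda>k. d k * of_real (V k) * g k)" by (rule summable_norm_cancel)
  have "norm (\<Sum>k. d k * of_real (V k) * g k) \<le> (\<Sum>k. norm (d k * of_real (V k) * g k))" by (rule summable_norm[OF sn])
  also have "\<dots> \<le> (\<Sum>k. ((real k)\<^sup>2 * \<bar>V k\<bar>) * (L * G))" by (intro suminf_le le sn s)
  also have "\<dots> = (\<Sum>k. (real k)\<^sup>2 * \<bar>V k\<bar>) * (L * G)" by (rule suminf_mult2[OF sumV, symmetric])
  also have "\<dots> \<le> S * (L * G)" using SV L0 G0 by (intro mult_right_mono mult_nonneg_nonneg)
  finally show "norm (\<Sum>k. d k * of_real (V k) * g k) \<le> S * (L * G)" .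
qed

lemma nat_le_square: "real (k - n) \<le> (real k)\<^sup>2"
proof -
  have "real (k - n) \<le> real k" by simp
  also have "real k \<le> real (k ^ 2)" by (simp only: of_nat_le_iff) (simp add: power2_eq_square)
  finally show ?thesis by simp
qed

lemma odd_power_sum_le: "norm z \<le> 1 \<Longrightarrow> norm (odd_power_sum z (k - n)) \<le> (real k)\<^sup>2 * 1"
  using order_trans[OF norm_odd_power_sum_le nat_le_square] by simp

lemma Volterra_bound:
  assumes z: "norm z \<le> 1" and g: "\<And>k. norm (g k) \<le> G"
  shows "summable (\<lambda>k. odd_power_sum z (k - n) * of_real (V k) * g k)" "norm (\<Sum>k. odd_power_sum z (k - n) * of_real (V k) * g k) \<le> S * G"
proof -
  note d = odd_power_sum_le[OF z]
  show "summable (\<lambda>k. odd_power_sum z (k - n) * of_real (V k) * g k)" by (rule kernel_bound(1)[OF d g])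
  have "norm (\<Sum>k. odd_power_sum z (k - n) * of_real (V k) * g k) \<le> S * (1 * G)" by (rule kernel_bound(2)[OF d g])
  then show "norm (\<Sum>k. odd_power_sum z (k - n) * of_real (V k) * g k) \<le> S * G" by simp
qed

text \<open>The Volterra equation for \<open>g\<^sub>n = z\<^sup>-\<^sup>n f\<^sub>n\<close>, where \<open>f\<close> is the Jost solution
  of \<open>f\<^sub>n\<^sub>+\<^sub>1 + f\<^sub>n\<^sub>-\<^sub>1 + V\<^sub>n f\<^sub>n = (z + 1/z) f\<^sub>n\<close> with \<open>f\<^sub>n\<close> asymptotic to \<open>z\<^sup>n\<close>. The differences
  \<open>k - n\<close> are truncated, so that only \<open>k > n\<close> contributes.\<close>

definition jost :: "'a \<Rightarrow> (nat \<Rightarrow> 'a :: {real_normed_field, banach}) \<Rightarrow> bool" where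
  "jost z g \<longleftrightarrow> (\<exists>C. \<forall>n. norm (g n) \<le> C) \<and> (\<forall>n. g n = 1 - (\<Sum>k. odd_power_sum z (k - n) * of_real (V k) * g k))"

text \<open>Banach's fixed point theorem on bounded sequences, modelled as bounded continuous
  functions on \<open>nat discrete\<close>, whose topology makes every sequence continuous. The
  contraction constant S is uniform over the closed unit disc.\<close>

lemma jost_exists:
  fixes z :: "'a :: {real_normed_field, banach}"
  assumes z: "norm z \<le> 1" shows "\<exists>g. jost z g"
proof -
  define K where "K = (\<lambda>(g :: nat \<Rightarrow> 'a) n. 1 - (\<Sum>k. odd_power_sum z (k - n) * of_real (V k) * g k))"
  have Kbd: "norm (K g n) \<le> 1 + S * G" if "\<And>k. norm (g k) \<le> G" for g G n
    unfolding K_def using Volterra_bound(2)[OF z that, of n] by (intro order_trans[OF norm_triangle_ineq4]) simp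
  define ev where "ev = (\<lambda>(g :: nat discrete \<Rightarrow>\<^sub>C 'a) k. apply_bcontfun g (discrete k))"
  define T where "T = (\<lambda>g :: nat discrete \<Rightarrow>\<^sub>C 'a. Bcontfun (\<lambda>d. K (ev g) (of_discrete d)))"
  have nb: "norm (ev g n) \<le> norm g" for g n unfolding ev_def by (rule norm_bounded)
  have T: "apply_bcontfun (T g) d = K (ev g) (of_discrete d)" for g d
  proof -
    have "norm (K (ev g) n) \<le> 1 + S * norm g" for n
      by (rule Kbd) (rule nb)
    then have "(\<lambda>d. K (ev g) (of_discrete d)) \<in> bcontfun"
      unfolding bcontfun_def bounded_iff by (auto simp: continuous_on_open_vimage open_discrete)
    then show ?thesis unfolding T_def by (simp add: Bcontfun_inverse)
  qed
  have "\<exists>!g. T g = g"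
  proof (rule banach_fix_type[of S])
    show "0 \<le> S" by (rule S_nonneg)
    show "S < 1" using S_le by simp
    show "\<forall>g h. dist (T g) (T h) \<le> S * dist g h"
    proof (intro allI dist_bound)
      fix g h and d :: "nat discrete"
      let ?n = "of_discrete d"
      have d: "norm (ev h k - ev g k) \<le> dist g h" for k
        using dist_bounded[of g "discrete k" h] by (simp add: ev_def dist_norm norm_minus_commute)
      have s: "summable (\<lambda>k. odd_power_sum z (k - ?n) * of_real (V k) * ev g k)" "summable (\<lambda>k. odd_power_sum z (k - ?n) * of_real (V k) * ev h k)"
        by (rule Volterra_bound(1)[OF z nb])+
      have "K (ev g) ?n - K (ev h) ?n = (\<Sum>k. odd_power_sum z (k - ?n) * of_real (V k) * (ev h k - ev g k))"
        unfolding K_def right_diff_distrib by (simp add: suminf_diff[OF s(2) s(1)])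
      also have "norm \<dots> \<le> S * dist g h"
        by (rule Volterra_bound(2)[OF z]) (rule d)
      finally show "dist (apply_bcontfun (T g) d) (apply_bcontfun (T h) d) \<le> S * dist g h"
        unfolding T dist_norm[of "K (ev g) ?n"] .
    qed
  qed
  then obtain g where g: "T g = g" by blast
  have "jost z (ev g)"
    unfolding jost_def
  proof (intro conjI allI)
    show "\<exists>C. \<forall>n. norm (ev g n) \<le> C" using nb[of g] by blast
    fix n
    have "ev g n = K (ev g) n" using T[of g "discrete n"] by (simp add: g discrete_inverse) (simp add: ev_def)
    then show "ev g n = 1 - (\<Sum>k. odd_power_sum z (k - n) * of_real (V k) * ev g k)" by (simp add: K_def)
  qed
  then show ?thesis by blast
qed

lemma jostD:
  assumes "jost z g"
  shows "\<exists>C. \<forall>n. norm (g n) \<le> C" "\<And>n. g n = 1 - (\<Sum>k. odd_power_sum z (k - n) * of_real (V k) * g k)"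
  using assms unfolding jost_def by blast+

lemma jost_bound:
  assumes g: "jost z g" and z: "norm z \<le> 1"
  shows "norm (g n) \<le> 2"
proof -
  obtain C where C: "\<And>n. norm (g n) \<le> C" using jostD(1)[OF g] by blast
  have "norm (g n) \<le> 2 * 1"
  proof (rule contraction_bound[OF C])
    fix n K assume K: "\<And>k. norm (g k) \<le> K"
    show "norm (g n) \<le> 1 + S * K"
      unfolding jostD(2)[OF g, of n]
      using Volterra_bound(2)[OF z K, of n] by (intro order_trans[OF norm_triangle_ineq4]) simp
  qed (use S_le in auto)
  then show ?thesis by simp
qed

lemma jost_near_1:
  assumes g: "jost z g" and z: "norm z \<le> 1"
  shows "norm (g n - 1) \<le> 2 * S"
proof -
  have "g n - 1 = - (\<Sum>k. odd_power_sum z (k - n) * of_real (V k) * g k)"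
    by (subst jostD(2)[OF g, of n]) simp
  moreover have "norm (\<Sum>k. odd_power_sum z (k - n) * of_real (V k) * g k) \<le> S * 2"
    by (rule Volterra_bound(2)[OF z]) (rule jost_bound[OF g z])
  ultimately show ?thesis by simp
qed

text \<open>The difference of two solutions satisfies a Volterra inequality of the same type; its
  inhomogeneity is the difference of the kernels applied to the bounded solution g, which is O(S |z
  - w|).\<close>

lemma jost_Lipschitz:
  assumes g: "jost z g" and z: "norm z \<le> 1" and h: "jost w h" and w: "norm w \<le> 1"
  shows "norm (g n - h n) \<le> 4 * S * norm (z - w)"
proof -
  note gb = jost_bound[OF g z] and hb = jost_bound[OF h w]
  have "norm (g n - h n) \<le> 2 * (2 * S * norm (z - w))"
  proof (rule contraction_bound[where C=4])
    show "norm (g n - h n) \<le> 4" for n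
      using norm_triangle_ineq4[of "g n" "h n"] gb[of n] hb[of n] by linarith
    fix n K assume K: "\<And>k. norm (g k - h k) \<le> K"
    have K': "norm (h k - g k) \<le> K" for k using K[of k] by (simp add: norm_minus_commute)
    have d: "norm (odd_power_sum w (k - n) - odd_power_sum z (k - n)) \<le> (real k)\<^sup>2 * norm (z - w)" for k
    proof -
      have "norm (odd_power_sum w (k - n) - odd_power_sum z (k - n)) \<le> (real (k - n))\<^sup>2 * norm (w - z)"
        by (rule norm_odd_power_sum_diff_le[OF w z])
      also have "\<dots> \<le> (real k)\<^sup>2 * norm (w - z)" by (intro mult_right_mono power_mono) auto
      finally show ?thesis by (simp add: norm_minus_commute)
    qed
    note s1 = Volterra_bound(1)[OF z gb, of n] and s2 = Volterra_bound(1)[OF w hb, of n]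
    note s3 = kernel_bound(1)[OF d gb] and s4 = Volterra_bound(1)[OF w K', of n]
    have "g n - h n = (\<Sum>k. odd_power_sum w (k - n) * of_real (V k) * h k) - (\<Sum>k. odd_power_sum z (k - n) * of_real (V k) * g k)"
      by (subst jostD(2)[OF g, of n], subst jostD(2)[OF h, of n]) simp
    also have "\<dots> = (\<Sum>k. odd_power_sum w (k - n) * of_real (V k) * h k - odd_power_sum z (k - n) * of_real (V k) * g k)"
      by (rule suminf_diff[OF s2 s1])
    also have "\<dots> = (\<Sum>k. (odd_power_sum w (k - n) - odd_power_sum z (k - n)) * of_real (V k) * g k + odd_power_sum w (k - n) * of_real (V k) * (h k - g k))"
      by (intro suminf_cong) (simp add: algebra_simps)
    also have "\<dots> = (\<Sum>k. (odd_power_sum w (k - n) - odd_power_sum z (k - n)) * of_real (V k) * g k) + (\<Sum>k. odd_power_sum w (k - n) * of_real (V k) * (h k - g k))"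
      by (rule suminf_add[OF s3 s4, symmetric])
    finally have "norm (g n - h n) \<le> S * (norm (z - w) * 2) + S * K"
      using norm_triangle_le[OF add_mono[OF kernel_bound(2)[OF d gb] Volterra_bound(2)[OF w K', of n]]] by simp
    then show "norm (g n - h n) \<le> 2 * S * norm (z - w) + S * K" by (simp add: mult_ac)
  qed (use S_le S_nonneg in auto)
  then show ?thesis by simp
qed

text \<open>Combining the Volterra equations at m, m + 1 and m + 2 with coefficients 1, -(1 + z^2)
  and z^2 cancels the kernel by \<open>odd_power_sum_rec\<close>, except at k = m + 1, where the
  truncated differences leave z. Multiplied by z^m, the result is the difference equation for z^n
  g_n.\<close>

lemma jost_rec:
  assumes g: "jost z g" and z: "norm z \<le> 1"
  shows "g m = (1 + z\<^sup>2) * g (Suc m) - z\<^sup>2 * g (Suc (Suc m)) - z * of_real (V (Suc m)) * g (Suc m)"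
proof -
  note gb = jost_bound[OF g z]
  let ?t = "\<lambda>n k. odd_power_sum z (k - n) * of_real (V k) * g k"
  have s: "?t n sums (1 - g n)" for n
  proof -
    have "summable (?t n)" by (rule Volterra_bound(1)[OF z]) (rule gb)
    from summable_sums[OF this] show ?thesis using jostD(2)[OF g, of n] by simp
  qed
  have "(\<lambda>k. ?t m k - (1 + z\<^sup>2) * ?t (Suc m) k + z\<^sup>2 * ?t (Suc (Suc m)) k) sums
      ((1 - g m) - (1 + z\<^sup>2) * (1 - g (Suc m)) + z\<^sup>2 * (1 - g (Suc (Suc m))))"
    by (intro sums_add sums_diff sums_mult s)
  moreover have "(\<lambda>k. ?t m k - (1 + z\<^sup>2) * ?t (Suc m) k + z\<^sup>2 * ?t (Suc (Suc m)) k) =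
      (\<lambda>k. if k = Suc m then z * of_real (V k) * g k else 0)"
  proof
    fix k
    have "?t m k - (1 + z\<^sup>2) * ?t (Suc m) k + z\<^sup>2 * ?t (Suc (Suc m)) k =
      (odd_power_sum z (k - m) - (1 + z\<^sup>2) * odd_power_sum z (k - Suc m) + z\<^sup>2 * odd_power_sum z (k - Suc (Suc m))) * of_real (V k) * g k"
      by (simp add: algebra_simps)
    also have "odd_power_sum z (k - m) - (1 + z\<^sup>2) * odd_power_sum z (k - Suc m) + z\<^sup>2 * odd_power_sum z (k - Suc (Suc m)) = (if k = Suc m then z else 0)"
    proof (cases "k \<le> Suc m")
      case True
      then show ?thesis by (cases "k = Suc m") auto
    next
      case False
      define j where "j = k - Suc (Suc m)"
      have j: "k - m = Suc (Suc j)" "k - Suc m = Suc j" "k - Suc (Suc m) = j" using False by (auto simp: j_def)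
      show ?thesis unfolding j odd_power_sum_rec using False by auto
    qed
    finally show "?t m k - (1 + z\<^sup>2) * ?t (Suc m) k + z\<^sup>2 * ?t (Suc (Suc m)) k = (if k = Suc m then z * of_real (V k) * g k else 0)"
      by simp
  qed
  ultimately have "(1 - g m) - (1 + z\<^sup>2) * (1 - g (Suc m)) + z\<^sup>2 * (1 - g (Suc (Suc m))) = z * of_real (V (Suc m)) * g (Suc m)"
    using sums_single[of "Suc m" "\<lambda>k. z * of_real (V k) * g k"] sums_unique2 by fastforce
  then show ?thesis by (simp add: algebra_simps)
qed

section \<open>The Jost solution as a square-summable vector\<close>

definition jost_vec :: "complex \<Rightarrow> (nat \<Rightarrow> complex) \<Rightarrow> nat \<Rightarrow> complex" where
  "jost_vec z g = (\<lambda>n. if n = 0 then 0 else z ^ n * g n)"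

lemma jost_vec_ell2:
  assumes g: "jost z g" and z: "cmod z < 1"
  shows "jost_vec z g \<in> ell2"
proof -
  have z1: "norm z \<le> 1" using z by simp
  have "summable (\<lambda>n. (cmod (jost_vec z g n))\<^sup>2)"
  proof (rule summable_comparison_test')
    have "(cmod z)\<^sup>2 < 1" using z by (simp add: power_less_one_iff abs_square_less_1)
    then show "summable (\<lambda>n. 4 * ((cmod z)\<^sup>2) ^ n)" by (intro summable_mult summable_geometric) simp
    fix n :: nat
    have "(cmod (z ^ n * g n))\<^sup>2 \<le> (cmod z ^ n * 2)\<^sup>2"
      unfolding norm_mult norm_power by (intro power_mono mult_left_mono jost_bound[OF g z1]) auto
    also have "\<dots> = 4 * ((cmod z)\<^sup>2) ^ n" by (simp add: power_mult_distrib power_mult[symmetric] mult.commute)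
    finally show "norm ((cmod (jost_vec z g n))\<^sup>2) \<le> 4 * ((cmod z)\<^sup>2) ^ n"
      by (auto simp: jost_vec_def)
  qed
  then show ?thesis by (simp add: ell2_def jost_vec_def)
qed

text \<open>The vector is 0 at index 0, where the Jost solution has the value \<open>g 0\<close>.
  This missing neighbour at n = 1 and the shifted first diagonal entry produce the source term,
  whose coefficient is the Jost function of the boundary condition with \<tau> = tan
  \<beta>.\<close>

lemma jacobi_jost_vec:
  assumes g: "jost z g" and z: "cmod z < 1" "z \<noteq> 0" and n: "n \<ge> 1"
  shows "jacobi (\<lambda>n. V n - (if n = 1 then \<tau> else 0)) (jost_vec z g) n =
    (z + 1 / z) * jost_vec z g n - (g 0 + of_real \<tau> * (z * g 1)) * delta 1 n"
proof -
  obtain m where m: "n = Suc m" using n by (cases n) auto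
  have z1: "norm z \<le> 1" using z by simp
  have r: "z ^ m * g m = (z + 1 / z) * (z ^ Suc m * g (Suc m)) - z ^ Suc (Suc m) * g (Suc (Suc m)) - of_real (V (Suc m)) * (z ^ Suc m * g (Suc m))"
    by (subst jost_rec[OF g z1]) (use z(2) in \<open>simp add: power2_eq_square field_simps\<close>)
  show ?thesis
  proof (cases "m = 0")
    case True
    then show ?thesis using r by (simp add: m jacobi_def jost_vec_def delta_def algebra_simps)
  next
    case False
    then show ?thesis using r by (simp add: m jacobi_def jost_vec_def delta_def algebra_simps)
  qed
qed

lemma cmod_jost_0_ge:
  assumes "jost z g" "norm z \<le> 1" shows "1 / 2 \<le> cmod (g 0)"
proof -
  have "norm (1 :: complex) \<le> norm (g 0) + norm (1 - g 0)" using norm_triangle_ineq[of "g 0" "1 - g 0"] by simp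
  then show ?thesis using jost_near_1[OF assms, of 0] S_le by (simp add: norm_minus_commute)
qed

text \<open>The Jost function for the condition \<open>u(0) + u(1) = 0\<close> is a perturbation of \<open>1 + z\<close>. Its value
  \<open>A\<close> at \<open>-1\<close> is real; on the unit circle \<open>|A + (1 + z)|\<^sup>2 = (1 + A) |1 + z|\<^sup>2 + A\<^sup>2\<close>, and a little
  inside the circle the same lower bound survives.\<close>

lemma cmod_jost_sum_ge:
  "\<exists>s>0. \<forall>z g. jost z g \<longrightarrow> cmod z \<le> 1 \<longrightarrow> 1 - (cmod z)\<^sup>2 \<le> s \<longrightarrow> cmod (1 + z) / 2 \<le> cmod (g 0 + z * g 1)"
proof -
  obtain h :: "nat \<Rightarrow> real" where h: "jost (-1) h" using jost_exists[of "-1 :: real"] by auto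
  define A where "A = h 0 - h 1"
  \<comment> \<open>The approximation A + 1 + z vanishes at z = -1 - A, inside the disc if A < 0.
    There 1 - |z|^2 = 2 |A| - A^2 exceeds |A|, so the condition 1 - |z|^2 <= |A| keeps z away from
    this zero. For A >= 0 any s would do.\<close>
  define s where "s = (if A < 0 then \<bar>A\<bar> else 1)"
  have n1: "norm (-1 :: real) \<le> 1" by simp
  have A_le: "\<bar>A\<bar> \<le> 1 / 25"
    using jost_near_1[OF h n1, of 0] jost_near_1[OF h n1, of 1] S_le unfolding A_def real_norm_def by linarith
  \<comment> \<open>The real solution at -1 is also the complex one, which makes A a real
    number.\<close>
  define H where "H = (\<lambda>n. complex_of_real (h n))"
  have H: "jost (-1) H"
    unfolding jost_def
  proof (intro conjI allI)
    show "\<exists>C. \<forall>n. norm (H n) \<le> C" using jostD(1)[OF h] by (simp add: H_def)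
    fix n
    have d: "odd_power_sum (-1 :: complex) k = complex_of_real (odd_power_sum (-1) k)" for k by (simp add: odd_power_sum_def)
    have "(\<lambda>k. odd_power_sum (-1) (k - n) * of_real (V k) * h k) sums (1 - h n)"
      using summable_sums[OF Volterra_bound(1)[OF n1 jost_bound[OF h n1], of n]] jostD(2)[OF h, of n] by simp
    then have "(\<lambda>k. complex_of_real (odd_power_sum (-1) (k - n) * of_real (V k) * h k)) sums complex_of_real (1 - h n)"
      by (simp only: sums_of_real_iff)
    then show "H n = 1 - (\<Sum>k. odd_power_sum (-1) (k - n) * of_real (V k) * H k)"
      by (simp add: d H_def sums_iff)
  qed
  show ?thesis
  proof (intro exI[of _ s] conjI allI impI)
    show "s > 0" by (simp add: s_def)
    fix z :: complex and g assume g: "jost z g" and z: "cmod z \<le> 1" and zs: "1 - (cmod z)\<^sup>2 \<le> s"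
    define w where "w = 1 + z"
    have L: "cmod (g n - H n) \<le> 4 * S * cmod w" for n
      using jost_Lipschitz[OF g _ H, of n] z by (simp add: w_def add.commute)
    have H1: "cmod (H 1 - 1) \<le> 2 * S" using jost_near_1[OF H, of 1] by simp
    \<comment> \<open>Expansion around z = -1: each error carries a factor |1 + z|, by the Lipschitz
      bound or explicitly, so it is small relative to the main term even at the zero of 1 +
      z.\<close>
    have "(g 0 + z * g 1) - (of_real A + w) = (g 0 - H 0) + z * (g 1 - H 1) + w * (H 1 - 1)"
      by (simp add: A_def w_def H_def algebra_simps)
    also have "cmod \<dots> \<le> cmod (g 0 - H 0) + cmod (z * (g 1 - H 1)) + cmod (w * (H 1 - 1))"
      by (intro norm_triangle_le add_mono) auto
    also have "\<dots> \<le> 4 * S * cmod w + 1 * (4 * S * cmod w) + cmod w * (2 * S)"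
      unfolding norm_mult by (intro add_mono mult_mono L z H1) auto
    also have "\<dots> = S * (10 * cmod w)" by (simp add: algebra_simps)
    also have "\<dots> \<le> 1 / 100 * (10 * cmod w)" using S_le by (intro mult_right_mono) auto
    finally have diff: "cmod ((g 0 + z * g 1) - (of_real A + w)) \<le> cmod w / 10" by simp
    have e: "(cmod (of_real A + w))\<^sup>2 = (1 + A) * (cmod w)\<^sup>2 + A\<^sup>2 + A * (1 - (cmod z)\<^sup>2)"
      unfolding cmod_power2 by (simp add: w_def power2_eq_square algebra_simps)
    have "(1 - \<bar>A\<bar>) * (cmod w)\<^sup>2 \<le> (cmod (of_real A + w))\<^sup>2"
    proof (cases "A < 0")
      case True
      then have "A * s \<le> A * (1 - (cmod z)\<^sup>2)" using zs by (intro mult_left_mono_neg) auto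
      moreover have "A * s = - A\<^sup>2" using True by (simp add: s_def power2_eq_square)
      ultimately show ?thesis unfolding e using True by simp
    next
      case False
      have "0 \<le> A * (1 - (cmod z)\<^sup>2)" using False z by (intro mult_nonneg_nonneg) (auto simp: power_le_one)
      moreover have "(1 - \<bar>A\<bar>) * (cmod w)\<^sup>2 \<le> (1 + A) * (cmod w)\<^sup>2" using False by (intro mult_right_mono) auto
      ultimately show ?thesis unfolding e using zero_le_power2[of A] by linarith
    qed
    \<comment> \<open>9/25 is far below 1 - |A| >= 24/25; what matters is that 3/5 minus the error
      1/10 is 1/2.\<close>
    moreover have "(3 / 5 * cmod w)\<^sup>2 \<le> (1 - \<bar>A\<bar>) * (cmod w)\<^sup>2"
      unfolding power_mult_distrib using A_le by (intro mult_right_mono) (auto simp: power2_eq_square)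
    ultimately have "(3 / 5 * cmod w)\<^sup>2 \<le> (cmod (of_real A + w))\<^sup>2" by linarith
    then have "3 / 5 * cmod w \<le> cmod (of_real A + w)" by (rule power2_le_imp_le) simp
    moreover have "cmod (of_real A + w) \<le> cmod (g 0 + z * g 1) + cmod ((g 0 + z * g 1) - (of_real A + w))"
      using norm_triangle_sub[of "of_real A + w" "g 0 + z * g 1"] by (simp add: norm_minus_commute)
    ultimately show "cmod (1 + z) / 2 \<le> cmod (g 0 + z * g 1)" using diff unfolding w_def by linarith
  qed
qed

end

text \<open>The two roots of z^2 - E z + 1 are inverse to each other and off the unit circle because
  E is not real. The last bound is uniform up to the band edges, where dE/dz vanishes at z = 1 and z
  = -1 and 1 - |z|^2 shrinks only like the square root of \<eta>.\<close>

lemma Joukowski_inverse: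
  assumes \<eta>: "\<eta> > 0" and x: "x \<in> {-2..2}"
  obtains z where "z \<noteq> 0" "cmod z < 1" "z + 1 / z = Complex x \<eta>" "(1 - (cmod z)\<^sup>2)\<^sup>2 \<le> 2 * \<eta>"
proof -
  define E where "E = Complex x \<eta>"
  define r where "r = (E + csqrt (E\<^sup>2 - 4)) / 2"
  have quad: "r * (E - r) = 1"
  proof -
    have "r * (E - r) = (E\<^sup>2 - (csqrt (E\<^sup>2 - 4))\<^sup>2) / 4" by (simp add: r_def field_simps power2_eq_square)
    then show ?thesis by simp
  qed
  then have r0: "r \<noteq> 0" by auto
  have rE: "r + 1 / r = E" using quad r0 by (simp add: field_simps)
  have r1: "cmod r \<noteq> 1"
  proof
    assume "cmod r = 1"
    then have "1 / r = cnj r" using complex_norm_square[of r] r0 by (simp add: field_simps)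
    then have "Im E = 0" using rE by (metis Im_complex_of_real complex_add_cnj)
    then show False using \<eta> by (simp add: E_def)
  qed
  define z where "z = (if cmod r < 1 then r else 1 / r)"
  have z: "z \<noteq> 0" "cmod z < 1" "z + 1 / z = E"
    using r0 r1 rE by (auto simp: z_def norm_divide field_simps)
  define p where "p = (cmod z)\<^sup>2"
  have p: "0 < p" "p < 1" using z by (auto simp: p_def abs_square_less_1)
  have pz: "p = (Re z)\<^sup>2 + (Im z)\<^sup>2" by (simp add: p_def cmod_power2)
  \<comment> \<open>Multiplying E = z + cnj z / p by p separates real and imaginary parts. The
    condition |x| <= 2 bounds (Re z)^2 from above, hence (Im z)^2 from below, and p (p + 1)^2 - 4
    p^2 = p (1 - p)^2 yields the fourth power of 1 - p.\<close>
  have re: "x * p = Re z * (p + 1)" and im: "\<eta> * p = Im z * (p - 1)"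
  proof -
    have "1 / z = cnj z / of_real p" unfolding p_def complex_norm_square using z(1) by simp
    then have "E = z + cnj z / of_real p" using z(3) by simp
    then have "E * of_real p = z * of_real p + cnj z" using p by (simp add: field_simps)
    from arg_cong[OF this, of Re] arg_cong[OF this, of Im]
    show "x * p = Re z * (p + 1)" "\<eta> * p = Im z * (p - 1)" by (simp_all add: E_def algebra_simps)
  qed
  have "(x * p)\<^sup>2 \<le> (2 * p)\<^sup>2"
    using x p by (intro power2_le_iff_abs_le[THEN iffD2]) (auto simp: abs_mult intro!: mult_right_mono)
  then have a: "(Re z)\<^sup>2 * (p + 1)\<^sup>2 \<le> 4 * p\<^sup>2" unfolding re by (simp add: power_mult_distrib)
  have "(\<eta> * p)\<^sup>2 * (p + 1)\<^sup>2 = (Im z)\<^sup>2 * (p + 1)\<^sup>2 * (p - 1)\<^sup>2"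
    unfolding im by (simp add: power_mult_distrib mult_ac)
  also have "(Im z)\<^sup>2 * (p + 1)\<^sup>2 = p * (p + 1)\<^sup>2 - (Re z)\<^sup>2 * (p + 1)\<^sup>2" using pz by (simp add: algebra_simps)
  finally have "(\<eta> * p)\<^sup>2 * (p + 1)\<^sup>2 = (p * (p + 1)\<^sup>2 - (Re z)\<^sup>2 * (p + 1)\<^sup>2) * (p - 1)\<^sup>2" .
  moreover have "(p * (p + 1)\<^sup>2 - 4 * p\<^sup>2) * (p - 1)\<^sup>2 \<le> (p * (p + 1)\<^sup>2 - (Re z)\<^sup>2 * (p + 1)\<^sup>2) * (p - 1)\<^sup>2"
    using a by (intro mult_right_mono) auto
  moreover have "(p * (p + 1)\<^sup>2 - 4 * p\<^sup>2) * (p - 1)\<^sup>2 = p * ((1 - p)\<^sup>2)\<^sup>2"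
    by (simp add: power2_eq_square algebra_simps)
  ultimately have "p * ((1 - p)\<^sup>2)\<^sup>2 \<le> p * (\<eta>\<^sup>2 * p * (p + 1)\<^sup>2)" by (simp add: power_mult_distrib power2_eq_square mult_ac)
  then have "((1 - p)\<^sup>2)\<^sup>2 \<le> \<eta>\<^sup>2 * p * (p + 1)\<^sup>2" using p by simp
  also have "\<dots> \<le> \<eta>\<^sup>2 * 1 * 2\<^sup>2" using p \<eta> by (intro mult_mono power_mono) auto
  also have "\<dots> = (2 * \<eta>)\<^sup>2" by (simp add: power_mult_distrib)
  finally have "(1 - p)\<^sup>2 \<le> 2 * \<eta>" by (rule power2_le_imp_le) (use \<eta> in simp)
  then show ?thesis using that[of z] z unfolding p_def E_def by blast
qed

section \<open>Spectral measures of small perturbations\<close>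

lemma schroedinger_eq_jacobi:
  assumes "u \<in> ell2"
  shows "schroedinger \<beta> V u = jacobi (\<lambda>n. V n - (if n = 1 then tan \<beta> else 0)) u"
proof
  fix n
  show "schroedinger \<beta> V u n = jacobi (\<lambda>n. V n - (if n = 1 then tan \<beta> else 0)) u n"
    using ell2_zero[OF assms] by (cases "n = 0"; cases "n = 1") (auto simp: schroedinger_def extend_bc_def jacobi_def algebra_simps)
qed

context jacobi_calculus
begin

text \<open>By cyclicity it suffices to control \<open>delta 1\<close>: its null sets are null for
  every spectral measure.\<close>

lemma purely_ac_onI:
  assumes le: "\<And>A. A \<in> sets borel \<Longrightarrow>
    emeasure (spectral_measure Hop (delta 1)) (A \<inter> {-2..2}) \<le> (\<integral>\<^sup>+x. w x * indicator A x \<partial>lborel)"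
    and w: "w \<in> borel_measurable borel"
  shows "purely_ac_on Hop {-2..2}"
  unfolding purely_ac_on_def absolutely_continuous_def
proof (intro ballI subsetI)
  fix \<psi> and A :: "real set" assume \<psi>: "\<psi> \<in> ell2" and A: "A \<in> null_sets lborel"
  then have Ab: "A \<in> sets borel" and A0: "emeasure lborel A = 0" by auto
  let ?B = "A \<inter> {-2..2}"
  have B: "?B \<in> sets borel" using Ab by auto
  have "(\<integral>\<^sup>+x. w x * indicator A x \<partial>lborel) = 0"
    using w Ab by (subst nn_integral_0_iff_AE) (auto intro!: AE_I[of _ _ A] simp: A0 indicator_def)
  then have "emeasure (spectral_measure Hop (delta 1)) ?B = 0" using le[OF Ab] by simp
  then have "measure (spectral_measure Hop (delta 1)) ?B = 0" by (simp add: measure_def)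
  then have m0: "measure (spectral_measure Hop \<psi>) ?B = 0" by (rule null_delta1_imp_null[OF B _ \<psi>])
  interpret finite_measure "spectral_measure Hop \<psi>" by (rule finite_spectral_measure[OF \<psi>])
  have "indicator {-2..2} \<in> borel_measurable (spectral_measure Hop \<psi>)"
    by (rule borel_measurable_indicator) (simp add: sets_spectral_measure[OF \<psi>])
  then have "emeasure (density (spectral_measure Hop \<psi>) (indicator {-2..2})) A = emeasure (spectral_measure Hop \<psi>) ?B"
    using Ab by (subst emeasure_density) (auto simp: sets_spectral_measure[OF \<psi>] indicator_inter_arith[symmetric] Int_commute)
  then show "A \<in> null_sets (density (spectral_measure Hop \<psi>) (indicator {-2..2}))"
    using Ab m0 by (simp add: null_sets_def sets_spectral_measure[OF \<psi>] emeasure_eq_measure)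
qed

section \<open>Vectors obtained from the first basis vector by the calculus\<close>

lemma calc_delta1_cutoff:
  assumes f: "continuous_on {-2..2} f"
  shows "(\<lambda>x. if x \<in> {-2..2::real} then f x else 0 :: complex) \<in> bounded_borel"
proof -
  have "bounded (f ` {-2..2})" by (intro compact_imp_bounded compact_continuous_image f) auto
  then obtain K where K: "\<forall>y\<in>f ` {-2..2}. norm y \<le> K" unfolding bounded_iff by blast
  have "(\<lambda>x. indicator {-2..2} x *\<^sub>R f x) \<in> borel_measurable borel"
    by (rule borel_measurable_continuous_on_indicator[OF _ f]) simp
  also have "(\<lambda>x. indicator {-2..2} x *\<^sub>R f x) = (\<lambda>x. if x \<in> {-2..2} then f x else 0)"
    by (auto simp: indicator_def)
  finally show ?thesis
    by (rule bounded_borelI[where K="max 0 K"]) (use K in \<open>auto simp: le_max_iff_disj\<close>)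
qed

lemma calc_delta1_ell2: "continuous_on {-2..2} f \<Longrightarrow> calc_delta1 Hop f \<in> ell2"
  unfolding calc_delta1_def by (intro Psi_ell2 calc_delta1_cutoff d1)

text \<open>The new measure has density |f|^2, cut off to [-2,2], with respect to that of
  \<open>delta 1\<close>; the constant is the square of a bound for |f|.\<close>

lemma spectral_measure_calc_delta1_le:
  assumes f: "continuous_on {-2..2} f"
  shows "\<exists>K\<ge>0. \<forall>A\<in>sets borel. emeasure (spectral_measure Hop (calc_delta1 Hop f)) A
    \<le> ennreal K * emeasure (spectral_measure Hop (delta 1)) (A \<inter> {-2..2})"
proof -
  define F where "F = (\<lambda>x. if x \<in> {-2..2::real} then f x else 0 :: complex)"
  have F: "F \<in> bounded_borel" unfolding F_def by (rule calc_delta1_cutoff[OF f])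
  obtain K where K: "\<And>x. cmod (F x) \<le> K" using bounded_borelD(2)[OF F] by blast
  have \<psi>: "calc_delta1 Hop f = \<Psi> F (delta 1)" by (simp add: calc_delta1_def F_def)
  have \<psi>2: "\<Psi> F (delta 1) \<in> ell2" by (rule Psi_ell2[OF F d1])
  let ?\<mu> = "spectral_measure Hop (delta 1)"
  interpret \<mu>: finite_measure ?\<mu> by (rule finite_spectral_measure[OF d1])
  interpret \<nu>: finite_measure "spectral_measure Hop (\<Psi> F (delta 1))" by (rule finite_spectral_measure[OF \<psi>2])
  note [measurable_cong] = sets_spectral_measure[OF d1]
  note [measurable] = bounded_borelD(1)[OF F]
  have "emeasure (spectral_measure Hop (\<Psi> F (delta 1))) A \<le> ennreal (K\<^sup>2) * emeasure ?\<mu> (A \<inter> {-2..2})"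
    if A: "A \<in> sets borel" for A
  proof -
    note [measurable] = A
    have "complex_of_real (measure (spectral_measure Hop (\<Psi> F (delta 1))) A) = quad (\<Psi> F (delta 1)) (\<lambda>x. indicator A x)"
      unfolding measure_spectral_measure[OF \<psi>2 A] quad_indicator[OF \<psi>2 A] ..
    also have "\<dots> = quad (delta 1) (\<lambda>x. indicator A x * (cnj (F x) * F x))"
      by (rule quad_Psi[OF d1 F indicator_bounded_borel[OF A]])
    also have "\<dots> = (LINT x|?\<mu>. indicator A x * (cnj (F x) * F x))"
      by (intro quad_eq_integral d1 bounded_borel_mult bounded_borel_cnj F indicator_bounded_borel A)
    also have "\<dots> = (LINT x|?\<mu>. complex_of_real (indicator A x * (cmod (F x))\<^sup>2))"
    proof (intro Bochner_Integration.integral_cong refl)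
      fix x
      have "cnj (F x) * F x = complex_of_real ((cmod (F x))\<^sup>2)"
        using complex_norm_square[of "F x"] by (simp add: mult.commute)
      then show "indicator A x * (cnj (F x) * F x) = complex_of_real (indicator A x * (cmod (F x))\<^sup>2)"
        by (simp add: indicator_def)
    qed
    finally have m: "measure (spectral_measure Hop (\<Psi> F (delta 1))) A = (LINT x|?\<mu>. indicator A x * (cmod (F x))\<^sup>2)"
      unfolding integral_complex_of_real of_real_eq_iff .
    have mF: "(\<lambda>x. indicator A x * (cmod (F x))\<^sup>2) \<in> borel_measurable ?\<mu>" by measurable
    have mI: "(\<lambda>x. K\<^sup>2 * indicator (A \<inter> {-2..2}) x) \<in> borel_measurable ?\<mu>" by measurable
    have FK: "(cmod (F x))\<^sup>2 \<le> K\<^sup>2" for x using K[of x] by (intro power_mono) auto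
    have "(LINT x|?\<mu>. indicator A x * (cmod (F x))\<^sup>2) \<le> (LINT x|?\<mu>. K\<^sup>2 * indicator (A \<inter> {-2..2}) x)"
    proof (rule integral_mono)
      show "integrable ?\<mu> (\<lambda>x. indicator A x * (cmod (F x))\<^sup>2)"
        by (rule \<mu>.integrable_const_bound[of _ "K\<^sup>2", OF _ mF]) (auto simp: indicator_def FK)
      show "integrable ?\<mu> (\<lambda>x. K\<^sup>2 * indicator (A \<inter> {-2..2}) x)"
        by (rule \<mu>.integrable_const_bound[of _ "K\<^sup>2", OF _ mI]) (auto simp: indicator_def)
      show "indicator A x * (cmod (F x))\<^sup>2 \<le> K\<^sup>2 * indicator (A \<inter> {-2..2}) x" for x
        using FK[of x] by (auto simp: indicator_def F_def)
    qed
    also have "\<dots> = K\<^sup>2 * measure ?\<mu> (A \<inter> {-2..2})"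
      using A by (simp add: space_spectral_measure[OF d1] del: One_nat_def)
    finally show ?thesis
      unfolding \<nu>.emeasure_eq_measure \<mu>.emeasure_eq_measure m by (simp add: ennreal_mult[symmetric] ennreal_leI)
  qed
  then show ?thesis unfolding \<psi> by (intro exI[of _ "K\<^sup>2"]) auto
qed

lemma avg_return_prob_eq:
  assumes "\<psi> \<in> ell2"
  shows "avg_return_prob Hop \<psi> t =
    1 / t * integral {0..t} (\<lambda>s. (cmod (LINT x|spectral_measure Hop \<psi>. exp (- \<i> * of_real s * of_real x)))\<^sup>2)"
proof -
  have "ell2_inner \<psi> (evolution Hop s \<psi>) = (LINT x|spectral_measure Hop \<psi>. exp (- \<i> * of_real s * of_real x))" for s
  proof -
    have "(\<lambda>x. exp (- \<i> * of_real s * complex_of_real x)) \<in> bounded_borel"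
      by (rule bounded_borelI[where K=1]) (auto simp: norm_exp_eq_Re)
    from quad_eq_integral[OF assms this] show ?thesis unfolding quad_def evolution_def .
  qed
  then show ?thesis by (simp add: avg_return_prob_def)
qed

end

text \<open>Here \<tau> is tan \<beta>, so 1 for the threshold condition and 0 for Dirichlet; it is
  unrelated to the decay rate in the theorem.\<close>

locale small_schroedinger = small_potential V S + jacobi_calculus "\<lambda>n. V n - (if n = 1 then \<tau> else 0)" B Hop
  for V S \<tau> B Hop
begin

text \<open>The Weyl m-function at x + i \<eta>, that is, the Borel transform of the spectral
  measure of \<open>delta 1\<close>; clamping changes nothing on the spectrum.\<close>

definition m_fun :: "real \<Rightarrow> real \<Rightarrow> complex" where
  "m_fun x \<eta> = (LINT y|spectral_measure Hop (delta 1). 1 / (complex_of_real (clamp y) - Complex x \<eta>))"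

text \<open>The product of the Jost function and m is, up to sign, the first entry of the Jost
  vector. The product form avoids dividing by a Jost function that might vanish.\<close>

lemma jost_m_fun:
  assumes g: "jost z g" and z: "z \<noteq> 0" "cmod z < 1" and E: "z + 1 / z = Complex x \<eta>" and \<eta>: "\<eta> > 0"
  shows "cmod (g 0 + of_real \<tau> * (z * g 1)) * cmod (m_fun x \<eta>) \<le> 2"
proof -
  have "jost_vec z g 1 = - (g 0 + of_real \<tau> * (z * g 1)) * m_fun x \<eta>"
    unfolding m_fun_def E[symmetric]
  proof (rule resolvent_formula)
    show "jost_vec z g \<in> ell2" by (rule jost_vec_ell2[OF g z(2)])
    show "Im (z + 1 / z) \<noteq> 0" unfolding E using \<eta> by simp
    show "jacobi (\<lambda>n. V n - (if n = 1 then \<tau> else 0)) (jost_vec z g) n =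
        (z + 1 / z) * jost_vec z g n - (g 0 + of_real \<tau> * (z * g 1)) * delta 1 n" if "n \<ge> 1" for n
      by (rule jacobi_jost_vec[OF g z(2,1) that])
  qed
  then have "cmod (g 0 + of_real \<tau> * (z * g 1)) * cmod (m_fun x \<eta>) = cmod (jost_vec z g 1)"
    by (simp only: norm_mult norm_minus_cancel)
  also have "\<dots> = cmod z * cmod (g 1)" by (simp add: jost_vec_def norm_mult)
  also have "\<dots> \<le> 1 * 2" using z by (intro mult_mono jost_bound[OF g]) auto
  finally show ?thesis by simp
qed

lemma m_fun_bound_Dirichlet:
  assumes "\<tau> = 0" "\<eta> > 0" "x \<in> {-2..2}"
  shows "cmod (m_fun x \<eta>) \<le> 4"
proof -
  obtain z where z: "z \<noteq> 0" "cmod z < 1" "z + 1 / z = Complex x \<eta>" "(1 - (cmod z)\<^sup>2)\<^sup>2 \<le> 2 * \<eta>"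
    by (rule Joukowski_inverse[OF assms(2,3)])
  then have z1: "cmod z \<le> 1" by simp
  obtain g where g: "jost z g" using jost_exists[OF z1] by blast
  have "cmod (g 0) * cmod (m_fun x \<eta>) \<le> 2" using jost_m_fun[OF g z(1-3) assms(2)] assms(1) by simp
  moreover have "1 / 2 * cmod (m_fun x \<eta>) \<le> cmod (g 0) * cmod (m_fun x \<eta>)"
    by (intro mult_right_mono cmod_jost_0_ge[OF g z1]) auto
  ultimately show ?thesis by linarith
qed

text \<open>The identity z (E + 2) = (1 + z)^2 converts the lower bound |1 + z|/2 for the Jost
  function into a multiple of the square root of |E + 2|.\<close>

lemma m_fun_bound_threshold:
  assumes "\<tau> = 1"
  shows "\<exists>\<eta>0>0. \<forall>\<eta> x. 0 < \<eta> \<longrightarrow> \<eta> < \<eta>0 \<longrightarrow> x \<in> {-2..2} \<longrightarrow> cmod (m_fun x \<eta>) \<le> 6 / sqrt (cmod (Complex (x + 2) \<eta>))"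
proof -
  obtain s where s: "s > 0" and F: "\<And>z g. jost z g \<Longrightarrow> cmod z \<le> 1 \<Longrightarrow> 1 - (cmod z)\<^sup>2 \<le> s \<Longrightarrow> cmod (1 + z) / 2 \<le> cmod (g 0 + z * g 1)"
    using cmod_jost_sum_ge by blast
  \<comment> \<open>Through (1 - |z|^2)^2 <= 2 \<eta>, the first entry gives 1 - |z|^2 <= s and the
    second gives |z| >= 1/2.\<close>
  define \<eta>0 where "\<eta>0 = min (s\<^sup>2 / 2) (1 / 4)"
  have \<eta>0: "\<eta>0 > 0" using s by (simp add: \<eta>0_def)
  show ?thesis
  proof (intro exI[of _ \<eta>0] conjI allI impI \<eta>0)
    fix \<eta> x :: real assume \<eta>: "0 < \<eta>" "\<eta> < \<eta>0" and x: "x \<in> {-2..2}"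
    obtain z where z: "z \<noteq> 0" "cmod z < 1" "z + 1 / z = Complex x \<eta>" "(1 - (cmod z)\<^sup>2)\<^sup>2 \<le> 2 * \<eta>"
      by (rule Joukowski_inverse[OF \<eta>(1) x])
    then have z1: "cmod z \<le> 1" by simp
    obtain g where g: "jost z g" using jost_exists[OF z1] by blast
    have "(1 - (cmod z)\<^sup>2)\<^sup>2 \<le> s\<^sup>2" using z(4) \<eta>(2) unfolding \<eta>0_def by linarith
    then have zs: "1 - (cmod z)\<^sup>2 \<le> s" by (rule power2_le_imp_le) (use s in simp)
    have "(1 - (cmod z)\<^sup>2)\<^sup>2 \<le> 1 / 2" using z(4) \<eta>(2) unfolding \<eta>0_def by linarith
    also have "\<dots> \<le> (3 / 4)\<^sup>2" by (simp add: power2_eq_square)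
    finally have "(1 - (cmod z)\<^sup>2)\<^sup>2 \<le> (3 / 4)\<^sup>2" .
    then have "1 - (cmod z)\<^sup>2 \<le> 3 / 4" by (rule power2_le_imp_le) simp
    moreover have "(1 / 2)\<^sup>2 = 1 / (4 :: real)" by (simp add: power2_eq_square)
    ultimately have "(1 / 2)\<^sup>2 \<le> (cmod z)\<^sup>2" by linarith
    then have zh: "1 / 2 \<le> cmod z" by (rule power2_le_imp_le) simp
    define M where "M = cmod (m_fun x \<eta>)"
    define D where "D = cmod (Complex (x + 2) \<eta>)"
    have D: "D > 0" using \<eta> by (simp add: D_def complex_eq_iff)
    have "Complex (x + 2) \<eta> = z + 1 / z + 2" unfolding z(3) by (simp add: complex_eq_iff)
    then have "z * Complex (x + 2) \<eta> = (1 + z)\<^sup>2" using z(1) by (simp add: field_simps power2_eq_square)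
    then have "cmod z * D = (cmod (1 + z))\<^sup>2" unfolding D_def by (metis norm_mult norm_power)
    moreover have "1 / 2 * D \<le> cmod z * D" using zh D by (intro mult_right_mono) auto
    ultimately have wD: "D \<le> 2 * (cmod (1 + z))\<^sup>2" by linarith
    have "cmod (1 + z) / 2 * M \<le> cmod (g 0 + z * g 1) * M"
      unfolding M_def by (intro mult_right_mono F[OF g z1 zs]) auto
    also have "\<dots> \<le> 2" using jost_m_fun[OF g z(1-3) \<eta>(1)] assms by (simp add: M_def)
    finally have wM: "cmod (1 + z) * M \<le> 4" by simp
    have "M\<^sup>2 * D \<le> M\<^sup>2 * (2 * (cmod (1 + z))\<^sup>2)" by (intro mult_left_mono wD) auto
    also have "\<dots> = 2 * (cmod (1 + z) * M)\<^sup>2" by (simp add: power_mult_distrib)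
    also have "\<dots> \<le> 2 * 4\<^sup>2" by (intro mult_left_mono power_mono wM) (auto simp: M_def)
    \<comment> \<open>The bound obtained is 32, rounded up to the square of 6.\<close>
    finally have "(M * sqrt D)\<^sup>2 \<le> 6\<^sup>2" using D by (simp add: power_mult_distrib)
    then have "M * sqrt D \<le> 6" by (rule power2_le_imp_le) simp
    then show "cmod (m_fun x \<eta>) \<le> 6 / sqrt (cmod (Complex (x + 2) \<eta>))"
      using D by (simp add: M_def D_def le_divide_eq)
  qed
qed

lemma delta1_mass_Dirichlet:
  assumes "\<tau> = 0" and A: "A \<in> sets borel"
  shows "emeasure (spectral_measure Hop (delta 1)) (A \<inter> {-2..2}) \<le> (\<integral>\<^sup>+x. ennreal 4 * indicator {-2<..<2} x * indicator A x \<partial>lborel)"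
proof (rule Stieltjes_upper_bound[where c=clamp and W="\<lambda>x. 4" and \<rho>=1 and C=4, OF finite_spectral_measure[OF d1] sets_spectral_measure[OF d1]])
  show "cmod (LINT y|spectral_measure Hop (delta 1). 1 / (complex_of_real (clamp y) - Complex x \<eta>)) \<le> 4"
    if "0 < \<eta>" "x \<in> {-2<..<2}" for x \<eta>
    using m_fun_bound_Dirichlet[OF assms(1) that(1), of x] that(2) by (simp add: m_fun_def)
  show "\<eta> * cmod (LINT y|spectral_measure Hop (delta 1). 1 / (complex_of_real (clamp y) - Complex x \<eta>)) \<le> 4 * sqrt \<eta>"
    if "0 < \<eta>" "\<eta> < 1" "x \<in> {-2, 2}" for x \<eta>
  proof -
    have "\<eta> * cmod (m_fun x \<eta>) \<le> \<eta> * 4" using that by (intro mult_left_mono m_fun_bound_Dirichlet assms) auto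
    also have "\<eta> \<le> sqrt \<eta>" using that by (intro real_le_rsqrt) (simp add: power2_eq_square mult_left_le)
    finally show ?thesis by (simp add: m_fun_def)
  qed
  show "(\<integral>\<^sup>+x. ennreal 4 * indicator {-2<..<2::real} x \<partial>lborel) < \<infinity>"
    by (simp add: nn_integral_cmult_indicator ennreal_mult_less_top)
qed (use A clamp_eq borel_measurable_clamp in auto)

lemma delta1_mass_threshold:
  assumes "\<tau> = 1" and A: "A \<in> sets borel"
  shows "emeasure (spectral_measure Hop (delta 1)) (A \<inter> {-2..2})
    \<le> (\<integral>\<^sup>+x. ennreal (6 / sqrt \<bar>2 + x\<bar>) * indicator {-2<..<2} x * indicator A x \<partial>lborel)"
proof -
  obtain \<eta>0 where \<eta>0: "\<eta>0 > 0" and b: "\<And>\<eta> x. 0 < \<eta> \<Longrightarrow> \<eta> < \<eta>0 \<Longrightarrow> x \<in> {-2..2} \<Longrightarrow> cmod (m_fun x \<eta>) \<le> 6 / sqrt (cmod (Complex (x + 2) \<eta>))"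
    using m_fun_bound_threshold[OF assms(1)] by blast
  show ?thesis
  proof (rule Stieltjes_upper_bound[where c=clamp and \<rho>=\<eta>0 and C=6, OF finite_spectral_measure[OF d1] sets_spectral_measure[OF d1]])
    show "cmod (LINT y|spectral_measure Hop (delta 1). 1 / (complex_of_real (clamp y) - Complex x \<eta>)) \<le> 6 / sqrt \<bar>2 + x\<bar>"
      if "0 < \<eta>" "\<eta> < \<eta>0" "x \<in> {-2<..<2}" for x \<eta>
    proof -
      have p: "0 < \<bar>2 + x\<bar>" using that by simp
      have le: "\<bar>2 + x\<bar> \<le> cmod (Complex (x + 2) \<eta>)" using abs_Re_le_cmod[of "Complex (x + 2) \<eta>"] by (simp add: add.commute)
      then have "6 / sqrt (cmod (Complex (x + 2) \<eta>)) \<le> 6 / sqrt \<bar>2 + x\<bar>"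
        by (intro frac_le real_sqrt_le_mono le) (use p in auto)
      then show ?thesis using b[OF that(1,2), of x] that(3) by (simp add: m_fun_def)
    qed
    show "\<eta> * cmod (LINT y|spectral_measure Hop (delta 1). 1 / (complex_of_real (clamp y) - Complex x \<eta>)) \<le> 6 * sqrt \<eta>"
      if "0 < \<eta>" "\<eta> < \<eta>0" "x \<in> {-2, 2}" for x \<eta>
    proof -
      \<comment> \<open>At x = -2 the number E + 2 is purely imaginary, so only \<eta> bounds its
        modulus from below; the resulting growth of order 1/sqrt \<eta> is still too slow for a
        point mass.\<close>
      have le: "\<eta> \<le> cmod (Complex (x + 2) \<eta>)" using abs_Im_le_cmod[of "Complex (x + 2) \<eta>"] that by simp
      then have "6 / sqrt (cmod (Complex (x + 2) \<eta>)) \<le> 6 / sqrt \<eta>"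
        by (intro frac_le real_sqrt_le_mono le) (use that in auto)
      moreover have "cmod (m_fun x \<eta>) \<le> 6 / sqrt (cmod (Complex (x + 2) \<eta>))" using that by (intro b) auto
      ultimately have "\<eta> * cmod (m_fun x \<eta>) \<le> \<eta> * (6 / sqrt \<eta>)" using that by (intro mult_left_mono) auto
      also have "\<dots> = 6 * (\<eta> / sqrt \<eta>)" by simp
      also have "\<eta> / sqrt \<eta> = sqrt \<eta>" using that by (intro real_div_sqrt) simp
      finally show ?thesis by (simp add: m_fun_def)
    qed
    have "(\<integral>\<^sup>+x. ennreal (6 / sqrt \<bar>2 + x\<bar>) * indicator {-2<..<2} x \<partial>lborel)
      \<le> (\<integral>\<^sup>+x. 6 * (ennreal (1 / sqrt \<bar>2 + x\<bar>) * indicator {-2..-2 + 4} x) \<partial>lborel)"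
    proof (intro nn_integral_mono)
      fix x :: real
      have "ennreal (6 / sqrt \<bar>2 + x\<bar>) = 6 * ennreal (1 / sqrt \<bar>2 + x\<bar>)"
        using ennreal_mult[of 6 "1 / sqrt \<bar>2 + x\<bar>"] by simp
      then show "ennreal (6 / sqrt \<bar>2 + x\<bar>) * indicator {-2<..<2} x \<le> 6 * (ennreal (1 / sqrt \<bar>2 + x\<bar>) * indicator {-2..-2 + 4} x)"
        by (auto simp: indicator_def)
    qed
    also have "\<dots> = 6 * ennreal (2 * sqrt 4)"
      by (subst nn_integral_cmult) (measurable, simp only: nn_integral_inverse_sqrt zero_le_numeral)
    also have "\<dots> < \<infinity>" by (simp add: ennreal_mult_less_top)
    finally show "(\<integral>\<^sup>+x. ennreal (6 / sqrt \<bar>2 + x\<bar>) * indicator {-2<..<2} x \<partial>lborel) < \<infinity>" .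
  qed (use A clamp_eq borel_measurable_clamp \<eta>0 in auto)
qed

lemma calc_delta1_mass_le:
  assumes f: "continuous_on {-2..2} f" and W: "W \<in> borel_measurable borel" "\<And>x. 0 \<le> W x"
    and le: "\<And>A. A \<in> sets borel \<Longrightarrow> emeasure (spectral_measure Hop (delta 1)) (A \<inter> {-2..2})
      \<le> (\<integral>\<^sup>+x. ennreal (W x) * indicator {-2<..<2} x * indicator A x \<partial>lborel)"
  shows "\<exists>K\<ge>0. \<forall>A\<in>sets borel. emeasure (spectral_measure Hop (calc_delta1 Hop f)) A
      \<le> (\<integral>\<^sup>+x. ennreal (K * W x * indicator {-2<..<2} x) * indicator A x \<partial>lborel)"
proof -
  obtain K where K: "K \<ge> 0" and Kle: "\<And>A. A \<in> sets borel \<Longrightarrow> emeasure (spectral_measure Hop (calc_delta1 Hop f)) A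
    \<le> ennreal K * emeasure (spectral_measure Hop (delta 1)) (A \<inter> {-2..2})"
    using spectral_measure_calc_delta1_le[OF f] by blast
  note [measurable] = W(1)
  have "emeasure (spectral_measure Hop (calc_delta1 Hop f)) A
      \<le> (\<integral>\<^sup>+x. ennreal (K * W x * indicator {-2<..<2} x) * indicator A x \<partial>lborel)" if [measurable]: "A \<in> sets borel" for A
  proof -
    have "emeasure (spectral_measure Hop (calc_delta1 Hop f)) A
      \<le> ennreal K * (\<integral>\<^sup>+x. ennreal (W x) * indicator {-2<..<2} x * indicator A x \<partial>lborel)"
      by (rule order_trans[OF Kle[OF that]]) (intro mult_left_mono le that, simp)
    also have "\<dots> = (\<integral>\<^sup>+x. ennreal K * (ennreal (W x) * indicator {-2<..<2} x * indicator A x) \<partial>lborel)"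
      by (intro nn_integral_cmult[symmetric]) measurable
    also have "\<dots> = (\<integral>\<^sup>+x. ennreal (K * W x * indicator {-2<..<2} x) * indicator A x \<partial>lborel)"
      using K W by (intro nn_integral_cong) (auto simp: indicator_def ennreal_mult)
    finally show ?thesis .
  qed
  then show ?thesis using K by blast
qed

section \<open>Conclusions for the two boundary conditions\<close>

lemma Dirichlet_conclusions:
  assumes "\<tau> = 0"
  shows "purely_ac_on Hop {-2..2}"
    and "continuous_on {-2..2} f \<Longrightarrow> lipschitz_continuous_measure (spectral_measure Hop (calc_delta1 Hop f))"
    and "continuous_on {-2..2} f \<Longrightarrow> \<exists>\<eta>>0. \<forall>t>0. avg_return_prob Hop (calc_delta1 Hop f) t \<le> \<eta> * (1 / t)"
proof -
  note mass = delta1_mass_Dirichlet[OF assms]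
  show "purely_ac_on Hop {-2..2}" by (rule purely_ac_onI, rule mass, assumption, measurable)
  assume f: "continuous_on {-2..2} f"
  define \<nu> where "\<nu> = spectral_measure Hop (calc_delta1 Hop f)"
  have \<psi>: "calc_delta1 Hop f \<in> ell2" by (rule calc_delta1_ell2[OF f])
  obtain K where K: "K \<ge> 0" and le: "\<And>A. A \<in> sets borel \<Longrightarrow> emeasure \<nu> A \<le> (\<integral>\<^sup>+x. ennreal (K * 4 * indicator {-2<..<2} x) * indicator A x \<partial>lborel)"
    using calc_delta1_mass_le[OF f _ _ mass] unfolding \<nu>_def by auto
  show "lipschitz_continuous_measure (spectral_measure Hop (calc_delta1 Hop f))"
    unfolding \<nu>_def[symmetric]
  proof (rule holder_continuous_measureI)
    \<comment> \<open>The summand 1 keeps the constant positive if K = 0.\<close>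
    show "0 < 4 * K + 1" using K by simp
    fix I :: "real set" and h assume I: "I \<in> sets borel" and h: "0 < h" "emeasure lborel I = ennreal h"
    have "emeasure \<nu> I \<le> (\<integral>\<^sup>+x. ennreal (4 * K) * indicator I x \<partial>lborel)"
      using K by (intro order_trans[OF le[OF I]] nn_integral_mono) (auto simp: indicator_def)
    also have "\<dots> = ennreal (4 * K * h)" using I h K by (simp add: nn_integral_cmult_indicator ennreal_mult)
    also have "\<dots> \<le> ennreal ((4 * K + 1) * h powr 1)" using h by (intro ennreal_leI) (simp add: algebra_simps)
    finally show "emeasure \<nu> I \<le> ennreal ((4 * K + 1) * h powr 1)" .
  qed
  \<comment> \<open>The square of the density bound 4 K, times the length 4 of the band.\<close>
  define L where "L = 64 * K\<^sup>2"
  have L: "integral {0..t} (\<lambda>s. (cmod (LINT x|\<nu>. exp (- \<i> * of_real s * of_real x)))\<^sup>2) \<le> 4 * pi * L" if "t > 0" for t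
  proof (rule fourier_L2_le[OF _ _ _ le])
    show "sets \<nu> = sets borel" "finite_measure \<nu>"
      unfolding \<nu>_def by (rule sets_spectral_measure[OF \<psi>], rule finite_spectral_measure[OF \<psi>])
    have "(\<integral>\<^sup>+x. ennreal ((K * 4 * indicator {-2<..<2::real} x)\<^sup>2) \<partial>lborel) = (\<integral>\<^sup>+x. ennreal (16 * K\<^sup>2) * indicator {-2<..<2::real} x \<partial>lborel)"
      by (intro nn_integral_cong) (auto simp: indicator_def power_mult_distrib mult.commute)
    also have "\<dots> = ennreal (16 * K\<^sup>2) * ennreal 4" by (simp add: nn_integral_cmult_indicator)
    also have "\<dots> = ennreal L" by (simp add: L_def ennreal_mult[symmetric] del: ennreal_numeral)
    finally show "(\<integral>\<^sup>+x. ennreal ((K * 4 * indicator {-2<..<2::real} x)\<^sup>2) \<partial>lborel) \<le> ennreal L" by simp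
  qed (use K that in \<open>auto simp: L_def\<close>)
  show "\<exists>\<eta>>0. \<forall>t>0. avg_return_prob Hop (calc_delta1 Hop f) t \<le> \<eta> * (1 / t)"
  proof (intro exI[of _ "4 * pi * L + 1"] conjI allI impI)
    show "0 < 4 * pi * L + 1" by (simp add: L_def add_nonneg_pos)
    fix t :: real assume t: "t > 0"
    have "avg_return_prob Hop (calc_delta1 Hop f) t \<le> 1 / t * (4 * pi * L + 1)"
      unfolding avg_return_prob_eq[OF \<psi>] \<nu>_def[symmetric] using L[OF t] t by (intro mult_left_mono) auto
    then show "avg_return_prob Hop (calc_delta1 Hop f) t \<le> (4 * pi * L + 1) * (1 / t)" by (simp add: mult.commute)
  qed
qed

lemma threshold_conclusions:
  assumes "\<tau> = 1"
  shows "purely_ac_on Hop {-2..2}"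
    and "continuous_on {-2..2} f \<Longrightarrow> holder_continuous_measure (1 / 2) (spectral_measure Hop (calc_delta1 Hop f))"
    and "continuous_on {-2..2} f \<Longrightarrow> \<exists>\<gamma>'>0. \<forall>t>2. avg_return_prob Hop (calc_delta1 Hop f) t \<le> \<gamma>' * (ln t / t)"
proof -
  note mass = delta1_mass_threshold[OF assms]
  show "purely_ac_on Hop {-2..2}" by (rule purely_ac_onI, rule mass, assumption, measurable)
  assume f: "continuous_on {-2..2} f"
  define \<nu> where "\<nu> = spectral_measure Hop (calc_delta1 Hop f)"
  have \<psi>: "calc_delta1 Hop f \<in> ell2" by (rule calc_delta1_ell2[OF f])
  have "\<exists>K\<ge>0. \<forall>A\<in>sets borel. emeasure \<nu> A \<le> (\<integral>\<^sup>+x. ennreal (K * (6 / sqrt \<bar>2 + x\<bar>) * indicator {-2<..<2} x) * indicator A x \<partial>lborel)"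
    unfolding \<nu>_def by (rule calc_delta1_mass_le[OF f _ _ mass]) auto
  then obtain K where K: "K \<ge> 0" and le': "\<And>A. A \<in> sets borel \<Longrightarrow> emeasure \<nu> A \<le> (\<integral>\<^sup>+x. ennreal (K * (6 / sqrt \<bar>2 + x\<bar>) * indicator {-2<..<2} x) * indicator A x \<partial>lborel)"
    by blast
  define c where "c = 6 * K"
  have c: "0 \<le> c" using K by (simp add: c_def)
  have le: "emeasure \<nu> A \<le> (\<integral>\<^sup>+x. ennreal (c / sqrt \<bar>2 + x\<bar> * indicator {-2<..<2} x) * indicator A x \<partial>lborel)"
    if "A \<in> sets borel" for A
    using le'[OF that] by (simp add: c_def mult.commute)
  show "holder_continuous_measure (1 / 2) (spectral_measure Hop (calc_delta1 Hop f))"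
    unfolding \<nu>_def[symmetric]
  proof (rule holder_continuous_measureI)
    show "0 < 3 * c + 1" using c by simp
    fix I :: "real set" and h assume I [measurable]: "I \<in> sets borel" and h: "0 < h" "emeasure lborel I = ennreal h"
    have "emeasure \<nu> I \<le> (\<integral>\<^sup>+x. ennreal (c / sqrt \<bar>2 + x\<bar> * indicator {-2<..<2} x) * indicator I x \<partial>lborel)" by (rule le[OF I])
    also have "\<dots> = (\<integral>\<^sup>+x. ennreal c * (ennreal (1 / sqrt \<bar>2 + x\<bar>) * indicator {-2<..<2} x * indicator I x) \<partial>lborel)"
      using c by (intro nn_integral_cong) (auto simp: indicator_def ennreal_mult[symmetric])
    also have "\<dots> = ennreal c * (\<integral>\<^sup>+x. ennreal (1 / sqrt \<bar>2 + x\<bar>) * indicator {-2<..<2} x * indicator I x \<partial>lborel)"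
      by (intro nn_integral_cmult) measurable
    also have "\<dots> \<le> ennreal c * ennreal (3 * sqrt h)"
      by (intro mult_left_mono sqrt_density_mass_le[OF I h(2,1)]) simp
    also have "\<dots> = ennreal (3 * c * h powr (1 / 2))" using c h by (simp add: ennreal_mult[symmetric] powr_half_sqrt)
    also have "\<dots> \<le> ennreal ((3 * c + 1) * h powr (1 / 2))" using h by (intro ennreal_leI mult_right_mono) auto
    finally show "emeasure \<nu> I \<le> ennreal ((3 * c + 1) * h powr (1 / 2))" .
  qed
  define L where "L = 16 * c\<^sup>2 + 24 * pi * c\<^sup>2"
  have L: "integral {0..t} (\<lambda>s. (cmod (LINT x|\<nu>. exp (- \<i> * of_real s * of_real x)))\<^sup>2) \<le> L * ln t" if "t > 2" for t
    unfolding L_def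
  proof (rule return_bound_sqrt_density[OF _ _ c le that])
    show "sets \<nu> = sets borel" "finite_measure \<nu>"
      unfolding \<nu>_def by (rule sets_spectral_measure[OF \<psi>], rule finite_spectral_measure[OF \<psi>])
  qed
  show "\<exists>\<gamma>'>0. \<forall>t>2. avg_return_prob Hop (calc_delta1 Hop f) t \<le> \<gamma>' * (ln t / t)"
  proof (intro exI[of _ "L + 1"] conjI allI impI)
    show "0 < L + 1" by (simp add: L_def add_nonneg_pos)
    fix t :: real assume t: "t > 2"
    have "L * ln t \<le> (L + 1) * ln t" using t by (intro mult_right_mono) auto
    from order_trans[OF L[OF t] this]
    have "avg_return_prob Hop (calc_delta1 Hop f) t \<le> 1 / t * ((L + 1) * ln t)"
      unfolding avg_return_prob_eq[OF \<psi>] \<nu>_def[symmetric] by (rule mult_left_mono) (use t in simp)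
    then show "avg_return_prob Hop (calc_delta1 Hop f) t \<le> (L + 1) * (ln t / t)" by simp
  qed
qed

end

text \<open>With q = a^(-\<tau>) at most 1/9, the crude estimate n^2 <= 4^n already gives a
  geometric majorant of ratio 4 q < 1.\<close>

lemma summable_square_times_exponential:
  fixes \<gamma> a \<tau> :: real
  assumes "\<gamma> > 0" "a > 3" "\<tau> > 4" and b: "\<And>n. n \<ge> 1 \<Longrightarrow> \<bar>b n\<bar> \<le> \<gamma> * a powr (- \<tau> * real n)"
  shows "summable (\<lambda>n. (real n)\<^sup>2 * \<bar>b n\<bar>)" "\<And>n. n \<ge> 1 \<Longrightarrow> \<bar>b n\<bar> \<le> \<gamma>"
proof -
  define q where "q = a powr (- \<tau>)"
  have q0: "0 \<le> q" by (simp add: q_def)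
  have "q \<le> a powr (- 2)" unfolding q_def using assms by (intro powr_mono) auto
  also have "\<dots> = 1 / a\<^sup>2" using assms by (simp add: powr_minus_divide)
  also have "\<dots> \<le> 1 / 3\<^sup>2" using assms by (intro divide_left_mono power_mono) auto
  finally have q: "q \<le> 1 / 9" by simp
  have pq: "a powr (- \<tau> * real n) = q ^ n" for n
  proof -
    have "a powr (- \<tau> * real n) = q powr real n" unfolding q_def powr_powr ..
    also have "\<dots> = q ^ n" using assms by (intro powr_realpow) (simp add: q_def)
    finally show ?thesis .
  qed
  show "\<bar>b n\<bar> \<le> \<gamma>" if "n \<ge> 1" for n
  proof -
    have "\<gamma> * q ^ n \<le> \<gamma> * 1" using q0 q assms by (intro mult_left_mono power_le_one) auto
    then show ?thesis using b[OF that] unfolding pq by simp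
  qed
  show "summable (\<lambda>n. (real n)\<^sup>2 * \<bar>b n\<bar>)"
  proof (rule summable_comparison_test')
    show "summable (\<lambda>n. \<gamma> * (4 * q) ^ n)" using q q0 by (intro summable_mult summable_geometric) simp
    fix n :: nat assume n: "n \<ge> 1"
    have "(real n)\<^sup>2 \<le> (2 ^ n)\<^sup>2" by (intro power_mono) (use of_nat_less_two_power[of n, where 'a=real] in auto)
    also have "((2::real) ^ n)\<^sup>2 = (2\<^sup>2) ^ n" by (simp only: power_mult[symmetric] mult.commute)
    also have "(2\<^sup>2) ^ n = (4::real) ^ n" by simp
    finally have "(real n)\<^sup>2 * \<bar>b n\<bar> \<le> 4 ^ n * (\<gamma> * q ^ n)"
      using b[OF n] unfolding pq by (intro mult_mono) auto
    then show "norm ((real n)\<^sup>2 * \<bar>b n\<bar>) \<le> \<gamma> * (4 * q) ^ n" by (simp add: power_mult_distrib mult_ac)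
  qed
qed

theorem theorem1p1:
  fixes \<gamma> a \<tau> :: real and b :: "nat \<Rightarrow> real"
  assumes "\<gamma> > 0" and "a > 3" and "\<tau> > 4"
    and "bounded (b ` {1..})"
    and "\<And>n. n \<ge> 1 \<Longrightarrow> \<bar>b n\<bar> \<le> \<gamma> * a powr (- \<tau> * real n)"
  shows "\<exists>\<epsilon>>0. \<forall>\<kappa>::real. \<bar>\<kappa>\<bar> < \<epsilon> \<longrightarrow>
    (let H = schroedinger (pi / 4) (\<lambda>n. \<kappa> * b n) in
       purely_ac_on H {-2..2} \<and>
       (\<forall>f. continuous_on {-2..2} f \<longrightarrow>
          holder_continuous_measure (1 / 2) (spectral_measure H (calc_delta1 H f))) \<and>
       (\<forall>f. continuous_on {-2..2} f \<longrightarrow>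
          (\<exists>\<gamma>'>0. \<forall>t>2. avg_return_prob H (calc_delta1 H f) t \<le> \<gamma>' * (ln t / t)))) \<and>
    (let H = schroedinger_dirichlet (\<lambda>n. \<kappa> * b n) in
       purely_ac_on H {-2..2} \<and>
       (\<forall>f. continuous_on {-2..2} f \<longrightarrow>
          lipschitz_continuous_measure (spectral_measure H (calc_delta1 H f))) \<and>
       (\<forall>f. continuous_on {-2..2} f \<longrightarrow>
          (\<exists>\<eta>>0. \<forall>t>0. avg_return_prob H (calc_delta1 H f) t \<le> \<eta> * (1 / t))))"
proof -
  note sum = summable_square_times_exponential[OF assms(1-3,5)]
  define s where "s = (\<Sum>n. (real n)\<^sup>2 * \<bar>b n\<bar>)"
  have s0: "0 \<le> s" unfolding s_def by (intro suminf_nonneg sum(1)) auto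
  \<comment> \<open>Chosen so that |\<kappa>| s <= 1/100. It depends on b alone, through the
    weighted sum s; adding 1 guards against s = 0.\<close>
  define \<epsilon> where "\<epsilon> = 1 / (100 * (s + 1))"
  have \<epsilon>: "\<epsilon> > 0" using s0 by (simp add: \<epsilon>_def)
  show ?thesis
  proof (intro exI[of _ \<epsilon>] conjI allI impI \<epsilon>)
    fix \<kappa> :: real assume \<kappa>: "\<bar>\<kappa>\<bar> < \<epsilon>"
    define V where "V = (\<lambda>n. \<kappa> * b n)"
    have Vb: "\<bar>V n\<bar> \<le> \<bar>\<kappa>\<bar> * \<gamma>" if "n \<ge> 1" for n
      unfolding V_def abs_mult by (intro mult_left_mono sum(2) that) auto
    have Vs: "(\<lambda>n. (real n)\<^sup>2 * \<bar>V n\<bar>) sums (\<bar>\<kappa>\<bar> * s)"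
      using sums_mult[OF summable_sums[OF sum(1)], of "\<bar>\<kappa>\<bar>"] by (simp add: V_def s_def abs_mult mult_ac)
    have "\<bar>\<kappa>\<bar> * s \<le> \<epsilon> * (s + 1)" using \<kappa> s0 by (intro mult_mono) auto
    also have "\<dots> = 1 / 100" using s0 by (simp add: \<epsilon>_def)
    finally have small: "small_potential V (\<bar>\<kappa>\<bar> * s)"
      using Vs by unfold_locales (auto simp: sums_iff)
    \<comment> \<open>One instantiation for both operators: the boundary condition enters only
      through tan \<beta>, which is 1 or 0.\<close>
    have loc: "small_schroedinger V (\<bar>\<kappa>\<bar> * s) \<tau>' (\<bar>\<kappa>\<bar> * \<gamma> + \<bar>\<tau>'\<bar>) (schroedinger \<beta> V)" if t: "tan \<beta> = \<tau>'" for \<beta> \<tau>'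
    proof (intro small_schroedinger.intro small jacobi_calculus.intro bounded_jacobi.intro jacobi_calculus_axioms.intro)
      show "\<bar>V n - (if n = 1 then \<tau>' else 0)\<bar> \<le> \<bar>\<kappa>\<bar> * \<gamma> + \<bar>\<tau>'\<bar>" if "n \<ge> 1" for n
        using Vb[OF that] by (cases "n = 1") (auto intro: order_trans[OF abs_triangle_ineq4] add_mono)
      show "schroedinger \<beta> V u = jacobi (\<lambda>n. V n - (if n = 1 then \<tau>' else 0)) u" if "u \<in> ell2" for u
        by (simp only: schroedinger_eq_jacobi[OF that] t)
    qed
    interpret threshold: small_schroedinger V "\<bar>\<kappa>\<bar> * s" 1 "\<bar>\<kappa>\<bar> * \<gamma> + \<bar>1\<bar>" "schroedinger (pi / 4) V"
      by (rule loc) (simp add: tan_45)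
    interpret dirichlet: small_schroedinger V "\<bar>\<kappa>\<bar> * s" 0 "\<bar>\<kappa>\<bar> * \<gamma> + \<bar>0\<bar>" "schroedinger 0 V"
      by (rule loc) simp
    show "let H = schroedinger (pi / 4) (\<lambda>n. \<kappa> * b n) in
       purely_ac_on H {-2..2} \<and>
       (\<forall>f. continuous_on {-2..2} f \<longrightarrow>
          holder_continuous_measure (1 / 2) (spectral_measure H (calc_delta1 H f))) \<and>
       (\<forall>f. continuous_on {-2..2} f \<longrightarrow>
          (\<exists>\<gamma>'>0. \<forall>t>2. avg_return_prob H (calc_delta1 H f) t \<le> \<gamma>' * (ln t / t)))"
      unfolding Let_def V_def[symmetric] by (intro conjI allI impI threshold.threshold_conclusions[OF refl])
    show "let H = schroedinger_dirichlet (\<lambda>n. \<kappa> * b n) in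
       purely_ac_on H {-2..2} \<and>
       (\<forall>f. continuous_on {-2..2} f \<longrightarrow>
          lipschitz_continuous_measure (spectral_measure H (calc_delta1 H f))) \<and>
       (\<forall>f. continuous_on {-2..2} f \<longrightarrow>
          (\<exists>\<eta>>0. \<forall>t>0. avg_return_prob H (calc_delta1 H f) t \<le> \<eta> * (1 / t)))"
      unfolding Let_def V_def[symmetric] by (intro conjI allI impI dirichlet.Dirichlet_conclusions[OF refl])
  qed
qed

end
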